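(* Let $A$ be a standard Young tableau of shape $\alpha\vdash m$ and let $q>0$ be a real number; put $\bar q=\min(q,q^{-1})$. Then $$\lim_{n\to\infty} \frac{\displaystyle\sum_{T\in\mathcal{T}_n(A)}q^{\operatorname{maj}(T_{> m})}}{\displaystyle\sum_{T\in\mathcal{T}_n}q^{\operatorname{maj}(T_{> m})}} = \frac{f^{\alpha}(q) + (1-\bar q)\,E}{[m]_q!+ (1-\bar q)\,D},$$ where $E$ and $D$ are the following polynomials in $q$ and $\bar q$: $$E=\sum_{j=1}^m\genfrac{[}{]}{0pt}{}{m}{j}_q[j]_q!\,(1-\bar q)^{j-1}\sum_{\mu\vdash j}f^{\alpha/\mu}(q),\qquad D=[m]_q!\sum_{j=1}^m t_j\binom{m}{j}(1-\bar q)^{j-1}.$$ Equivalently, the limit equals $$\frac{\sum_{j=0}^m \genfrac{[}{]}{0pt}{}{m}{j}_q [j]_q!\,(1-\bar q)^j \sum_{\mu\vdash j} f^{\alpha/\mu}(q)}{\sum_{j=0}^m [m]_q!\, t_j \binom{m}{j} (1-\bar q)^j}.$$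
   Context: Partitions are identified with their Ferrers diagrams (left justified, row $i$ of length $\lambda_i$, rows numbered from the top). For $\mu\subset\lambda$, $\lambda/\mu$ is the set difference of diagrams; a skew standard Young tableau (skew SYT) of shape $\lambda/\mu$ and size $n=|\lambda|-|\mu|$ is a bijective filling of $\lambda/\mu$ with $1,\dots,n$ increasing along rows (left to right) and columns (top to bottom); it is a standard Young tableau (SYT) if $\mu=\emptyset$. $\mathcal{T}_n$ is the set of all SYTs of size $n$. For a SYT $T$, $T_{\le k}$ is the SYT obtained by deleting all squares with entries $>k$, and $T_{>k}$ is the skew SYT obtained by deleting all squares with entries $\le k$ and subtracting $k$ from the remaining entries. For $A$ a SYT of size $m$, $\mathcal{T}_n(A)=\{T\in\mathcal{T}_n: T_{\le m}=A\}$. A descent of a skew SYT $T$ of size $n$ is $i\in[n-1]$ such that $i+1$ is in a row lower than the row containing $i$; $\operatorname{maj}(T)$ is the sum of the descents of $T$. $f^{\lambda/\mu}(q)=\sum_T q^{\operatorname{maj}(T)}$ over all skew SYTs $T$ of shape $\lambda/\mu$ (zero if $\mu\not\subset\lambda$), $f^{\lambda}(q)=f^{\lambda/\emptyset}(q)$. $t_j$ is the number of involutions (identity included) in the symmetric group on $j$ letters. $[n]_q!=\prod_{i=1}^n(1+q+\cdots+q^{i-1})$ and $\genfrac{[}{]}{0pt}{}{n}{k}_q=\frac{[n]_q!}{[k]_q!\,[n-k]_q!}$. The convention $0^0=1$ is used. *)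

theory Defs
  imports Complex_Main "HOL-Combinatorics.Permutations"
begin

definition partitions_of :: "nat \<Rightarrow> nat list set" where
  "partitions_of n = {la. sorted_wrt (\<ge>) la \<and> 0 \<notin> set la \<and> sum_list la = n}"

text \<open>Cells are pairs (row, column), both counted from 0, rows numbered from the top.\<close>

definition diagram :: "nat list \<Rightarrow> (nat \<times> nat) set" where
  "diagram la = {(i, j). i < length la \<and> j < la ! i}"

definition skew_diagram :: "nat list \<Rightarrow> nat list \<Rightarrow> (nat \<times> nat) set" where
  "skew_diagram la mu = diagram la - diagram mu"

text \<open>A tableau is a function on all cells; entries are positive and the value 0 marks the cells
  outside the shape, so that tableaux are equal iff they have the same filled cells and entries.\<close>

type_synonym tableau = "nat \<times> nat \<Rightarrow> nat"

definition skew_SYT :: "nat list \<Rightarrow> nat list \<Rightarrow> tableau set" where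
  "skew_SYT la mu = {T. diagram mu \<subseteq> diagram la
     \<and> bij_betw T (skew_diagram la mu) {1..sum_list la - sum_list mu}
     \<and> (\<forall>c. c \<notin> skew_diagram la mu \<longrightarrow> T c = 0)
     \<and> (\<forall>i j j'. (i, j) \<in> skew_diagram la mu \<and> (i, j') \<in> skew_diagram la mu \<and> j < j'
            \<longrightarrow> T (i, j) < T (i, j'))
     \<and> (\<forall>i i' j. (i, j) \<in> skew_diagram la mu \<and> (i', j) \<in> skew_diagram la mu \<and> i < i'
            \<longrightarrow> T (i, j) < T (i', j))}"

definition SYT :: "nat list \<Rightarrow> tableau set" where
  "SYT la = skew_SYT la []"

definition SYT_size :: "nat \<Rightarrow> tableau set" where
  "SYT_size n = (\<Union>la\<in>partitions_of n. SYT la)"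

definition tab_le :: "nat \<Rightarrow> tableau \<Rightarrow> tableau" where
  "tab_le k T = (\<lambda>c. if T c \<le> k then T c else 0)"

definition tab_gt :: "nat \<Rightarrow> tableau \<Rightarrow> tableau" where
  "tab_gt k T = (\<lambda>c. if T c > k then T c - k else 0)"

text \<open>In \<open>SYT_extending n m A\<close>, \<open>m\<close> is the size of \<open>A\<close>.\<close>

definition SYT_extending :: "nat \<Rightarrow> nat \<Rightarrow> tableau \<Rightarrow> tableau set" where
  "SYT_extending n m A = {T \<in> SYT_size n. tab_le m T = A}"

definition tab_size :: "tableau \<Rightarrow> nat" where
  "tab_size T = card {c. T c \<noteq> 0}"

definition descents :: "tableau \<Rightarrow> nat set" where
  "descents T = {i. 1 \<le> i \<and> i < tab_size T \<and>
     (\<exists>r c r' c'. T (r, c) = i \<and> T (r', c') = i + 1 \<and> r < r')}"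

definition maj :: "tableau \<Rightarrow> nat" where
  "maj T = \<Sum>(descents T)"

text \<open>If the diagram of \<open>mu\<close> is not contained in that of \<open>la\<close>, then \<open>skew_SYT la mu\<close> is empty
  and \<open>skew_maj_gf la mu q = 0\<close>.\<close>

definition skew_maj_gf :: "nat list \<Rightarrow> nat list \<Rightarrow> real \<Rightarrow> real" where
  "skew_maj_gf la mu q = (\<Sum>T\<in>skew_SYT la mu. q ^ maj T)"

definition maj_gf :: "nat list \<Rightarrow> real \<Rightarrow> real" where
  "maj_gf la q = skew_maj_gf la [] q"

definition num_involutions :: "nat \<Rightarrow> nat" where
  "num_involutions j = card {p. p permutes {1..j} \<and> p \<circ> p = id}"

definition q_fact :: "real \<Rightarrow> nat \<Rightarrow> real" where
  "q_fact q n = (\<Prod>i=1..n. \<Sum>k<i. q ^ k)"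

text \<open>Used only for \<open>q > 0\<close> and \<open>k \<le> n\<close>, where the denominator is nonzero.\<close>

definition q_binomial :: "real \<Rightarrow> nat \<Rightarrow> nat \<Rightarrow> real" where
  "q_binomial q n k = q_fact q n / (q_fact q k * q_fact q (n - k))"

end

theory Submission
  imports Defs "HOL-Computational_Algebra.Formal_Power_Series"
begin

text \<open>
  Let \<open>F_k(\<alpha>)\<close> be the sum of \<open>f^(\<lambda>/\<alpha>)(q) / [k]_q!\<close> over all shapes \<open>\<lambda>\<close> with \<open>k\<close> boxes more than \<open>\<alpha>\<close>, and put
  \<open>b_k = F_k(\<emptyset>)\<close>. Deleting the entries up to \<open>m\<close> shows that the numerator of the quotient is
  \<open>[n - m]_q! F_(n-m)(\<alpha>)\<close>, and that the denominator is the sum of the same expressions over all standard tableaux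
  of size \<open>m\<close>, taken at their shapes. The proof rests on the factorisation (lemma \<open>level_sum_factorization\<close>)

  \<open>F_k(\<alpha>) = \<Sum>_h b_(k-h) G_h(\<alpha>)\<close>, where \<open>G_h(\<alpha>)\<close> is the sum of \<open>f^(\<alpha>/\<mu>)(q) / [h]_q!\<close> over all \<open>\<mu>\<close> with \<open>h\<close> boxes less than \<open>\<alpha>\<close>,

  a specialisation of the identity \<open>\<Sum>_\<lambda> s_(\<lambda>/\<alpha>) = (\<Sum>_\<lambda> s_\<lambda>) (\<Sum>_\<mu> s_(\<alpha>/\<mu>))\<close> for Schur functions. As
  \<open>G_h(\<alpha>) = 0\<close> for \<open>h > m\<close>, the limit of the quotient is determined by the limit \<open>x\<close> of \<open>b_(k+1) / b_k\<close>: the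
  numerator is asymptotically proportional to \<open>\<Sum>_j x^j G_(m-j)(\<alpha>)\<close>, and multiplying by \<open>[m]_q!\<close> gives the
  numerator of the limit if \<open>x = 1 - min q (1/q)\<close>. In the denominator the shapes are summed out by
  \<open>count_weighted\<close>, a version of \<open>\<Sum>_\<beta> f^\<beta> s_\<beta> = p_1^m\<close>, and the number of standard tableaux with \<open>j\<close> boxes is
  the number of involutions because both satisfy \<open>t_(n+1) = t_n + n t_(n-1)\<close>.

  The factorisation is proved without symmetric functions. In a tableau, a run of consecutive entries without
  descents fills a horizontal strip, and cutting off the last such run gives a linear recursion for
  \<open>f^(\<lambda>/\<alpha>)(q)\<close> (lemma \<open>norm_gf_hstrip_expansion\<close>). A reflection of intervals exchanges adding and removing
  horizontal strips (lemma \<open>card_hstrips_above_below\<close>). With these two facts a horizontal strip can be commuted past the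
  generating function (lemma \<open>strip_sum_eq_commuted_sum\<close>), and then both sides of the factorisation satisfy the
  same recursion. In both cases uniqueness comes from a factor \<open>1 - q^k\<close>, which is invertible for \<open>q \<noteq> 1\<close>; the case
  \<open>q = 1\<close> follows by continuity.

  The limit \<open>x\<close> is found in three cases. For \<open>q < 1\<close> the sequence \<open>b_k / (1 - q)^k\<close> increases to a finite limit.
  For \<open>q = 1\<close> one has \<open>b_k = t_k / k!\<close>, and \<open>t_(k+1) / t_k\<close> is of order \<open>sqrt k\<close>. Transposing tableaux exchanges
  descents and ascents, so \<open>b_k\<close> takes the same value at \<open>q\<close> and \<open>1/q\<close>, which settles \<open>q > 1\<close>.
\<close>

unbundle fps_syntax

section \<open>Young diagrams and horizontal strips\<close>

typedef shape = "{f :: nat \<Rightarrow> nat. antimono f \<and> (\<exists>N. \<forall>i\<ge>N. f i = 0)}"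
  morphisms row Shape
  by (rule exI[of _ "\<lambda>_. 0"]) (auto simp: antimono_def)

definition boxes :: "shape \<Rightarrow> (nat \<times> nat) set" where
  "boxes l = {(i, j). j < row l i}"

definition size_of :: "shape \<Rightarrow> nat" where
  "size_of l = card (boxes l)"

definition empty_shape :: shape where
  "empty_shape = Shape (\<lambda>_. 0)"

text \<open>The condition says that the rows of \<open>k\<close> and \<open>l\<close> interlace, which is the usual description
  of \<open>l / k\<close> having at most one box in each column. In this form a strip is a choice of one
  number from each of a list of intervals.\<close>

definition hstrip :: "shape \<Rightarrow> shape \<Rightarrow> bool" where
  "hstrip k l \<longleftrightarrow> (\<forall>i. row k i \<le> row l i \<and> row l (Suc i) \<le> row k i)"

lemma row_antimono: "i \<le> j \<Longrightarrow> row l j \<le> row l i"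
  using row[of l] by (auto simp: antimono_def)

lemma row_eventually_0: "\<exists>N. \<forall>i\<ge>N. row l i = 0"
  using row[of l] by auto

lemma row_Shape:
  assumes "\<And>i. f (Suc i) \<le> f i" "\<And>i. i \<ge> N \<Longrightarrow> f i = 0"
  shows "row (Shape f) = f"
proof -
  have "antimono f" using assms(1) by (simp add: antimono_iff_le_Suc)
  then show ?thesis using assms(2) by (intro Shape_inverse) auto
qed

lemma shape_eqI: "(\<And>i. row k i = row l i) \<Longrightarrow> k = l"
  by (metis row_inject ext)

lemma boxes_subset_iff: "boxes k \<subseteq> boxes l \<longleftrightarrow> (\<forall>i. row k i \<le> row l i)"
proof
  assume s: "boxes k \<subseteq> boxes l"
  show "\<forall>i. row k i \<le> row l i"
  proof
    fix i
    show "row k i \<le> row l i"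
    proof (cases "row k i")
      case (Suc j)
      then have "(i, j) \<in> boxes k" by (simp add: boxes_def)
      then have "(i, j) \<in> boxes l" using s by blast
      then show ?thesis using Suc by (simp add: boxes_def)
    qed simp
  qed
qed (auto simp: boxes_def intro: less_le_trans)

lemma boxes_inj: "boxes k = boxes l \<Longrightarrow> k = l"
  by (metis boxes_subset_iff dual_order.antisym order_refl shape_eqI)

lemma boxes_Sigma:
  assumes "\<forall>i\<ge>N. row l i = 0"
  shows "boxes l = Sigma {..<N} (\<lambda>i. {..<row l i})"
  using assms by (auto simp: boxes_def) (metis not_le not_less0)

lemma finite_boxes [simp]: "finite (boxes l)"
proof -
  obtain N where "\<forall>i\<ge>N. row l i = 0" using row_eventually_0 by blast
  then show ?thesis by (simp add: boxes_Sigma)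
qed

lemma size_of_eq_sum:
  assumes "\<forall>i\<ge>N. row l i = 0"
  shows "size_of l = (\<Sum>i<N. row l i)"
  by (simp add: size_of_def boxes_Sigma[OF assms])

lemma boxes_down_closed:
  assumes "(i, j) \<in> boxes l" "i' \<le> i" "j' \<le> j"
  shows "(i', j') \<in> boxes l"
  using assms row_antimono[of i' i l] by (auto simp: boxes_def)

lemma size_of_mono: "boxes k \<subseteq> boxes l \<Longrightarrow> size_of k \<le> size_of l"
  by (simp add: size_of_def card_mono)

lemma boxes_eq_of_size: "boxes k \<subseteq> boxes l \<Longrightarrow> size_of l \<le> size_of k \<Longrightarrow> k = l"
  by (simp add: size_of_def boxes_inj card_seteq)

lemma hstrip_boxes: "hstrip k l \<Longrightarrow> boxes k \<subseteq> boxes l"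
  by (simp add: hstrip_def boxes_subset_iff)

lemma hstrip_size: "hstrip k l \<Longrightarrow> size_of k \<le> size_of l"
  by (simp add: hstrip_boxes size_of_mono)

lemma hstrip_eq_of_size: "hstrip k l \<Longrightarrow> size_of l \<le> size_of k \<Longrightarrow> k = l"
  by (simp add: hstrip_boxes boxes_eq_of_size)

lemma hstrip_refl [simp]: "hstrip l l"
  by (simp add: hstrip_def row_antimono)

lemma boxes_empty [simp]: "boxes empty_shape = {}"
  by (simp add: boxes_def empty_shape_def row_Shape)

lemma size_of_empty [simp]: "size_of empty_shape = 0"
  by (simp add: size_of_def)

lemma size_of_0_iff [simp]: "size_of l = 0 \<longleftrightarrow> l = empty_shape"
  using boxes_inj[of l empty_shape] by (auto simp: size_of_def)

text \<open>A nonempty row forces all rows above it to be nonempty, so every box lies in the square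
  whose side is the number of boxes; this is what makes the sets of shapes of bounded size
  finite.\<close>

lemma row_bounds:
  assumes "size_of l \<le> n"
  shows "row l i \<le> n" and "i \<ge> n \<Longrightarrow> row l i = 0"
proof -
  have "Pair i ` {..<row l i} \<subseteq> boxes l" by (auto simp: boxes_def)
  then have "card (Pair i ` {..<row l i}) \<le> n"
    using assms card_mono[OF finite_boxes] unfolding size_of_def by (meson order_trans)
  then show "row l i \<le> n" by (simp add: card_image inj_on_def)
  show "row l i = 0" if "i \<ge> n"
  proof (rule ccontr)
    assume "row l i \<noteq> 0"
    then have "(\<lambda>i. (i, 0)) ` {..i} \<subseteq> boxes l"
      using row_antimono[of _ i l] by (fastforce simp: boxes_def)
    then have "card ((\<lambda>i. (i, 0::nat)) ` {..i}) \<le> n"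
      using assms card_mono[OF finite_boxes] unfolding size_of_def by (meson order_trans)
    then show False using that by (simp add: card_image inj_on_def)
  qed
qed

lemma finite_shapes_le: "finite {l. size_of l \<le> n}"
proof -
  have "finite {f::nat \<Rightarrow> nat. \<forall>x. (x \<in> {..<n} \<longrightarrow> f x \<in> {..n}) \<and> (x \<notin> {..<n} \<longrightarrow> f x = 0)}"
    by (rule finite_set_of_finite_funs) auto
  then have "finite (row ` {l. size_of l \<le> n})"
    by (rule finite_subset[rotated]) (use row_bounds in \<open>auto simp: not_less\<close>)
  then show ?thesis
    by (rule finite_imageD) (simp add: inj_on_def row_inject)
qed

lemma finite_shapes_size [simp]: "finite {l. size_of l = n}"
  by (rule finite_subset[OF _ finite_shapes_le[of n]]) auto

lemma finite_shapes_size_conj [simp]: "finite {l. size_of l = n \<and> P l}"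
  by (rule finite_subset[OF _ finite_shapes_le[of n]]) auto

lemma finite_hstrips [simp]: "finite {k. hstrip k l \<and> P k}"
  by (rule finite_subset[OF _ finite_shapes_le[of "size_of l"]]) (auto simp: hstrip_size)

lemma finite_hstrips' [simp]: "finite {k. hstrip k l}"
  using finite_hstrips[of l "\<lambda>_. True"] by simp

text \<open>The local rule of growth diagrams, in its counting form. If \<open>l\<close> lies above both \<open>mu\<close> and
  \<open>nu\<close>, then row \<open>i + 1\<close> of \<open>l\<close> ranges over the interval from \<open>max (mu_(i+1)) (nu_(i+1))\<close> to
  \<open>min mu_i nu_i\<close>, which is also the range of row \<open>i\<close> of a shape \<open>k\<close> below both. Reflecting this
  interval turns \<open>l\<close> into \<open>k\<close> and keeps track of sizes. Row \<open>0\<close> of \<open>l\<close> has no upper bound; its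
  excess over \<open>max mu_0 nu_0\<close> is the slack in the size condition for \<open>k\<close>. For \<open>mu = nu\<close> the
  lemma compares the strips added to a shape with the strips removed from it.\<close>

lemma card_hstrips_above_below:
  "card {l. size_of l = L \<and> hstrip mu l \<and> hstrip nu l}
   = card {k. hstrip k mu \<and> hstrip k nu \<and> size_of mu + size_of nu \<le> L + size_of k}"
proof -
  define M where "M i = max (row mu i) (row nu i)" for i
  define m where "m i = min (row mu i) (row nu i)" for i
  have Mm: "M i + m i = row mu i + row nu i" for i by (auto simp: M_def m_def)
  have mM: "m i \<le> M i" for i by (auto simp: M_def m_def)
  have m_anti: "m (Suc i) \<le> m i" and M_anti: "M (Suc i) \<le> M i" for i
    using row_antimono[of i "Suc i" mu] row_antimono[of i "Suc i" nu] by (auto simp: M_def m_def)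
  have above: "hstrip mu l \<and> hstrip nu l \<longleftrightarrow> M 0 \<le> row l 0 \<and> (\<forall>i. M (Suc i) \<le> row l (Suc i) \<and> row l (Suc i) \<le> m i)" for l
  proof -
    have nat_split: "(\<forall>i. P i) \<longleftrightarrow> P 0 \<and> (\<forall>i. P (Suc i))" for P :: "nat \<Rightarrow> bool"
      by (metis not0_implies_Suc)
    show ?thesis
      unfolding hstrip_def M_def m_def all_conj_distrib nat_split[of "\<lambda>i. row _ i \<le> row l i"] by auto
  qed
  have below: "hstrip k mu \<and> hstrip k nu \<longleftrightarrow> (\<forall>i. M (Suc i) \<le> row k i \<and> row k i \<le> m i)" for k
    unfolding hstrip_def M_def m_def by auto
  obtain N where N: "\<And>i. i \<ge> N \<Longrightarrow> M i = 0"
  proof -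
    obtain N1 where "\<forall>i\<ge>N1. row mu i = 0" using row_eventually_0 by blast
    moreover obtain N2 where "\<forall>i\<ge>N2. row nu i = 0" using row_eventually_0 by blast
    ultimately show thesis by (intro that[of "max N1 N2"]) (auto simp: M_def)
  qed
  have N': "m i = 0" if "i \<ge> N" for i using N[OF that] mM[of i] by simp
  have size_munu: "size_of mu + size_of nu = (\<Sum>i<Suc N. M i) + (\<Sum>i<N. m i)"
  proof -
    have "size_of mu = (\<Sum>i<Suc N. row mu i)" "size_of nu = (\<Sum>i<Suc N. row nu i)"
      using N unfolding M_def by (auto intro!: size_of_eq_sum simp del: sum.lessThan_Suc)
    then have "size_of mu + size_of nu = (\<Sum>i<Suc N. M i) + (\<Sum>i<Suc N. m i)"
      by (simp add: sum.distrib[symmetric] Mm del: sum.lessThan_Suc)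
    then show ?thesis using N' by simp
  qed
  have M_split: "(\<Sum>i<Suc N. M i) = M 0 + (\<Sum>i<N. M (Suc i))"
    by (rule sum.lessThan_Suc_shift)
  have size_l: "size_of l = row l 0 + (\<Sum>i<N. row l (Suc i))" if "hstrip mu l \<and> hstrip nu l" for l
  proof -
    have "\<forall>i\<ge>Suc N. row l i = 0"
      using that N' unfolding above by (metis Suc_le_D Suc_le_mono le_zero_eq)
    from size_of_eq_sum[OF this] show ?thesis by (simp only: sum.lessThan_Suc_shift)
  qed
  have size_k: "size_of k = (\<Sum>i<N. row k i)" if "hstrip k mu \<and> hstrip k nu" for k
    using that N' unfolding below by (intro size_of_eq_sum) (metis le_zero_eq)
  \<comment> \<open>Reflection of the intervals; \<open>up\<close> is the inverse map and recovers row \<open>0\<close> from the slack.\<close>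
  define down where "down l = Shape (\<lambda>i. M (Suc i) + m i - row l (Suc i))" for l
  define up where "up k = Shape (\<lambda>i. case i of 0 \<Rightarrow> M 0 + (L + size_of k - (size_of mu + size_of nu))
                                    | Suc i \<Rightarrow> M (Suc i) + m i - row k i)" for k
  have row_down: "row (down l) i = M (Suc i) + m i - row l (Suc i)" if "hstrip mu l \<and> hstrip nu l" for l i
  proof -
    have b: "M (Suc i) \<le> row l (Suc i)" "row l (Suc i) \<le> m i" for i using that unfolding above by auto
    show ?thesis unfolding down_def
    proof (subst row_Shape[where N = N])
      show "M (Suc (Suc i)) + m (Suc i) - row l (Suc (Suc i)) \<le> M (Suc i) + m i - row l (Suc i)" for i
        using b[of i] b[of "Suc i"] mM[of "Suc i"] by linarith
      show "M (Suc i) + m i - row l (Suc i) = 0" if "i \<ge> N" for i using N[of "Suc i"] N'[of i] that by simp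
    qed simp
  qed
  have row_up: "row (up k) 0 = M 0 + (L + size_of k - (size_of mu + size_of nu))"
    "row (up k) (Suc i) = M (Suc i) + m i - row k i" if "hstrip k mu \<and> hstrip k nu" for k i
  proof -
    have b: "M (Suc i) \<le> row k i" "row k i \<le> m i" for i using that unfolding below by auto
    have "row (up k) = (\<lambda>i. case i of 0 \<Rightarrow> M 0 + (L + size_of k - (size_of mu + size_of nu))
                                    | Suc i \<Rightarrow> M (Suc i) + m i - row k i)"
      unfolding up_def
    proof (rule row_Shape[where N = "Suc N"], goal_cases)
      case (1 i)
      show ?case
      proof (cases i)
        case 0
        then show ?thesis using b[of 0] mM[of 0] by simp
      next
        case (Suc j)
        then show ?thesis using b[of j] b[of "Suc j"] mM[of "Suc j"] by simp
      qed
    next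
      case (2 i)
      then obtain j where "i = Suc j" "j \<ge> N" by (metis Suc_le_D Suc_le_mono)
      then show ?case using N[of "Suc j"] N'[of j] by simp
    qed
    then show "row (up k) 0 = M 0 + (L + size_of k - (size_of mu + size_of nu))"
      "row (up k) (Suc i) = M (Suc i) + m i - row k i" by simp_all
  qed
  have reflect: "(\<Sum>i<N. M (Suc i) + m i - f i) + (\<Sum>i<N. f i) = (\<Sum>i<N. M (Suc i)) + (\<Sum>i<N. m i)"
    if "\<And>i. f i \<le> m i" for f
    using that by (simp add: sum.distrib[symmetric] trans_le_add2)
  have down_in: "hstrip (down l) mu \<and> hstrip (down l) nu" if "hstrip mu l \<and> hstrip nu l" for l
  proof -
    have b: "M (Suc i) \<le> row l (Suc i)" "row l (Suc i) \<le> m i" for i using that unfolding above by auto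
    show ?thesis unfolding below row_down[OF that] using b by (simp add: Nat.le_diff_conv2 trans_le_add2 le_diff_conv)
  qed
  have down_size: "size_of (down l) + size_of l + M 0 = size_of mu + size_of nu + row l 0"
    if "hstrip mu l \<and> hstrip nu l" for l
  proof -
    have "row l (Suc i) \<le> m i" for i using that unfolding above by auto
    from reflect[of "\<lambda>i. row l (Suc i)", OF this] show ?thesis
      using size_l[OF that] size_k[OF down_in[OF that]] size_munu M_split by (simp add: row_down[OF that])
  qed
  have up_in: "hstrip mu (up k) \<and> hstrip nu (up k)" if "hstrip k mu \<and> hstrip k nu" for k
  proof -
    have b: "M (Suc i) \<le> row k i" "row k i \<le> m i" for i using that unfolding below by auto
    show ?thesis unfolding above row_up[OF that] using b by (simp add: Nat.le_diff_conv2 trans_le_add2 le_diff_conv)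
  qed
  have up_size: "size_of (up k) = L"
    if "hstrip k mu \<and> hstrip k nu" "size_of mu + size_of nu \<le> L + size_of k" for k
  proof -
    have "row k i \<le> m i" for i using that unfolding below by auto
    from reflect[of "row k", OF this] show ?thesis
      using that(2) size_k[OF that(1)] size_l[OF up_in[OF that(1)]] size_munu M_split by (simp add: row_up[OF that(1)])
  qed
  show ?thesis
  proof (rule bij_betw_same_card[of down], rule bij_betw_byWitness[where f' = up], goal_cases)
    case 1
    show ?case
    proof safe
      fix l assume l: "hstrip mu l" "hstrip nu l" and L: "L = size_of l"
      have h: "hstrip mu l \<and> hstrip nu l" using l by simp
      have b: "M 0 \<le> row l 0" "row l (Suc i) \<le> m i" for i using h unfolding above by auto
      show "up (down l) = l"
      proof (rule shape_eqI)
        fix i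
        show "row (up (down l)) i = row l i"
        proof (cases i)
          case 0
          then show ?thesis using row_up(1)[OF down_in[OF h]] down_size[OF h] b(1) L by simp
        next
          case (Suc j)
          then show ?thesis using row_up(2)[OF down_in[OF h]] row_down[OF h] b(2)[of j] by simp
        qed
      qed
    qed
  next
    case 2
    show ?case
    proof safe
      fix k assume k: "hstrip k mu" "hstrip k nu" 
      have h: "hstrip k mu \<and> hstrip k nu" using k by simp
      have b: "row k i \<le> m i" for i using h unfolding below by auto
      show "down (up k) = k"
        by (rule shape_eqI) (use row_up(2)[OF h] row_down[OF up_in[OF h]] b in \<open>simp add: trans_le_add2\<close>)
    qed
  next
    case 3
    show ?case
    proof safe
      fix l assume l: "hstrip mu l" "hstrip nu l" and L: "L = size_of l"
      have h: "hstrip mu l \<and> hstrip nu l" using l by simp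
      have b: "M 0 \<le> row l 0" using h unfolding above by auto
      show "hstrip (down l) mu" "hstrip (down l) nu" "size_of mu + size_of nu \<le> size_of l + size_of (down l)"
        using down_in[OF h] down_size[OF h] b by auto
    qed
  next
    case 4
    show ?case using up_in up_size by auto
  qed
qed

section \<open>Standard fillings of a set of cells\<close>

text \<open>Skew tableaux are treated as fillings of an arbitrary set of cells: cutting a tableau at
  an entry \<open>d\<close> then gives two objects of the same kind, and no separate treatment of straight
  shapes is needed.\<close>

definition fillings :: "(nat \<times> nat) set \<Rightarrow> tableau set" where
  "fillings X = {T. bij_betw T X {1..card X} \<and> (\<forall>c. c \<notin> X \<longrightarrow> T c = 0)
     \<and> (\<forall>i j j'. (i, j) \<in> X \<and> (i, j') \<in> X \<and> j < j' \<longrightarrow> T (i, j) < T (i, j'))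
     \<and> (\<forall>i i' j. (i, j) \<in> X \<and> (i', j) \<in> X \<and> i < i' \<longrightarrow> T (i, j) < T (i', j))}"

definition skew_tableaux :: "shape \<Rightarrow> shape \<Rightarrow> tableau set" where
  "skew_tableaux l a = (if boxes a \<subseteq> boxes l then fillings (boxes l - boxes a) else {})"

lemma fillingsD:
  assumes "T \<in> fillings X"
  shows "bij_betw T X {1..card X}" "c \<notin> X \<Longrightarrow> T c = 0"
    "(i, j) \<in> X \<Longrightarrow> (i, j') \<in> X \<Longrightarrow> j < j' \<Longrightarrow> T (i, j) < T (i, j')"
    "(i, j) \<in> X \<Longrightarrow> (i', j) \<in> X \<Longrightarrow> i < i' \<Longrightarrow> T (i, j) < T (i', j)"
  using assms unfolding fillings_def by blast+

lemma fillings_range: "T \<in> fillings X \<Longrightarrow> c \<in> X \<Longrightarrow> 1 \<le> T c \<and> T c \<le> card X"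
  using fillingsD(1)[of T X] by (fastforce simp: bij_betw_def)

lemma fillings_support: "T \<in> fillings X \<Longrightarrow> {c. T c \<noteq> 0} = X"
  using fillings_range[of T X] fillingsD(2)[of T X] by fastforce

lemma fillings_inj: "T \<in> fillings X \<Longrightarrow> T c = T c' \<Longrightarrow> T c \<noteq> 0 \<Longrightarrow> c = c'"
  using fillingsD(1)[of T X] fillings_support[of T X] by (auto simp: bij_betw_def inj_on_def)

lemma tab_size_fillings: "T \<in> fillings X \<Longrightarrow> tab_size T = card X"
  unfolding tab_size_def by (simp only: fillings_support)

lemma fillings_surj: "T \<in> fillings X \<Longrightarrow> 1 \<le> v \<Longrightarrow> v \<le> card X \<Longrightarrow> \<exists>c. T c = v"
proof -
  assume "T \<in> fillings X" "1 \<le> v" "v \<le> card X"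
  then have "v \<in> T ` X" using fillingsD(1)[of T X] by (simp add: bij_betw_def)
  then show ?thesis by blast
qed

lemma finite_fillings:
  assumes "finite X"
  shows "finite (fillings X)"
proof (rule finite_subset)
  show "fillings X \<subseteq> {T. \<forall>c. (c \<in> X \<longrightarrow> T c \<in> {..card X}) \<and> (c \<notin> X \<longrightarrow> T c = 0)}"
    using fillings_range fillingsD(2) by fastforce
  show "finite {T :: tableau. \<forall>c. (c \<in> X \<longrightarrow> T c \<in> {..card X}) \<and> (c \<notin> X \<longrightarrow> T c = 0)}"
    by (rule finite_set_of_finite_funs[OF assms]) simp
qed

lemma finite_skew_tableaux [simp]: "finite (skew_tableaux l a)"
  by (simp add: skew_tableaux_def finite_fillings)

text \<open>Cutting at the entry \<open>d\<close> is a bijection as soon as no cell of \<open>Y\<close> lies weakly above and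
  to the left of a cell of \<open>X\<close>: then every entry of \<open>X\<close> may be smaller than every entry of \<open>Y\<close>,
  and the two fillings are independent. The lemma serves twice, for removing the largest entry
  and for extending a fixed tableau.\<close>

lemma fillings_split_bij:
  assumes fin: "finite X" "finite Y" and disj: "X \<inter> Y = {}"
    and order: "\<And>i j i' j'. (i, j) \<in> X \<Longrightarrow> (i', j') \<in> Y \<Longrightarrow> \<not> (i' \<le> i \<and> j' \<le> j)"
    and d: "d = card X"
  shows "bij_betw (\<lambda>T. (tab_le d T, tab_gt d T)) {T \<in> fillings (X \<union> Y). \<forall>c\<in>X. T c \<le> d}
           (fillings X \<times> fillings Y)"
proof -
  define n where "n = card Y"
  have card_un: "card (X \<union> Y) = d + n" using fin disj by (simp add: card_Un_disjoint d n_def)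
  define glue where "glue P c = (if c \<in> X then fst P c else if c \<in> Y then snd P c + d else 0)"
    for P :: "tableau \<times> tableau" and c
  have split: "bij_betw T X {1..d}" "bij_betw T Y {d+1..d+n}" 
    "tab_le d T c = (if c \<in> X then T c else 0)" "tab_gt d T c = (if c \<in> Y then T c - d else 0)"
    if T: "T \<in> fillings (X \<union> Y)" and le: "\<forall>c\<in>X. T c \<le> d" for T c
  proof -
    have bij: "bij_betw T (X \<union> Y) {1..d+n}" using fillingsD(1)[OF T] card_un by simp
    have inj: "inj_on T (X \<union> Y)" using bij by (simp add: bij_betw_def)
    then have injX: "inj_on T X" and injY: "inj_on T Y" by (auto intro: inj_on_subset)
    have sub: "T ` X \<subseteq> {1..d}" using fillings_range[OF T] le by auto
    have im: "T ` X = {1..d}"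
      by (rule card_subset_eq) (use sub injX d in \<open>auto simp: card_image\<close>)
    show "bij_betw T X {1..d}" using injX im by (simp add: bij_betw_def)
    have "T ` Y = T ` (X \<union> Y) - T ` X" using inj disj by (auto simp: inj_on_def)
    also have "\<dots> = {d+1..d+n}" using bij im by (auto simp: bij_betw_def)
    finally have imY: "T ` Y = {d+1..d+n}" .
    then show "bij_betw T Y {d+1..d+n}" using injY by (simp add: bij_betw_def)
    have gt: "T c > d" if "c \<in> Y" for c using imY that by (metis Suc_eq_plus1 Suc_le_eq atLeastAtMost_iff imageI)
    show "tab_le d T c = (if c \<in> X then T c else 0)" "tab_gt d T c = (if c \<in> Y then T c - d else 0)"
      using le gt[of c] disj fillingsD(2)[OF T, of c]
      by (cases "c \<in> X"; cases "c \<in> Y"; fastforce simp: tab_le_def tab_gt_def)+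
  qed
  show ?thesis
  proof (rule bij_betw_byWitness[where f' = glue], goal_cases)
    case 1
    show ?case
    proof safe
      fix T assume T: "T \<in> fillings (X \<union> Y)" and le: "\<forall>c\<in>X. T c \<le> d"
      show "glue (tab_le d T, tab_gt d T) = T"
      proof
        fix c
        have "c \<in> Y \<Longrightarrow> T c \<ge> d" using bij_betwE[OF split(2)[OF T le]] by auto
        then show "glue (tab_le d T, tab_gt d T) c = T c"
          using split(3,4)[OF T le] disj fillingsD(2)[OF T, of c] by (auto simp: glue_def)
      qed
    qed
  next
    case 2
    show ?case
    proof safe
      fix T1 T2 assume T1: "T1 \<in> fillings X" and T2: "T2 \<in> fillings Y"
      have "tab_le d (glue (T1, T2)) c = T1 c" "tab_gt d (glue (T1, T2)) c = T2 c" for c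
        using fillings_range[OF T1, of c] fillings_range[OF T2, of c] fillingsD(2)[OF T1, of c]
          fillingsD(2)[OF T2, of c] disj d by (auto simp: tab_le_def tab_gt_def glue_def)
      then show "tab_le d (glue (T1, T2)) = T1" "tab_gt d (glue (T1, T2)) = T2" by auto
    qed
  next
    case 3
    show ?case
    proof safe
      fix T assume T: "T \<in> fillings (X \<union> Y)" and le: "\<forall>c\<in>X. T c \<le> d"
      note s = split[OF T le]
      show "tab_le d T \<in> fillings X"
        unfolding fillings_def
      proof safe
        show "bij_betw (tab_le d T) X {1..card X}"
          using s(1) unfolding d[symmetric] by (subst bij_betw_cong[of X _ T]) (auto simp: s(3))
      qed (use s(3) fillingsD(3,4)[OF T] in auto)
      show "tab_gt d T \<in> fillings Y"
        unfolding fillings_def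
      proof safe
        have "bij_betw (\<lambda>v. v - d) {d+1..d+n} {1..n}"
          by (rule bij_betw_byWitness[where f' = "\<lambda>v. v + d"]) auto
        from bij_betw_trans[OF s(2) this] show "bij_betw (tab_gt d T) Y {1..card Y}"
          by (subst bij_betw_cong[of Y _ "(\<lambda>v. v - d) \<circ> T"]) (auto simp: s(4) n_def)
        have ge: "T c \<ge> d" if "c \<in> Y" for c using bij_betwE[OF s(2)] that by auto
        show "tab_gt d T (i, j) < tab_gt d T (i, j')" if "(i, j) \<in> Y" "(i, j') \<in> Y" "j < j'" for i j j'
          using fillingsD(3)[OF T, of i j j'] that ge[of "(i,j)"] by (simp add: s(4) diff_less_mono)
        show "tab_gt d T (i, j) < tab_gt d T (i', j)" if "(i, j) \<in> Y" "(i', j) \<in> Y" "i < i'" for i i' j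
          using fillingsD(4)[OF T, of i j i'] that ge[of "(i,j)"] by (simp add: s(4) diff_less_mono)
      qed (use s(4) in auto)
    qed
  next
    case 4
    show ?case
    proof safe
      fix T1 T2 assume T1: "T1 \<in> fillings X" and T2: "T2 \<in> fillings Y"
      let ?T = "glue (T1, T2)"
      have gX: "?T c = T1 c" if "c \<in> X" for c using that by (simp add: glue_def)
      have gY: "?T c = T2 c + d" if "c \<in> Y" for c using that disj by (auto simp: glue_def)
      have cross: "?T c < ?T c'" if "c \<in> X" "c' \<in> Y" for c c'
        using fillings_range[OF T1 that(1)] fillings_range[OF T2 that(2)] gX[OF that(1)] gY[OF that(2)] d by simp
      show "?T \<in> fillings (X \<union> Y)"
        unfolding fillings_def mem_Collect_eq
      proof (intro conjI allI impI)
        have "bij_betw (\<lambda>v. v + d) {1..n} {d+1..d+n}"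
          by (rule bij_betw_byWitness[where f' = "\<lambda>v. v - d"]) auto
        from bij_betw_trans[OF fillingsD(1)[OF T2, folded n_def] this]
        have "bij_betw ?T Y {d+1..d+n}"
          by (subst bij_betw_cong[of Y _ "(\<lambda>v. v + d) \<circ> T2"]) (auto simp: gY)
        moreover have "bij_betw ?T X {1..d}"
          using fillingsD(1)[OF T1, folded d] by (subst bij_betw_cong[of X _ T1]) (auto simp: gX)
        ultimately have "bij_betw ?T (X \<union> Y) ({1..d} \<union> {d+1..d+n})"
          by (intro bij_betw_combine) auto
        moreover have "{1..d} \<union> {d+1..d+n} = {1..card (X \<union> Y)}" using card_un by auto
        ultimately show "bij_betw ?T (X \<union> Y) {1..card (X \<union> Y)}" by simp
        show "?T c = 0" if "c \<notin> X \<union> Y" for c using that by (simp add: glue_def)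
        show "?T (i, j) < ?T (i, j')" if h: "(i, j) \<in> X \<union> Y \<and> (i, j') \<in> X \<union> Y \<and> j < j'" for i j j'
        proof -
          consider "(i, j) \<in> X" "(i, j') \<in> X" | "(i, j) \<in> X" "(i, j') \<in> Y" | "(i, j) \<in> Y" "(i, j') \<in> Y"
            using h order[of i j' i j] by auto
          then show ?thesis
            by cases (use h gX gY cross fillingsD(3)[OF T1] fillingsD(3)[OF T2] in simp_all)
        qed
        show "?T (i, j) < ?T (i', j)" if h: "(i, j) \<in> X \<union> Y \<and> (i', j) \<in> X \<union> Y \<and> i < i'" for i i' j
        proof -
          consider "(i, j) \<in> X" "(i', j) \<in> X" | "(i, j) \<in> X" "(i', j) \<in> Y" | "(i, j) \<in> Y" "(i', j) \<in> Y"
            using h order[of i' j i j] by auto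
          then show ?thesis
            by cases (use h gX gY cross fillingsD(4)[OF T1] fillingsD(4)[OF T2] in simp_all)
        qed
      qed
      show "?T c \<le> d" if "c \<in> X" for c using fillings_range[OF T1 that] gX[OF that] d by simp
    qed
  qed
qed

text \<open>The corner \<open>(i, j')\<close> of the rectangle spanned by the two cells is again a cell of the
  skew shape, so one row step and one column step suffice.\<close>

lemma skew_tableaux_less:
  assumes T: "T \<in> skew_tableaux l a" and c: "(i, j) \<in> boxes l - boxes a" "(i', j') \<in> boxes l - boxes a"
    and le: "i \<le> i'" "j \<le> j'" "(i, j) \<noteq> (i', j')"
  shows "T (i, j) < T (i', j')"
proof -
  have F: "T \<in> fillings (boxes l - boxes a)" using T by (auto simp: skew_tableaux_def split: if_splits)
  have mid: "(i, j') \<in> boxes l - boxes a"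
    using c le boxes_down_closed[of i' j' l i j'] boxes_down_closed[of i j' a i j] by auto
  have "T (i, j) \<le> T (i, j')" using fillingsD(3)[OF F c(1) mid] le by (cases "j = j'") auto
  moreover have "T (i, j') \<le> T (i', j')" using fillingsD(4)[OF F mid c(2)] le by (cases "i = i'") auto
  moreover have "T (i, j) \<noteq> T (i', j')"
    using fillings_inj[OF F, of "(i,j)" "(i',j')"] fillings_range[OF F c(1)] le by auto
  ultimately show ?thesis by linarith
qed

lemma card_skew: "boxes a \<subseteq> boxes l \<Longrightarrow> card (boxes l - boxes a) = size_of l - size_of a"
  by (simp add: card_Diff_subset size_of_def)

lemma skew_tableauxD:
  assumes "T \<in> skew_tableaux l a"
  shows "T \<in> fillings (boxes l - boxes a)" "boxes a \<subseteq> boxes l" "tab_size T = size_of l - size_of a"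
    "card (boxes l - boxes a) = size_of l - size_of a"
  using assms card_skew[of a l] by (auto simp: skew_tableaux_def tab_size_fillings split: if_splits)

lemma skew_tableaux_self: "skew_tableaux a a = {\<lambda>_. 0}"
  by (auto simp: skew_tableaux_def fillings_def bij_betw_def)

section \<open>Removing the largest entry\<close>

definition corner :: "nat \<Rightarrow> shape \<Rightarrow> bool" where
  "corner r l \<longleftrightarrow> row l (Suc r) < row l r"

definition remove_box :: "nat \<Rightarrow> shape \<Rightarrow> shape" where
  "remove_box r l = Shape ((row l)(r := row l r - 1))"

lemma row_remove_box: "corner r l \<Longrightarrow> row (remove_box r l) = (row l)(r := row l r - 1)"
proof -
  assume c: "corner r l"
  obtain N where N: "\<forall>i\<ge>N. row l i = 0" using row_eventually_0 by blast
  show ?thesis unfolding remove_box_def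
  proof (rule row_Shape[where N = N])
    show "((row l)(r := row l r - 1)) (Suc i) \<le> ((row l)(r := row l r - 1)) i" for i
      using row_antimono[of i "Suc i" l] c by (auto simp: corner_def)
  qed (use N in simp)
qed

lemma boxes_remove_box:
  assumes "corner r l"
  shows "boxes (remove_box r l) = boxes l - {(r, row l r - 1)}" "(r, row l r - 1) \<in> boxes l"
proof -
  show "boxes (remove_box r l) = boxes l - {(r, row l r - 1)}"
    by (rule set_eqI) (use assms in \<open>auto simp: boxes_def row_remove_box[OF assms] corner_def split: if_splits\<close>)
  show "(r, row l r - 1) \<in> boxes l" using assms by (simp add: boxes_def corner_def)
qed

lemma size_remove_box: "corner r l \<Longrightarrow> size_of l = Suc (size_of (remove_box r l))"
  using boxes_remove_box[of r l] card_Suc_Diff1[OF finite_boxes, of "(r, row l r - 1)" l]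
  by (simp add: size_of_def)

text \<open>No cell of the skew shape lies to the right of the largest entry or below it.\<close>

lemma max_entry_corner:
  assumes T: "T \<in> skew_tableaux l a" and lt: "size_of a < size_of l"
    and max: "T (r, c) = size_of l - size_of a"
  shows "corner r l \<and> c = row l r - 1 \<and> boxes a \<subseteq> boxes (remove_box r l)"
proof -
  note F = skew_tableauxD[OF T]
  have ne: "T (r, c) \<noteq> 0" using lt max by simp
  have rc: "(r, c) \<in> boxes l - boxes a" using fillings_support[OF F(1)] ne by auto
  have no: "(i, j) \<notin> boxes l" if "r \<le> i" "c \<le> j" "(r, c) \<noteq> (i, j)" for i j
  proof
    assume "(i, j) \<in> boxes l"
    moreover have "(i, j) \<notin> boxes a" using rc boxes_down_closed[of i j a r c] that by auto
    ultimately have ij: "(i, j) \<in> boxes l - boxes a" by simp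
    from skew_tableaux_less[OF T rc ij that] fillings_range[OF F(1) ij] F(4) max show False by simp
  qed
  have "row l r = Suc c" using rc no[of r "Suc c"] by (auto simp: boxes_def)
  moreover have "row l (Suc r) \<le> c" using no[of "Suc r" c] by (auto simp: boxes_def)
  ultimately show ?thesis using F(2) rc boxes_remove_box(1)[of r l] by (auto simp: corner_def)
qed

lemma remove_box_bij:
  assumes c: "corner r l" and sub: "boxes a \<subseteq> boxes (remove_box r l)" and k: "k = size_of l - size_of a"
  shows "bij_betw (tab_le (k - 1)) {T \<in> skew_tableaux l a. T (r, row l r - 1) = k}
           (skew_tableaux (remove_box r l) a)"
proof -
  define b where "b = (r, row l r - 1)"
  define X where "X = boxes (remove_box r l) - boxes a"
  have bb: "boxes (remove_box r l) = boxes l - {b}" "b \<in> boxes l" "b \<notin> boxes a"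
    using boxes_remove_box[OF c] sub by (auto simp: b_def)
  have suba: "boxes a \<subseteq> boxes l" using sub bb by auto
  have un: "boxes l - boxes a = X \<union> {b}" "b \<notin> X" using bb by (auto simp: X_def)
  have finX: "finite X" by (simp add: X_def)
  have cardX: "card X = k - 1" and k1: "k \<ge> 1"
    using card_skew[OF suba] un finX k by auto
  have single: "fillings {b} = {\<lambda>c. if c = b then 1 else 0}"
    by (auto simp: fillings_def bij_betw_def b_def fun_eq_iff)
  have bij: "bij_betw (\<lambda>T. (tab_le (k - 1) T, tab_gt (k - 1) T))
      {T \<in> fillings (X \<union> {b}). \<forall>c\<in>X. T c \<le> k - 1} (fillings X \<times> fillings {b})"
  proof (rule fillings_split_bij[OF finX])
    fix i j i' j' assume ij: "(i, j) \<in> X" "(i', j') \<in> {b}"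
    show "\<not> (i' \<le> i \<and> j' \<le> j)"
    proof
      assume "i' \<le> i \<and> j' \<le> j"
      then have "b \<in> boxes (remove_box r l)"
        using ij boxes_down_closed[of i j "remove_box r l" i' j'] by (auto simp: X_def)
      then show False using bb by auto
    qed
  qed (use un cardX in auto)
  have "bij_betw fst (fillings X \<times> fillings {b}) (fillings X)"
    unfolding single by (rule bij_betw_byWitness[where f' = "\<lambda>S. (S, \<lambda>c. if c = b then 1 else 0)"]) auto
  from bij_betw_trans[OF bij this]
  have "bij_betw (tab_le (k - 1)) {T \<in> fillings (X \<union> {b}). \<forall>c\<in>X. T c \<le> k - 1} (fillings X)"
    by (simp add: o_def)
  moreover have "{T \<in> fillings (X \<union> {b}). \<forall>c\<in>X. T c \<le> k - 1} = {T \<in> fillings (X \<union> {b}). T b = k}"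
  proof (intro Collect_cong conj_cong refl iffI)
    fix T assume T: "T \<in> fillings (X \<union> {b})" and le: "\<forall>c\<in>X. T c \<le> k - 1"
    have cu: "card (X \<union> {b}) = k" using cardX k1 un finX by simp
    obtain x where x: "T x = k" using fillings_surj[OF T, of k] k1 cu by auto
    then have "x \<in> X \<union> {b}" using fillingsD(2)[OF T, of x] k1 by fastforce
    moreover have "x \<notin> X" using x le k1 by auto
    ultimately show "T b = k" using x by simp
  next
    fix T assume T: "T \<in> fillings (X \<union> {b})" and Tb: "T b = k"
    have cu: "card (X \<union> {b}) = k" using cardX k1 un finX by simp
    show "\<forall>c\<in>X. T c \<le> k - 1"
    proof
      fix x assume x: "x \<in> X"
      have "T x \<noteq> k" using fillings_inj[OF T, of x b] Tb k1 x un by auto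
      then show "T x \<le> k - 1" using fillings_range[OF T, of x] x cu by auto
    qed
  qed
  ultimately show ?thesis using sub suba un by (simp add: skew_tableaux_def X_def b_def)
qed

text \<open>Removing the largest entry \<open>k\<close> affects only the possible descent at \<open>k - 1\<close>, which is
  decided by comparing the rows of \<open>k - 1\<close> and \<open>k\<close>.\<close>

lemma maj_remove_max:
  assumes T: "T \<in> skew_tableaux l a" and k: "k = size_of l - size_of a" and Tk: "T (r, c) = k" and k1: "k \<ge> 1"
    and T': "T' \<in> skew_tableaux l' a" "T' = tab_le (k - 1) T" "size_of l' - size_of a = k - 1"
  shows "maj T = maj T' + (if k \<ge> 2 \<and> (\<exists>i j. i < r \<and> T' (i, j) = k - 1) then k - 1 else 0)"
proof -
  note F = skew_tableauxD[OF T] and F' = skew_tableauxD[OF T'(1)]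
  have eq: "T' x = v \<longleftrightarrow> T x = v" if "1 \<le> v" "v \<le> k - 1" for x v
    using that by (auto simp: T'(2) tab_le_def)
  have uniq: "T x = k \<Longrightarrow> x = (r, c)" for x using fillings_inj[OF F(1), of x "(r,c)"] Tk k1 by linarith
  let ?P = "k \<ge> 2 \<and> (\<exists>i j. i < r \<and> T' (i, j) = k - 1)"
  have "i \<in> descents T \<longleftrightarrow> i \<in> descents T' \<or> (i = k - 1 \<and> ?P)" for i
  proof -
    consider "i < 1 \<or> i \<ge> k" | "1 \<le> i" "i + 1 \<le> k - 1" | "1 \<le> i" "i = k - 1" "k \<ge> 2" by linarith
    then show ?thesis
    proof cases
      case 1
      then show ?thesis using F(3) F'(3) T'(3) k by (auto simp: descents_def)
    next
      case 2
      then show ?thesis using F(3) F'(3) T'(3) k eq[of i] eq[of "i+1"] by (auto simp: descents_def)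
    next
      case 3
      then have "tab_size T = k" "i + 1 = k" "i < k" using F(3) k by simp_all
      then have "i \<in> descents T \<longleftrightarrow> (\<exists>r1 c1 r' c'. T (r1, c1) = i \<and> T (r', c') = k \<and> r1 < r')"
        using 3(1) by (simp add: descents_def)
      also have "\<dots> \<longleftrightarrow> (\<exists>r1 c1. T (r1, c1) = i \<and> r1 < r)"
        using Tk uniq by (metis prod.inject)
      finally have "i \<in> descents T \<longleftrightarrow> (\<exists>r1 c1. T (r1, c1) = i \<and> r1 < r)" .
      moreover have "i \<notin> descents T'" using 3 F'(3) T'(3) by (auto simp: descents_def)
      ultimately show ?thesis using 3 eq[of i] by auto
    qed
  qed
  then have D: "descents T = descents T' \<union> (if ?P then {k - 1} else {})" by auto
  have "k - 1 \<notin> descents T'" using F'(3) T'(3) by (auto simp: descents_def)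
  moreover have "finite (descents T')" by (rule finite_subset[of _ "{..tab_size T'}"]) (auto simp: descents_def)
  ultimately show ?thesis unfolding maj_def D by (simp add: sum.union_disjoint)
qed

definition skew_gf :: "real \<Rightarrow> shape \<Rightarrow> shape \<Rightarrow> real" where
  "skew_gf q l a = (\<Sum>T\<in>skew_tableaux l a. q ^ maj T)"

text \<open>Only tableaux whose largest entry is in row \<open>r\<close> or below are counted. The row of the
  largest entry is the only information about a tableau that is needed to see whether the next
  box creates a descent.\<close>

definition skew_gf_from :: "nat \<Rightarrow> real \<Rightarrow> shape \<Rightarrow> shape \<Rightarrow> real" where
  "skew_gf_from r q l a = (\<Sum>T\<in>{T \<in> skew_tableaux l a. \<exists>i c. r \<le> i \<and> T (i, c) = size_of l - size_of a}. q ^ maj T)"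

lemma skew_gf_0: "\<not> boxes a \<subseteq> boxes l \<Longrightarrow> skew_gf q l a = 0"
  by (simp add: skew_gf_def skew_tableaux_def)

lemma maj_zero [simp]: "maj (\<lambda>_. 0) = 0"
  by (simp add: maj_def descents_def tab_size_def)

lemma skew_gf_self [simp]: "skew_gf q a a = 1"
  by (simp add: skew_gf_def skew_tableaux_self)

lemma max_entry_exists:
  assumes "T \<in> skew_tableaux l a" "size_of a < size_of l"
  shows "\<exists>i c. T (i, c) = size_of l - size_of a"
  using fillings_surj[OF skew_tableauxD(1)[OF assms(1)], of "size_of l - size_of a"]
    skew_tableauxD(4)[OF assms(1)] assms(2) by fastforce

lemma skew_gf_from_0: "size_of a < size_of l \<Longrightarrow> skew_gf_from 0 q l a = skew_gf q l a"
  unfolding skew_gf_def skew_gf_from_def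
  by (intro sum.cong) (use max_entry_exists in auto)

lemma skew_gf_from_large:
  assumes "size_of a < size_of l" "row l r = 0"
  shows "skew_gf_from r q l a = 0"
proof -
  have "\<not> (r \<le> i \<and> T (i, c) = size_of l - size_of a)" if "T \<in> skew_tableaux l a" for T i c
    using max_entry_corner[OF that assms(1), of i c] row_antimono[of r i l] assms(2) by (auto simp: corner_def)
  then have "{T \<in> skew_tableaux l a. \<exists>i c. r \<le> i \<and> T (i, c) = size_of l - size_of a} = {}" by blast
  then show ?thesis unfolding skew_gf_from_def by (simp only: sum.empty)
qed

text \<open>A tableau \<open>T'\<close> of the smaller shape contributes \<open>q ^ (k - 1) * q ^ maj T'\<close> if its largest
  entry \<open>k - 1\<close> is in a row above \<open>r\<close>, and \<open>q ^ maj T'\<close> otherwise. For \<open>k = 1\<close> the two weights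
  agree, and the formula remains correct with the factor \<open>1 - q ^ 0 = 0\<close>.\<close>

lemma skew_gf_max_row:
  assumes c: "corner r l" and lt: "size_of a < size_of l"
  defines "k \<equiv> size_of l - size_of a" and "u \<equiv> remove_box r l"
  shows "(\<Sum>T\<in>{T \<in> skew_tableaux l a. \<exists>c. T (r, c) = k}. q ^ maj T)
     = q ^ (k - 1) * skew_gf q u a + (1 - q ^ (k - 1)) * skew_gf_from r q u a"
proof (cases "boxes a \<subseteq> boxes u")
  case False
  have "{T \<in> skew_tableaux l a. \<exists>c. T (r, c) = k} = {}"
    using max_entry_corner[OF _ lt] False by (auto simp: k_def u_def)
  moreover have "skew_gf_from r q u a = 0" using False by (simp add: skew_gf_from_def skew_tableaux_def)
  ultimately show ?thesis using skew_gf_0[OF False, of q] by (simp only: sum.empty)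
next
  case True
  have k1: "k \<ge> 1" using lt by (simp add: k_def)
  have sz: "size_of u - size_of a = k - 1" using size_remove_box[OF c] by (simp add: k_def u_def)
  let ?A = "{T \<in> skew_tableaux u a. \<exists>i c. r \<le> i \<and> T (i, c) = size_of u - size_of a}"
  let ?B = "skew_tableaux u a - ?A"
  \<comment> \<open>The contribution of \<open>k - 1\<close> to the major index, read off from the smaller tableau.\<close>
  define ex where "ex T' = (if k \<ge> 2 \<and> (\<exists>i j. i < r \<and> T' (i, j) = k - 1) then k - 1 else 0)" for T' :: tableau
  have set_eq: "{T \<in> skew_tableaux l a. \<exists>c. T (r, c) = k} = {T \<in> skew_tableaux l a. T (r, row l r - 1) = k}"
    using max_entry_corner[OF _ lt, of _ r] unfolding k_def by blast
  note bij = remove_box_bij[OF c True[unfolded u_def] k_def[THEN meta_eq_to_obj_eq], folded u_def]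
  have "(\<Sum>T\<in>{T \<in> skew_tableaux l a. \<exists>c. T (r, c) = k}. q ^ maj T)
      = (\<Sum>T\<in>{T \<in> skew_tableaux l a. T (r, row l r - 1) = k}. q ^ (maj (tab_le (k - 1) T) + ex (tab_le (k - 1) T)))"
    unfolding set_eq
  proof (rule sum.cong[OF refl])
    fix T assume T: "T \<in> {T \<in> skew_tableaux l a. T (r, row l r - 1) = k}"
    then have "tab_le (k - 1) T \<in> skew_tableaux u a" using bij_betwE[OF bij] by blast
    from maj_remove_max[OF _ k_def[THEN meta_eq_to_obj_eq] _ k1 this refl sz] T
    show "q ^ maj T = q ^ (maj (tab_le (k - 1) T) + ex (tab_le (k - 1) T))" by (auto simp: ex_def)
  qed
  also have "\<dots> = (\<Sum>T\<in>skew_tableaux u a. q ^ (maj T + ex T))"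
    by (rule sum.reindex_bij_betw[OF bij])
  also have "\<dots> = (\<Sum>T\<in>?A. q ^ (maj T + ex T)) + (\<Sum>T\<in>?B. q ^ (maj T + ex T))"
    by (subst sum.subset_diff[of ?A]) (auto simp: add.commute)
  also have "\<dots> = (\<Sum>T\<in>?A. q ^ maj T) + (\<Sum>T\<in>?B. q ^ (k - 1) * q ^ maj T)"
  proof (intro arg_cong2[where f = "(+)"] sum.cong refl)
    fix T assume T: "T \<in> ?A"
    have "ex T = 0"
    proof (cases "k \<ge> 2")
      case True
      have F: "T \<in> fillings (boxes u - boxes a)" using T skew_tableauxD(1) by blast
      obtain i c where ic: "r \<le> i" "T (i, c) = k - 1" using T sz by auto
      have "(i', j') = (i, c)" if "T (i', j') = k - 1" for i' j'
        using fillings_inj[OF F, of "(i', j')" "(i, c)"] that ic True by auto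
      then have "\<not> (\<exists>i j. i < r \<and> T (i, j) = k - 1)" using ic(1) by (metis not_le prod.inject)
      then show ?thesis unfolding ex_def by simp
    qed (simp add: ex_def)
    then show "q ^ (maj T + ex T) = q ^ maj T" by simp
  next
    fix T assume T: "T \<in> ?B"
    have "ex T = k - 1"
    proof (cases "k \<ge> 2")
      case True
      have Tu: "T \<in> skew_tableaux u a" using T by blast
      moreover have "size_of a < size_of u" using sz True by linarith
      ultimately obtain i c where ic: "T (i, c) = k - 1" using max_entry_exists[of T u a] sz by auto
      have "\<not> r \<le> i"
      proof
        assume "r \<le> i"
        then have "T \<in> ?A" using Tu ic sz by auto
        then show False using T by blast
      qed
      then have "\<exists>i j. i < r \<and> T (i, j) = k - 1" using ic not_le by blast
      then show ?thesis using True unfolding ex_def by simp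
    qed (auto simp: ex_def)
    then show "q ^ (maj T + ex T) = q ^ (k - 1) * q ^ maj T" by (simp add: power_add)
  qed
  also have "(\<Sum>T\<in>?B. q ^ (k - 1) * q ^ maj T) = q ^ (k - 1) * (skew_gf q u a - skew_gf_from r q u a)"
    unfolding skew_gf_def skew_gf_from_def
    by (simp only: sum_distrib_left[symmetric]) (subst sum_diff, auto)
  also have "(\<Sum>T\<in>?A. q ^ maj T) = skew_gf_from r q u a" by (simp add: skew_gf_from_def)
  finally show ?thesis by (simp add: algebra_simps)
qed

lemma skew_gf_from_Suc:
  assumes lt: "size_of a < size_of l"
  defines "k \<equiv> size_of l - size_of a"
  shows "skew_gf_from r q l a = skew_gf_from (Suc r) q l a
     + (if corner r l then q ^ (k - 1) * skew_gf q (remove_box r l) a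
                         + (1 - q ^ (k - 1)) * skew_gf_from r q (remove_box r l) a else 0)"
proof -
  let ?S = "\<lambda>r. {T \<in> skew_tableaux l a. \<exists>i c. r \<le> i \<and> T (i, c) = k}"
  let ?R = "{T \<in> skew_tableaux l a. \<exists>c. T (r, c) = k}"
  have un: "?S r = ?S (Suc r) \<union> ?R"
  proof -
    have "r \<le> i \<longleftrightarrow> Suc r \<le> i \<or> i = r" for i by auto
    then show ?thesis by blast
  qed
  have disj: "?S (Suc r) \<inter> ?R = {}"
  proof -
    have False if T: "T \<in> skew_tableaux l a" and "T (r, c) = k" "T (i, c') = k" "Suc r \<le> i" for T i c c'
      using fillings_inj[OF skew_tableauxD(1)[OF T], of "(r, c)" "(i, c')"] that lt by (auto simp: k_def)
    then show ?thesis by blast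
  qed
  have R0: "(\<Sum>T\<in>?R. q ^ maj T) = 0" if "\<not> corner r l"
  proof -
    have "?R = {}" using max_entry_corner[OF _ lt, of _ r] that unfolding k_def by blast
    then show ?thesis by (simp only: sum.empty)
  qed
  have "skew_gf_from r q l a = (\<Sum>T\<in>?S (Suc r). q ^ maj T) + (\<Sum>T\<in>?R. q ^ maj T)"
    unfolding skew_gf_from_def k_def[symmetric] un by (rule sum.union_disjoint[OF _ _ disj]) auto
  also have "(\<Sum>T\<in>?S (Suc r). q ^ maj T) = skew_gf_from (Suc r) q l a"
    by (simp add: skew_gf_from_def k_def)
  finally show ?thesis
    using skew_gf_max_row[OF _ lt, of r q] R0 unfolding k_def[symmetric] by (auto split: if_splits)
qed

section \<open>Peeling off the last run without descents\<close>

lemma q_fact_0 [simp]: "q_fact q 0 = 1"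
  by (simp add: q_fact_def)

lemma q_fact_Suc: "q_fact q (Suc n) = q_fact q n * (\<Sum>k<Suc n. q ^ k)"
  by (simp add: q_fact_def mult.commute)

lemma q_fact_step: "(1 - q ^ Suc n) * q_fact q n = (1 - q) * q_fact q (Suc n)"
  by (simp only: q_fact_Suc one_diff_power_eq) (simp only: mult_ac)

lemma q_fact_pos [simp]: "q > 0 \<Longrightarrow> q_fact q n > 0"
  unfolding q_fact_def by (intro prod_pos ballI sum_pos) (auto simp: lessThan_empty_iff)

lemma q_fact_nonzero [simp]: "q > 0 \<Longrightarrow> q_fact q n \<noteq> 0"
  by (metis less_irrefl q_fact_pos)

text \<open>The normalisation by \<open>[k]_q!\<close>, with \<open>k\<close> the number of boxes of the skew shape, makes the
  later identities free of \<open>q\<close>-binomial coefficients. Compared with the normalisation by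
  \<open>(1 - q) ... (1 - q ^ k)\<close>, which gives the value of the skew Schur function at
  \<open>1, q, q^2, ...\<close>, it has a meaning also at \<open>q = 1\<close>.\<close>

definition norm_gf :: "real \<Rightarrow> shape \<Rightarrow> shape \<Rightarrow> real" where
  "norm_gf q l a = skew_gf q l a / q_fact q (size_of l - size_of a)"

lemma norm_gf_0: "\<not> boxes a \<subseteq> boxes l \<Longrightarrow> norm_gf q l a = 0"
  by (simp add: norm_gf_def skew_gf_0)

lemma norm_gf_small: "size_of l < size_of a \<Longrightarrow> norm_gf q l a = 0"
  using size_of_mono[of a l] by (intro norm_gf_0) auto

lemma norm_gf_self [simp]: "norm_gf q a a = 1"
  by (simp add: norm_gf_def)

lemma norm_gf_same_size: "size_of l \<le> size_of a \<Longrightarrow> l \<noteq> a \<Longrightarrow> norm_gf q l a = 0"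
  using boxes_eq_of_size[of a l] by (intro norm_gf_0) auto

text \<open>These are the inner shapes left after removing a nonempty final run without descents
  whose largest entry is in row \<open>r\<close> or below: along such a run the rows weakly decrease in
  index, so the run fills a horizontal strip, from its lowest row upwards, that does not meet
  the rows above \<open>r\<close>.\<close>

definition run_shapes :: "nat \<Rightarrow> shape \<Rightarrow> shape set" where
  "run_shapes r l = {k. hstrip k l \<and> k \<noteq> l \<and> (\<forall>i<r. row k i = row l i)}"

lemma finite_run_shapes [simp]: "finite (run_shapes r l)"
  by (simp add: run_shapes_def)

lemma run_shapes_size: "k \<in> run_shapes r l \<Longrightarrow> size_of k < size_of l"
  using hstrip_size[of k l] hstrip_eq_of_size[of k l] by (force simp: run_shapes_def)

lemma run_shapes_large: "\<forall>i\<ge>r. row l i = 0 \<Longrightarrow> run_shapes r l = {}"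
proof -
  assume z: "\<forall>i\<ge>r. row l i = 0"
  have "k = l" if "hstrip k l" "\<forall>i<r. row k i = row l i" for k
  proof (rule shape_eqI)
    fix i show "row k i = row l i"
      using that z by (cases "i < r") (auto simp: hstrip_def not_less, metis le_zero_eq)
  qed
  then show ?thesis by (auto simp: run_shapes_def)
qed

text \<open>Either no box of row \<open>r\<close> is removed, or the last box of row \<open>r\<close> is removed and the rest
  of the strip may be empty.\<close>

lemma run_shapes_Suc:
  "run_shapes r l = run_shapes (Suc r) l
     \<union> (if corner r l then insert (remove_box r l) (run_shapes r (remove_box r l)) else {})"
proof -
  let ?B = "{k. hstrip k l \<and> (\<forall>i<r. row k i = row l i) \<and> row k r < row l r}"
  have "run_shapes r l = run_shapes (Suc r) l \<union> ?B"
  proof -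
    have "row k r = row l r \<or> row k r < row l r" if "hstrip k l" for k
      using that by (metis hstrip_def le_neq_implies_less)
    then show ?thesis by (auto simp: run_shapes_def less_Suc_eq)
  qed
  moreover have "?B = {}" if "\<not> corner r l"
    using that by (auto simp: corner_def hstrip_def) (meson le_less_trans not_less)
  moreover have "?B = insert (remove_box r l) (run_shapes r (remove_box r l))" if c: "corner r l"
  proof -
    let ?u = "remove_box r l"
    have "insert ?u (run_shapes r ?u) = {k. hstrip k ?u \<and> (\<forall>i<r. row k i = row ?u i)}"
      by (auto simp: run_shapes_def)
    also have "\<dots> = ?B"
    proof (rule Collect_cong, rule iffI)
      fix k assume k: "hstrip k ?u \<and> (\<forall>i<r. row k i = row ?u i)"
      have up: "row k i \<le> row ?u i" "row ?u (Suc i) \<le> row k i" for i using k by (auto simp: hstrip_def)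
      have "row k i \<le> row l i \<and> row l (Suc i) \<le> row k i" for i
      proof
        show "row k i \<le> row l i" using up(1)[of i] by (auto simp: row_remove_box[OF c] split: if_splits)
        show "row l (Suc i) \<le> row k i"
        proof (cases "Suc i = r")
          case True
          then have "row k i = row l i" using k by (auto simp: row_remove_box[OF c])
          then show ?thesis using row_antimono[of i "Suc i" l] by simp
        next
          case False
          then show ?thesis using up(2)[of i] by (simp add: row_remove_box[OF c])
        qed
      qed
      moreover have "row k r < row l r" using up(1)[of r] c by (simp add: row_remove_box[OF c] corner_def)
      ultimately show "hstrip k l \<and> (\<forall>i<r. row k i = row l i) \<and> row k r < row l r"
        using k by (auto simp: hstrip_def row_remove_box[OF c])
    next
      fix k assume k: "hstrip k l \<and> (\<forall>i<r. row k i = row l i) \<and> row k r < row l r"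
      then have "row k i \<le> row l i" "row l (Suc i) \<le> row k i" for i by (auto simp: hstrip_def)
      then show "hstrip k ?u \<and> (\<forall>i<r. row k i = row ?u i)"
        using k by (auto simp: hstrip_def row_remove_box[OF c] le_diff_conv)
          (metis One_nat_def Suc_leI le_diff_conv add.commute plus_1_eq_Suc less_eq_Suc_le diff_Suc_1 le_Suc_eq)+
    qed
    finally show ?thesis by simp
  qed
  ultimately show ?thesis by (auto split: if_splits)
qed

text \<open>The tableaux are classified by their final runs. Write \<open>S_d\<close> for the part of the
  generating function whose last descent is at most \<open>d\<close>, and \<open>P_d\<close> for the sum over all ways to
  cut off the entries above \<open>d\<close> as a horizontal strip, weighted by the major index of what is
  left. A tableau with last descent exactly \<open>d\<close> is counted in \<open>P_d\<close> without the summand \<open>d\<close> of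
  its major index, so \<open>S_d = q^d P_d + (1 - q^d) S_(d-1)\<close>, and unrolling this gives the
  coefficients below. The induction below obtains the same formula box by box, on the size of
  \<open>l\<close> and downwards on \<open>r\<close>, which avoids constructing the filling of a horizontal strip.\<close>

lemma skew_gf_from_expand:
  assumes q: "q > 0"
  shows "size_of a < size_of l \<Longrightarrow> skew_gf_from r q l a = q_fact q (size_of l - size_of a - 1)
     * (\<Sum>k\<in>run_shapes r l. q ^ (size_of k - size_of a) * (1 - q) ^ (size_of l - 1 - size_of k) * norm_gf q k a)"
proof (induction "size_of l" arbitrary: l r rule: less_induct)
  case less
  define w where "w l k = q ^ (size_of k - size_of a) * (1 - q) ^ (size_of l - 1 - size_of k) * norm_gf q k a" for l k
  define n where "n = size_of l - size_of a"
  obtain N where N: "\<forall>i\<ge>N. row l i = 0" using row_eventually_0 by blast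
  have "skew_gf_from r q l a = q_fact q (n - 1) * (\<Sum>k\<in>run_shapes r l. w l k)"
  proof (cases "N \<le> r")
    case True
    then show ?thesis using N skew_gf_from_large[OF less.prems] run_shapes_large[of r l] by simp
  next
    case False
    then have "r \<le> N" by simp
    then show ?thesis
    proof (induction rule: inc_induct)
      case base
      then show ?case using N skew_gf_from_large[OF less.prems] run_shapes_large[of N l] by simp
    next
      case (step r)
      show ?case
      proof (cases "corner r l")
        case False
        then show ?thesis
          using step.IH skew_gf_from_Suc[OF less.prems, of r q] run_shapes_Suc[of r l] by simp
      next
        case c: True
        define u where "u = remove_box r l"
        have su: "size_of l = Suc (size_of u)" using size_remove_box[OF c] by (simp add: u_def)
        have disj: "run_shapes (Suc r) l \<inter> insert u (run_shapes r u) = {}"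
        proof -
          have "row k r < row l r" if "k \<in> insert u (run_shapes r u)" for k
          proof -
            have "row k r \<le> row u r" using that by (auto simp: run_shapes_def hstrip_def)
            then show ?thesis using c by (simp add: u_def row_remove_box corner_def)
          qed
          then show ?thesis by (force simp: run_shapes_def)
        qed
        have u_notin: "u \<notin> run_shapes r u" by (simp add: run_shapes_def)
        have split: "(\<Sum>k\<in>run_shapes r l. w l k)
            = (\<Sum>k\<in>run_shapes (Suc r) l. w l k) + (w l u + (\<Sum>k\<in>run_shapes r u. w l k))"
          using run_shapes_Suc[of r l] c disj u_notin by (simp add: u_def[symmetric] sum.union_disjoint)
        have nu: "n - 1 = size_of u - size_of a" using su by (simp add: n_def)
        have top: "q ^ (n - 1) * skew_gf q u a = q_fact q (n - 1) * w l u"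
          using q_fact_pos[OF q, of "n - 1"] unfolding nu by (simp add: w_def norm_gf_def su)
        have wl: "(\<Sum>k\<in>run_shapes r u. w l k) = (1 - q) * (\<Sum>k\<in>run_shapes r u. w u k)"
          unfolding sum_distrib_left
        proof (rule sum.cong[OF refl])
          fix k assume "k \<in> run_shapes r u"
          then have "size_of l - 1 - size_of k = Suc (size_of u - 1 - size_of k)"
            using run_shapes_size[of k r u] su by simp
          then show "w l k = (1 - q) * w u k" by (simp add: w_def)
        qed
        have bot: "(1 - q ^ (n - 1)) * skew_gf_from r q u a = q_fact q (n - 1) * (\<Sum>k\<in>run_shapes r u. w l k)"
        proof (cases "size_of a < size_of u")
          case True
          have n2: "size_of u - size_of a - 1 = n - 2" using nu by linarith
          from True have "skew_gf_from r q u a = q_fact q (n - 2) * (\<Sum>k\<in>run_shapes r u. w u k)"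
            using less.hyps[of u r] su n2 by (simp add: w_def)
          moreover have "n - 1 = Suc (n - 2)" using True nu by linarith
          ultimately show ?thesis using q_fact_step[of q "n - 2"] wl by (simp add: mult_ac)
        next
          case False
          then have "n - 1 = 0" using nu by simp
          moreover have "w l k = 0" if "k \<in> run_shapes r u" for k
            using run_shapes_size[OF that] False norm_gf_small[of k a q] by (simp add: w_def)
          ultimately show ?thesis by simp
        qed
        show ?thesis
          using skew_gf_from_Suc[OF less.prems, of r q] c step.IH split top bot
          unfolding u_def[symmetric] n_def[symmetric] by (simp add: distrib_left)
      qed
    qed
  qed
  then show ?case by (simp add: w_def n_def)
qed

text \<open>The case \<open>r = 0\<close> of the previous lemma, multiplied by \<open>1 - q\<close>, with the term for \<open>k = l\<close>
  added on both sides. In terms of symmetric functions it separates the first of the variables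
  \<open>1, q, q^2, ...\<close> from the others. Since \<open>norm_gf q k a\<close> vanishes for \<open>size_of k < size_of a\<close>,
  the truncated subtraction in the exponent is harmless. At \<open>q = 1\<close> only the term for \<open>k = l\<close>
  remains and the identity carries no information, which is why the case \<open>q = 1\<close> is later
  treated by continuity.\<close>

lemma norm_gf_hstrip_expansion:
  assumes q: "q > 0"
  shows "norm_gf q l a
    = (\<Sum>k\<in>{k. hstrip k l}. q ^ (size_of k - size_of a) * (1 - q) ^ (size_of l - size_of k) * norm_gf q k a)"
    (is "_ = (\<Sum>k\<in>_. ?w k)")
proof -
  have set: "{k. hstrip k l} = insert l (run_shapes 0 l)" by (auto simp: run_shapes_def)
  have "l \<notin> run_shapes 0 l" by (simp add: run_shapes_def)
  then have split: "(\<Sum>k\<in>{k. hstrip k l}. ?w k)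
      = q ^ (size_of l - size_of a) * norm_gf q l a + (\<Sum>k\<in>run_shapes 0 l. ?w k)"
    unfolding set by simp
  show ?thesis
  proof (cases "size_of a < size_of l")
    case True
    define n where "n = size_of l - size_of a - 1"
    have n: "size_of l - size_of a = Suc n" using True by (simp add: n_def)
    have "(\<Sum>k\<in>run_shapes 0 l. ?w k)
        = (1 - q) * (\<Sum>k\<in>run_shapes 0 l. q ^ (size_of k - size_of a) * (1 - q) ^ (size_of l - 1 - size_of k) * norm_gf q k a)"
      unfolding sum_distrib_left
    proof (rule sum.cong[OF refl])
      fix k assume "k \<in> run_shapes 0 l"
      then have "size_of l - size_of k = Suc (size_of l - 1 - size_of k)"
        using run_shapes_size[of k 0 l] by simp
      then show "?w k = (1 - q) * (q ^ (size_of k - size_of a) * (1 - q) ^ (size_of l - 1 - size_of k) * norm_gf q k a)"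
        by simp
    qed
    then have "q_fact q n * (\<Sum>k\<in>run_shapes 0 l. ?w k) = (1 - q) * skew_gf q l a"
      using skew_gf_from_expand[OF q True, of 0] skew_gf_from_0[OF True, of q] by (simp add: n_def mult_ac)
    also have "\<dots> = (1 - q) * q_fact q (Suc n) * norm_gf q l a"
      using q_fact_pos[OF q, of "Suc n"] by (simp add: norm_gf_def n)
    also have "\<dots> = q_fact q n * ((1 - q ^ Suc n) * norm_gf q l a)"
      by (simp only: q_fact_step[symmetric] mult_ac)
    finally have "(\<Sum>k\<in>run_shapes 0 l. ?w k) = (1 - q ^ Suc n) * norm_gf q l a"
      using q_fact_pos[OF q, of n] by simp
    then show ?thesis using split n by (simp add: algebra_simps)
  next
    case False
    have "?w k = 0" if "k \<in> run_shapes 0 l" for k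
      using run_shapes_size[OF that] False norm_gf_small[of k a q] by simp
    then have "(\<Sum>k\<in>run_shapes 0 l. ?w k) = 0" by (rule sum.neutral[OF ballI])
    then show ?thesis using split False by simp
  qed
qed

text \<open>For \<open>q < 1\<close> and up to a power of \<open>1 - q\<close>, the numbers \<open>1 / [u]_q!\<close> are the coefficients
  of the infinite product \<open>e(x) = 1 / ((1 - x) (1 - q x) (1 - q^2 x) ...)\<close>, and the identity
  says \<open>(1 - x) e(x) = e(q x)\<close>.\<close>

lemma q_exp_identity:
  assumes q: "q > 0"
  shows "(\<Sum>u\<le>v. q ^ u * (1 - q) ^ (v - u) / q_fact q u) = 1 / q_fact q v"
proof (induction v)
  case (Suc v)
  have "(\<Sum>u\<le>Suc v. q ^ u * (1 - q) ^ (Suc v - u) / q_fact q u)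
      = (\<Sum>u\<le>v. (1 - q) * (q ^ u * (1 - q) ^ (v - u) / q_fact q u)) + q ^ Suc v / q_fact q (Suc v)"
    by (simp add: Suc_diff_le mult_ac)
  also have "\<dots> = (1 - q) / q_fact q v + q ^ Suc v / q_fact q (Suc v)"
    unfolding sum_distrib_left[symmetric] Suc.IH by simp
  also have "(1 - q) / q_fact q v = (1 - q ^ Suc v) / q_fact q (Suc v)"
    using q_fact_step[of q v] q_fact_pos[OF q] by (simp add: divide_simps less_imp_neq[symmetric] mult_ac del: power_Suc)
  finally show ?case by (simp add: diff_divide_distrib)
qed simp

section \<open>Commuting a strip past a generating function\<close>

text \<open>Two sides of a commutation relation: add boxes to \<open>a\<close> with weight \<open>q ^ maj\<close> and then
  remove a horizontal strip to reach \<open>n\<close>, or first remove a horizontal strip from \<open>a\<close> and then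
  add boxes.\<close>

definition strip_sum :: "real \<Rightarrow> nat \<Rightarrow> shape \<Rightarrow> shape \<Rightarrow> real" where
  "strip_sum q L n a = (\<Sum>l\<in>{l. size_of l = L \<and> hstrip n l}. norm_gf q l a)"

definition commuted_sum :: "real \<Rightarrow> nat \<Rightarrow> shape \<Rightarrow> shape \<Rightarrow> real" where
  "commuted_sum q L n a = (\<Sum>s\<in>{s. hstrip s a \<and> size_of a + size_of n \<le> L + size_of s}.
     norm_gf q n s / q_fact q (L + size_of s - (size_of a + size_of n)))"

text \<open>The recursion that both sides satisfy. The right-hand side refers to \<open>X L n\<close> itself only
  in the term \<open>r = n\<close>, \<open>K = L\<close>, and otherwise to sizes \<open>K < L\<close>.\<close>

definition strip_rec :: "real \<Rightarrow> shape \<Rightarrow> (nat \<Rightarrow> shape \<Rightarrow> real) \<Rightarrow> nat \<Rightarrow> shape \<Rightarrow> real" where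
  "strip_rec q a X L n = (\<Sum>r\<in>{r. hstrip r n}. \<Sum>K\<in>{K \<in> {..L}. K + size_of n \<le> L + size_of r}.
     q ^ (K - size_of a) * (1 - q) ^ (L - K) * X K r)"

lemma sum_by_size:
  assumes "\<And>k. k \<in> S \<Longrightarrow> P (size_of k)" "finite S" "finite {K. P K}"
  shows "(\<Sum>k\<in>S. f k) = (\<Sum>K\<in>{K. P K}. \<Sum>k\<in>{k \<in> S. size_of k = K}. f k)"
  by (rule sum.group[symmetric]) (use assms in auto)

text \<open>Peel off the first variable and exchange the order of the two strips by the local rule.\<close>

lemma strip_sum_rec:
  assumes q: "q > 0"
  shows "strip_sum q L n a = strip_rec q a (\<lambda>K r. strip_sum q K r a) L n"
proof -
  define W where "W k = q ^ (size_of k - size_of a) * (1 - q) ^ (L - size_of k) * norm_gf q k a" for k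
  let ?Y = "{k. size_of k \<le> L}"
  let ?A = "{l. size_of l = L \<and> hstrip n l}"
  have "strip_sum q L n a = (\<Sum>l\<in>?A. \<Sum>k\<in>{k \<in> ?Y. hstrip k l}. W k)"
    unfolding strip_sum_def
  proof (rule sum.cong[OF refl])
    fix l assume l: "l \<in> ?A"
    have "{k. hstrip k l} = {k \<in> ?Y. hstrip k l}" using l hstrip_size by auto
    then show "norm_gf q l a = (\<Sum>k\<in>{k \<in> ?Y. hstrip k l}. W k)"
      using norm_gf_hstrip_expansion[OF q, of l a] l by (simp add: W_def)
  qed
  also have "\<dots> = (\<Sum>k\<in>?Y. \<Sum>l\<in>{l \<in> ?A. hstrip k l}. W k)"
    by (rule sum.swap_restrict) (auto simp: finite_shapes_le)
  also have "\<dots> = (\<Sum>k\<in>?Y. \<Sum>r\<in>{r \<in> {r. hstrip r n}. hstrip r k \<and> size_of k + size_of n \<le> L + size_of r}. W k)"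
  proof (rule sum.cong[OF refl])
    fix k
    have "card {l \<in> ?A. hstrip k l} = card {r \<in> {r. hstrip r n}. hstrip r k \<and> size_of k + size_of n \<le> L + size_of r}"
      using card_hstrips_above_below[of L n k] by (simp add: conj_ac add.commute)
    then show "(\<Sum>l\<in>{l \<in> ?A. hstrip k l}. W k)
      = (\<Sum>r\<in>{r \<in> {r. hstrip r n}. hstrip r k \<and> size_of k + size_of n \<le> L + size_of r}. W k)" by simp
  qed
  also have "\<dots> = (\<Sum>r\<in>{r. hstrip r n}. \<Sum>k\<in>{k \<in> ?Y. hstrip r k \<and> size_of k + size_of n \<le> L + size_of r}. W k)"
    by (rule sum.swap_restrict) (auto simp: finite_shapes_le)
  also have "\<dots> = strip_rec q a (\<lambda>K r. strip_sum q K r a) L n"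
    unfolding strip_rec_def
  proof (rule sum.cong[OF refl])
    fix r
    let ?S = "{k \<in> ?Y. hstrip r k \<and> size_of k + size_of n \<le> L + size_of r}"
    let ?P = "\<lambda>K. K \<in> {..L} \<and> K + size_of n \<le> L + size_of r"
    have "(\<Sum>k\<in>?S. W k) = (\<Sum>K\<in>{K. ?P K}. \<Sum>k\<in>{k \<in> ?S. size_of k = K}. W k)"
      by (rule sum_by_size) (auto simp: finite_shapes_le)
    also have "\<dots> = (\<Sum>K\<in>{K. ?P K}. q ^ (K - size_of a) * (1 - q) ^ (L - K) * strip_sum q K r a)"
    proof (rule sum.cong[OF refl])
      fix K assume K: "K \<in> {K. ?P K}"
      then have "{k \<in> ?S. size_of k = K} = {k. size_of k = K \<and> hstrip r k}" by auto
      then show "(\<Sum>k\<in>{k \<in> ?S. size_of k = K}. W k) = q ^ (K - size_of a) * (1 - q) ^ (L - K) * strip_sum q K r a"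
        by (simp add: strip_sum_def sum_distrib_left W_def)
    qed
    finally show "(\<Sum>k\<in>?S. W k) = (\<Sum>K\<in>{K. ?P K}. q ^ (K - size_of a) * (1 - q) ^ (L - K) * strip_sum q K r a)" .
  qed
  finally show ?thesis .
qed

text \<open>For fixed \<open>r\<close> and \<open>s\<close> the sum over \<open>K\<close> collapses by the identity for \<open>1 / [u]_q!\<close>; the
  remaining sum over \<open>r\<close> is the horizontal strip expansion of \<open>norm_gf q n s\<close>.\<close>

lemma commuted_sum_rec:
  assumes q: "q > 0"
  shows "commuted_sum q L n a = strip_rec q a (\<lambda>K r. commuted_sum q K r a) L n"
proof -
  let ?H = "{s. hstrip s a}"
  let ?R = "{r. hstrip r n}"
  define c where "c K r s = q ^ (K - size_of a) * (1 - q) ^ (L - K)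
        * (norm_gf q r s / q_fact q (K + size_of s - (size_of a + size_of r)))" for K r s
  have inner: "(\<Sum>K\<in>{K \<in> {..L}. K + size_of n \<le> L + size_of r \<and> size_of a + size_of r \<le> K + size_of s}. c K r s)
      = (if size_of a + size_of n \<le> L + size_of s then
          q ^ (size_of r - size_of s) * (1 - q) ^ (size_of n - size_of r) * norm_gf q r s / q_fact q (L + size_of s - (size_of a + size_of n))
         else 0)"
    (is "(\<Sum>K\<in>?K. _) = ?rhs") if r: "hstrip r n" and s: "hstrip s a" for r s
  proof (cases "size_of s \<le> size_of r")
    case False
    then have "norm_gf q r s = 0" by (intro norm_gf_small) simp
    then show ?thesis by (simp add: c_def)
  next
    case sr: True
    define d where "d = size_of r - size_of s"
    have d: "size_of r = size_of s + d" using sr by (simp add: d_def)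
    obtain e where e: "size_of n = size_of r + e" using hstrip_size[OF r] le_Suc_ex by blast
    obtain f where f: "size_of a = size_of s + f" using hstrip_size[OF s] le_Suc_ex by blast
    show ?thesis
    proof (cases "size_of a + size_of n \<le> L + size_of s")
      case False
      then have "?K = {}" by auto
      then show ?thesis using False by (simp only: sum.empty if_False)
    next
      case True
      define v where "v = L + size_of s - (size_of a + size_of n)"
      have L: "L = v + f + size_of r + e" using True f e by (simp add: v_def)
      \<comment> \<open>The lower bound for \<open>K\<close> makes the index of the \<open>q\<close>-factorial zero, the upper bound makes it \<open>v\<close>.\<close>
      have bij: "(\<Sum>K\<in>?K. c K r s) = (\<Sum>u\<in>{..v}. c (u + (size_of a + d)) r s)"
        by (rule sum.reindex_bij_witness[where i = "\<lambda>u. u + (size_of a + d)" and j = "\<lambda>K. K - (size_of a + d)"])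
          (use L f e d in auto)
      also have "\<dots> = (\<Sum>u\<le>v. q ^ d * (1 - q) ^ e * norm_gf q r s * (q ^ u * (1 - q) ^ (v - u) / q_fact q u))"
      proof (rule sum.cong[OF refl])
        fix u assume u: "u \<in> {..v}"
        have "L - (u + (size_of a + d)) = (v - u) + e" using u L f d by simp
        moreover have "u + (size_of a + d) + size_of s - (size_of a + size_of r) = u" using d by simp
        ultimately show "c (u + (size_of a + d)) r s = q ^ d * (1 - q) ^ e * norm_gf q r s * (q ^ u * (1 - q) ^ (v - u) / q_fact q u)"
          by (simp add: c_def power_add)
      qed
      also have "\<dots> = q ^ d * (1 - q) ^ e * norm_gf q r s / q_fact q v"
        unfolding sum_distrib_left[symmetric] q_exp_identity[OF q] by simp
      finally show ?thesis using True e by (simp add: d_def v_def)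
    qed
  qed
  have "strip_rec q a (\<lambda>K r. commuted_sum q K r a) L n
    = (\<Sum>r\<in>?R. \<Sum>K\<in>{K \<in> {..L}. K + size_of n \<le> L + size_of r}. \<Sum>s\<in>{s \<in> ?H. size_of a + size_of r \<le> K + size_of s}. c K r s)"
    unfolding strip_rec_def commuted_sum_def by (simp add: c_def sum_distrib_left)
  also have "\<dots> = (\<Sum>r\<in>?R. \<Sum>s\<in>?H. \<Sum>K\<in>{K \<in> {K \<in> {..L}. K + size_of n \<le> L + size_of r}. size_of a + size_of r \<le> K + size_of s}. c K r s)"
    by (rule sum.cong[OF refl], rule sum.swap_restrict) auto
  also have "\<dots> = (\<Sum>r\<in>?R. \<Sum>s\<in>?H. \<Sum>K\<in>{K \<in> {..L}. K + size_of n \<le> L + size_of r \<and> size_of a + size_of r \<le> K + size_of s}. c K r s)"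
    by (simp add: conj_ac)
  also have "\<dots> = (\<Sum>r\<in>?R. \<Sum>s\<in>?H. (if size_of a + size_of n \<le> L + size_of s then
          q ^ (size_of r - size_of s) * (1 - q) ^ (size_of n - size_of r) * norm_gf q r s / q_fact q (L + size_of s - (size_of a + size_of n))
         else 0))"
    using inner by (intro sum.cong refl) simp
  also have "\<dots> = (\<Sum>s\<in>?H. \<Sum>r\<in>?R. (if size_of a + size_of n \<le> L + size_of s then
          q ^ (size_of r - size_of s) * (1 - q) ^ (size_of n - size_of r) * norm_gf q r s / q_fact q (L + size_of s - (size_of a + size_of n))
         else 0))"
    by (rule sum.swap)
  also have "\<dots> = (\<Sum>s\<in>?H. if size_of a + size_of n \<le> L + size_of s then
          norm_gf q n s / q_fact q (L + size_of s - (size_of a + size_of n)) else 0)"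
    using norm_gf_hstrip_expansion[OF q, of n] by (intro sum.cong refl) (simp add: sum_divide_distrib[symmetric])
  also have "\<dots> = commuted_sum q L n a"
    unfolding commuted_sum_def by (subst sum.inter_filter[symmetric]) auto
  finally show ?thesis by simp
qed

text \<open>By induction on \<open>L\<close>, the difference of the two sides satisfies
  \<open>X = q ^ (L - size_of a) * X\<close>, so it vanishes for \<open>q \<noteq> 1\<close> and \<open>L > size_of a\<close>.\<close>

lemma strip_sum_eq_commuted_sum:
  assumes q: "q > 0" "q \<noteq> 1"
  shows "strip_sum q L n a = commuted_sum q L n a"
proof (induction L arbitrary: n rule: less_induct)
  case (less L)
  consider "L < size_of a" | "L = size_of a" | "L > size_of a" by linarith
  then show ?case
  proof cases
    case 1
    have "strip_sum q L n a = 0" unfolding strip_sum_def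
      using 1 norm_gf_small by (intro sum.neutral) auto
    moreover have "commuted_sum q L n a = 0" unfolding commuted_sum_def
    proof (intro sum.neutral ballI)
      fix s assume "s \<in> {s. hstrip s a \<and> size_of a + size_of n \<le> L + size_of s}"
      then have "norm_gf q n s = 0" using 1 by (intro norm_gf_small) auto
      then show "norm_gf q n s / q_fact q (L + size_of s - (size_of a + size_of n)) = 0" by simp
    qed
    ultimately show ?thesis by simp
  next
    case 2
    have "strip_sum q L n a = (if hstrip n a then 1 else 0)"
    proof -
      have "strip_sum q L n a = (\<Sum>l\<in>{l. size_of l = L \<and> hstrip n l}. if l = a then 1 else 0)"
        unfolding strip_sum_def using 2 norm_gf_same_size by (intro sum.cong) auto
      then show ?thesis using 2 by (simp add: sum.delta)
    qed
    moreover have "commuted_sum q L n a = (if hstrip n a then 1 else 0)"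
    proof -
      have "commuted_sum q L n a = (\<Sum>s\<in>{s. hstrip s a \<and> size_of n \<le> size_of s}. if s = n then 1 else 0)"
        unfolding commuted_sum_def using 2 norm_gf_same_size[of n] by (intro sum.cong) auto
      then show ?thesis by (simp add: sum.delta)
    qed
    ultimately show ?thesis by simp
  next
    case 3
    define w where "w K = q ^ (K - size_of a) * (1 - q) ^ (L - K)" for K
    let ?S = "strip_sum q L n a" and ?C = "commuted_sum q L n a"
    have diff: "?S - ?C = (\<Sum>r\<in>{r. hstrip r n}. \<Sum>K\<in>{K \<in> {..L}. K + size_of n \<le> L + size_of r}.
        w K * (strip_sum q K r a - commuted_sum q K r a))"
      by (subst strip_sum_rec[OF q(1)], subst commuted_sum_rec[OF q(1)])
        (simp add: strip_rec_def w_def sum_subtractf[symmetric] right_diff_distrib)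
    also have "\<dots> = (\<Sum>r\<in>{r. hstrip r n}. \<Sum>K\<in>{K \<in> {..L}. K + size_of n \<le> L + size_of r}.
        if r = n \<and> K = L then w L * (?S - ?C) else 0)"
    proof (intro sum.cong refl)
      fix r K assume r: "r \<in> {r. hstrip r n}" and K: "K \<in> {K \<in> {..L}. K + size_of n \<le> L + size_of r}"
      show "w K * (strip_sum q K r a - commuted_sum q K r a) = (if r = n \<and> K = L then w L * (?S - ?C) else 0)"
      proof (cases "K = L")
        case True
        then have "r = n" using r K hstrip_eq_of_size[of r n] by auto
        then show ?thesis using True by simp
      next
        case False
        then show ?thesis using less.IH[of K r] K by simp
      qed
    qed
    also have "\<dots> = (\<Sum>r\<in>{r. hstrip r n}. if r = n then w L * (?S - ?C) else 0)"
    proof (intro sum.cong refl)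
      fix r assume "r \<in> {r. hstrip r n}"
      show "(\<Sum>K\<in>{K \<in> {..L}. K + size_of n \<le> L + size_of r}. if r = n \<and> K = L then w L * (?S - ?C) else 0)
         = (if r = n then w L * (?S - ?C) else 0)"
        by (cases "r = n") (simp_all add: sum.delta)
    qed
    also have "\<dots> = w L * (?S - ?C)" by (simp add: sum.delta)
    finally have "(1 - w L) * (?S - ?C) = 0" by (simp add: algebra_simps)
    moreover have "w L \<noteq> 1"
      using 3 q power_eq_1_iff[of q "L - size_of a"] by (auto simp: w_def)
    ultimately show ?thesis by simp
  qed
qed

section \<open>Summing over all outer shapes\<close>

text \<open>The outer shape varies in \<open>level_sum\<close> and the inner shape in \<open>removed_sum\<close>; in both cases
  the second argument is the number of boxes of the skew shape.\<close>

definition level_sum :: "real \<Rightarrow> nat \<Rightarrow> shape \<Rightarrow> real" where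
  "level_sum q k a = (\<Sum>l\<in>{l. size_of l = size_of a + k}. norm_gf q l a)"

definition removed_sum :: "real \<Rightarrow> nat \<Rightarrow> shape \<Rightarrow> real" where
  "removed_sum q h a = (\<Sum>m\<in>{m. size_of m + h = size_of a}. norm_gf q a m)"

text \<open>The coefficients of \<open>e(q (1 - q) z^2) / (1 - (1 - q) z)\<close> with \<open>e(x) = \<Sum> x^u / [u]_q!\<close>. In
  the identity \<open>\<Sum> s_\<lambda> = \<Prod> 1 / (1 - x_i) * \<Prod> 1 / (1 - x_i x_j)\<close>, with \<open>i < j\<close> in the second
  product, these are the factors that contain the first variable, after rescaling the variables
  by \<open>1 - q\<close>.\<close>

definition pair_coeff :: "real \<Rightarrow> nat \<Rightarrow> real" where
  "pair_coeff q n = (\<Sum>u\<in>{u. 2 * u \<le> n}. q ^ u * (1 - q) ^ (n - u) / q_fact q u)"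

lemma finite_shapes_size_plus [simp]: "finite {m. size_of m + h = n}"
  by (rule finite_subset[OF _ finite_shapes_le[of n]]) auto

lemma finite_double_le [simp]: "finite {u::nat. 2 * u \<le> n}"
  by (rule finite_subset[of _ "{..n}"]) auto

lemma pair_coeff_0 [simp]: "pair_coeff q 0 = 1"
proof -
  have "{u::nat. 2 * u \<le> 0} = {0}" by auto
  then show ?thesis by (simp add: pair_coeff_def)
qed

lemma level_sum_0 [simp]: "level_sum q 0 a = 1"
proof -
  have "level_sum q 0 a = (\<Sum>l\<in>{l. size_of l = size_of a}. if l = a then 1 else 0)"
    unfolding level_sum_def using norm_gf_same_size by (intro sum.cong) auto
  then show ?thesis by (simp add: sum.delta)
qed

lemma removed_sum_0 [simp]: "removed_sum q 0 a = 1"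
proof -
  have "removed_sum q 0 a = (\<Sum>l\<in>{l. size_of l = size_of a}. if l = a then 1 else 0)"
    unfolding removed_sum_def using norm_gf_same_size by (intro sum.cong) auto
  then show ?thesis by (simp add: sum.delta)
qed

text \<open>Peel off the first variable and apply the local rule with \<open>mu = nu\<close>: the strips that lead
  out of \<open>k\<close> to a shape of size \<open>K\<close> are traded for strips removed from \<open>k\<close>.\<close>

lemma level_sum_as_strip_sums:
  assumes q: "q > 0"
  defines "w \<equiv> \<lambda>K J a. q ^ (J - size_of a) * (1 - q) ^ (K - J)"
  assumes K: "K = size_of a + k"
  shows "level_sum q k a = (\<Sum>r\<in>{r. size_of r \<le> K}. \<Sum>J\<in>{J \<in> {..K}. 2 * J \<le> K + size_of r}. w K J a * strip_sum q J r a)"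
proof -
  define W where "W k = w K (size_of k) a * norm_gf q k a" for k
  let ?Y = "{k. size_of k \<le> K}"
  let ?A = "{l. size_of l = K}"
  have "level_sum q k a = (\<Sum>l\<in>?A. \<Sum>k\<in>{k \<in> ?Y. hstrip k l}. W k)"
    unfolding level_sum_def K[symmetric]
  proof (rule sum.cong[OF refl])
    fix l assume l: "l \<in> ?A"
    have "{k. hstrip k l} = {k \<in> ?Y. hstrip k l}" using l hstrip_size by auto
    then show "norm_gf q l a = (\<Sum>k\<in>{k \<in> ?Y. hstrip k l}. W k)"
      using norm_gf_hstrip_expansion[OF q, of l a] l by (simp add: W_def w_def)
  qed
  also have "\<dots> = (\<Sum>k\<in>?Y. \<Sum>l\<in>{l \<in> ?A. hstrip k l}. W k)"
    by (rule sum.swap_restrict) (auto simp: finite_shapes_le)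
  also have "\<dots> = (\<Sum>k\<in>?Y. \<Sum>r\<in>{r \<in> ?Y. hstrip r k \<and> 2 * size_of k \<le> K + size_of r}. W k)"
  proof (rule sum.cong[OF refl])
    fix k assume k: "k \<in> ?Y"
    have "{r \<in> ?Y. hstrip r k \<and> 2 * size_of k \<le> K + size_of r} = {r. hstrip r k \<and> 2 * size_of k \<le> K + size_of r}"
      using hstrip_size[of _ k] k by fastforce
    then have "card {l \<in> ?A. hstrip k l} = card {r \<in> ?Y. hstrip r k \<and> 2 * size_of k \<le> K + size_of r}"
      using card_hstrips_above_below[of K k k] by (simp add: mult_2)
    then show "(\<Sum>l\<in>{l \<in> ?A. hstrip k l}. W k)
      = (\<Sum>r\<in>{r \<in> ?Y. hstrip r k \<and> 2 * size_of k \<le> K + size_of r}. W k)" by simp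
  qed
  also have "\<dots> = (\<Sum>r\<in>?Y. \<Sum>k\<in>{k \<in> ?Y. hstrip r k \<and> 2 * size_of k \<le> K + size_of r}. W k)"
    by (rule sum.swap_restrict) (auto simp: finite_shapes_le)
  also have "\<dots> = (\<Sum>r\<in>?Y. \<Sum>J\<in>{J \<in> {..K}. 2 * J \<le> K + size_of r}. w K J a * strip_sum q J r a)"
  proof (rule sum.cong[OF refl])
    fix r
    let ?S = "{k \<in> ?Y. hstrip r k \<and> 2 * size_of k \<le> K + size_of r}"
    let ?P = "\<lambda>J. J \<in> {..K} \<and> 2 * J \<le> K + size_of r"
    have "(\<Sum>k\<in>?S. W k) = (\<Sum>J\<in>{J. ?P J}. \<Sum>k\<in>{k \<in> ?S. size_of k = J}. W k)"
      by (rule sum_by_size) (auto simp: finite_shapes_le)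
    also have "\<dots> = (\<Sum>J\<in>{J. ?P J}. w K J a * strip_sum q J r a)"
    proof (rule sum.cong[OF refl])
      fix J assume J: "J \<in> {J. ?P J}"
      then have "{k \<in> ?S. size_of k = J} = {k. size_of k = J \<and> hstrip r k}" by auto
      then show "(\<Sum>k\<in>{k \<in> ?S. size_of k = J}. W k) = w K J a * strip_sum q J r a"
        by (simp add: strip_sum_def sum_distrib_left W_def)
    qed
    finally show "(\<Sum>k\<in>?S. W k) = (\<Sum>J\<in>{J. ?P J}. w K J a * strip_sum q J r a)" .
  qed
  finally show ?thesis .
qed

text \<open>The strip removed by the local rule is moved past the generating function to the inner
  shape \<open>a\<close>.\<close>

lemma level_sum_rec:
  assumes q: "q > 0" "q \<noteq> 1"
  shows "level_sum q k a = (\<Sum>s\<in>{s. hstrip s a}. if size_of a - size_of s \<le> k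
      then (1 - q) ^ (size_of a - size_of s) * (\<Sum>m\<le>k - (size_of a - size_of s).
             pair_coeff q (k - (size_of a - size_of s) - m) * (q ^ m * level_sum q m s))
      else 0)"
proof -
  define K where "K = size_of a + k"
  define w where "w J = q ^ (J - size_of a) * (1 - q) ^ (K - J)" for J
  let ?Y = "{r. size_of r \<le> K}"
  let ?H = "{s. hstrip s a}"
  define c where "c s M = (\<Sum>J\<in>{J \<in> {..K}. 2 * J \<le> K + M \<and> size_of a + M \<le> J + size_of s}.
     w J / q_fact q (J + size_of s - (size_of a + M)))" for s M
  have "level_sum q k a = (\<Sum>r\<in>?Y. \<Sum>J\<in>{J \<in> {..K}. 2 * J \<le> K + size_of r}. w J *
     (\<Sum>s\<in>{s \<in> ?H. size_of a + size_of r \<le> J + size_of s}. norm_gf q r s / q_fact q (J + size_of s - (size_of a + size_of r))))"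
    unfolding level_sum_as_strip_sums[OF q(1) K_def] strip_sum_eq_commuted_sum[OF q] commuted_sum_def w_def by simp
  also have "\<dots> = (\<Sum>r\<in>?Y. \<Sum>s\<in>?H. \<Sum>J\<in>{J \<in> {J \<in> {..K}. 2 * J \<le> K + size_of r}. size_of a + size_of r \<le> J + size_of s}.
      w J * (norm_gf q r s / q_fact q (J + size_of s - (size_of a + size_of r))))"
    unfolding sum_distrib_left by (rule sum.cong[OF refl], rule sum.swap_restrict) auto
  also have "\<dots> = (\<Sum>r\<in>?Y. \<Sum>s\<in>?H. norm_gf q r s * c s (size_of r))"
    unfolding c_def sum_distrib_left by (intro sum.cong refl) (auto simp: conj_ac)
  also have "\<dots> = (\<Sum>s\<in>?H. \<Sum>r\<in>?Y. norm_gf q r s * c s (size_of r))"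
    by (rule sum.swap)
  also have "\<dots> = (\<Sum>s\<in>?H. if size_of a - size_of s \<le> k
      then (1 - q) ^ (size_of a - size_of s) * (\<Sum>m\<le>k - (size_of a - size_of s).
             pair_coeff q (k - (size_of a - size_of s) - m) * (q ^ m * level_sum q m s))
      else 0)"
  proof (rule sum.cong[OF refl])
    fix s assume "s \<in> ?H"
    then obtain h where h: "size_of a = size_of s + h" using hstrip_size le_Suc_ex by blast
    have "(\<Sum>r\<in>?Y. norm_gf q r s * c s (size_of r)) = (\<Sum>M\<in>{M. M \<le> K}. \<Sum>r\<in>{r \<in> ?Y. size_of r = M}. norm_gf q r s * c s (size_of r))"
      by (rule sum_by_size) (auto simp: finite_shapes_le)
    also have "\<dots> = (\<Sum>M\<in>{..K}. c s M * (\<Sum>r\<in>{r. size_of r = M}. norm_gf q r s))"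
    proof (intro sum.cong)
      fix M assume "M \<in> {..K}"
      then have "{r \<in> ?Y. size_of r = M} = {r. size_of r = M}" by auto
      then show "(\<Sum>r\<in>{r \<in> ?Y. size_of r = M}. norm_gf q r s * c s (size_of r)) = c s M * (\<Sum>r\<in>{r. size_of r = M}. norm_gf q r s)"
        by (simp add: sum_distrib_left mult.commute)
    qed auto
    also have "\<dots> = (\<Sum>M\<in>{size_of s..K}. c s M * (\<Sum>r\<in>{r. size_of r = M}. norm_gf q r s))"
    proof (rule sum.mono_neutral_right)
      have "(\<Sum>r\<in>{r. size_of r = M}. norm_gf q r s) = 0" if "M < size_of s" for M
        using that norm_gf_small by (intro sum.neutral) auto
      then show "\<forall>M\<in>{..K} - {size_of s..K}. c s M * (\<Sum>r\<in>{r. size_of r = M}. norm_gf q r s) = 0" by auto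
    qed auto
    also have "\<dots> = (\<Sum>m\<le>k + h. c s (size_of s + m) * level_sum q m s)"
      by (rule sum.reindex_bij_witness[where i = "\<lambda>m. size_of s + m" and j = "\<lambda>M. M - size_of s"])
        (auto simp: level_sum_def K_def h)
    also have "\<dots> = (\<Sum>m\<le>k + h. if m + h \<le> k then (1 - q) ^ h * (pair_coeff q (k - h - m) * (q ^ m * level_sum q m s)) else 0)"
    proof (rule sum.cong[OF refl])
      fix m
      show "c s (size_of s + m) * level_sum q m s
        = (if m + h \<le> k then (1 - q) ^ h * (pair_coeff q (k - h - m) * (q ^ m * level_sum q m s)) else 0)"
      proof (cases "m + h \<le> k")
        case True
        then obtain n where n: "k = m + h + n" using le_Suc_ex by blast
        have "c s (size_of s + m) = (\<Sum>u\<in>{u. 2 * u \<le> n}. w (u + (size_of a + m)) / q_fact q u)"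
          unfolding c_def
          by (rule sum.reindex_bij_witness[where i = "\<lambda>u. u + (size_of a + m)" and j = "\<lambda>J. J - (size_of a + m)"])
            (auto simp: K_def n h add_ac)
        also have "\<dots> = (\<Sum>u\<in>{u. 2 * u \<le> n}. q ^ m * (1 - q) ^ h * (q ^ u * (1 - q) ^ (n - u) / q_fact q u))"
        proof (rule sum.cong[OF refl])
          fix u assume "u \<in> {u. 2 * u \<le> n}"
          then have "K - (u + (size_of a + m)) = h + (n - u)" by (simp add: K_def n)
          then show "w (u + (size_of a + m)) / q_fact q u = q ^ m * (1 - q) ^ h * (q ^ u * (1 - q) ^ (n - u) / q_fact q u)"
            by (simp add: w_def power_add)
        qed
        also have "\<dots> = q ^ m * (1 - q) ^ h * pair_coeff q n"
          unfolding sum_distrib_left[symmetric] pair_coeff_def ..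
        finally show ?thesis using n by simp
      next
        case False
        then have "{J \<in> {..K}. 2 * J \<le> K + (size_of s + m) \<and> size_of a + (size_of s + m) \<le> J + size_of s} = {}"
          by (auto simp: K_def h)
        then have "c s (size_of s + m) = 0" unfolding c_def by (simp only: sum.empty)
        then show ?thesis using False by simp
      qed
    qed
    also have "\<dots> = (\<Sum>m\<in>{m \<in> {..k + h}. m + h \<le> k}. (1 - q) ^ h * (pair_coeff q (k - h - m) * (q ^ m * level_sum q m s)))"
      by (rule sum.inter_filter[symmetric]) simp
    also have "\<dots> = (if h \<le> k then (\<Sum>m\<le>k - h. (1 - q) ^ h * (pair_coeff q (k - h - m) * (q ^ m * level_sum q m s))) else 0)"
    proof (cases "h \<le> k")
      case True
      then have "{m \<in> {..k + h}. m + h \<le> k} = {..k - h}" by auto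
      then show ?thesis using True by simp
    next
      case False
      then have "{m \<in> {..k + h}. m + h \<le> k} = {}" by auto
      then show ?thesis using False by (simp only: sum.empty if_False)
    qed
    finally show "(\<Sum>r\<in>?Y. norm_gf q r s * c s (size_of r)) = (if size_of a - size_of s \<le> k
      then (1 - q) ^ (size_of a - size_of s) * (\<Sum>m\<le>k - (size_of a - size_of s).
             pair_coeff q (k - (size_of a - size_of s) - m) * (q ^ m * level_sum q m s))
      else 0)" using h by (simp add: sum_distrib_left)
  qed
  finally show ?thesis .
qed

lemma removed_sum_rec:
  assumes q: "q > 0"
  shows "removed_sum q h a = (\<Sum>s\<in>{s. hstrip s a}. if size_of a - size_of s \<le> h
      then (1 - q) ^ (size_of a - size_of s) * (q ^ (h - (size_of a - size_of s)) * removed_sum q (h - (size_of a - size_of s)) s)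
      else 0)"
proof -
  let ?M = "{m. size_of m + h = size_of a}"
  have "removed_sum q h a = (\<Sum>m\<in>?M. \<Sum>s\<in>{s. hstrip s a}. q ^ (size_of s - size_of m) * (1 - q) ^ (size_of a - size_of s) * norm_gf q s m)"
    unfolding removed_sum_def using norm_gf_hstrip_expansion[OF q] by (intro sum.cong refl)
  also have "\<dots> = (\<Sum>s\<in>{s. hstrip s a}. \<Sum>m\<in>?M. q ^ (size_of s - size_of m) * (1 - q) ^ (size_of a - size_of s) * norm_gf q s m)"
    by (rule sum.swap)
  also have "\<dots> = (\<Sum>s\<in>{s. hstrip s a}. if size_of a - size_of s \<le> h
      then (1 - q) ^ (size_of a - size_of s) * (q ^ (h - (size_of a - size_of s)) * removed_sum q (h - (size_of a - size_of s)) s)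
      else 0)"
  proof (rule sum.cong[OF refl])
    fix s assume "s \<in> {s. hstrip s a}"
    then obtain r where r: "size_of a = size_of s + r" using hstrip_size le_Suc_ex by blast
    show "(\<Sum>m\<in>?M. q ^ (size_of s - size_of m) * (1 - q) ^ (size_of a - size_of s) * norm_gf q s m) = (if size_of a - size_of s \<le> h
      then (1 - q) ^ (size_of a - size_of s) * (q ^ (h - (size_of a - size_of s)) * removed_sum q (h - (size_of a - size_of s)) s)
      else 0)"
    proof (cases "r \<le> h")
      case True
      then have "?M = {m. size_of m + (h - r) = size_of s}" using r by auto
      then have "(\<Sum>m\<in>?M. q ^ (size_of s - size_of m) * (1 - q) ^ (size_of a - size_of s) * norm_gf q s m)
          = (\<Sum>m\<in>{m. size_of m + (h - r) = size_of s}. (1 - q) ^ r * (q ^ (h - r) * norm_gf q s m))"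
      proof (rule sum.cong)
        fix m assume "m \<in> {m. size_of m + (h - r) = size_of s}"
        then have "size_of s - size_of m = h - r" by auto
        then show "q ^ (size_of s - size_of m) * (1 - q) ^ (size_of a - size_of s) * norm_gf q s m
           = (1 - q) ^ r * (q ^ (h - r) * norm_gf q s m)" using r by simp
      qed
      then show ?thesis using True r by (simp add: removed_sum_def sum_distrib_left)
    next
      case False
      then have "norm_gf q s m = 0" if "m \<in> ?M" for m using that r by (intro norm_gf_small) auto
      then show ?thesis using False r by simp
    qed
  qed
  finally show ?thesis .
qed

definition fps_rescale :: "real \<Rightarrow> real fps \<Rightarrow> real fps" where
  "fps_rescale q f = f oo (fps_const q * fps_X)"

lemma fps_rescale_nth [simp]: "fps_rescale q f $ n = q ^ n * f $ n"
  by (simp add: fps_rescale_def fps_compose_linear)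

lemma fps_rescale_mult: "fps_rescale q (f * g) = fps_rescale q f * fps_rescale q g"
  by (simp add: fps_rescale_def fps_compose_mult_distrib)

lemma fps_rescale_diff: "fps_rescale q (f - g) = fps_rescale q f - fps_rescale q g"
  by (rule fps_ext) (simp add: right_diff_distrib)

text \<open>Peeling one horizontal strip off the inner shape, as an operator on families of power
  series; rescaling by \<open>q\<close> passes from the variables \<open>1, q, q^2, ...\<close> to \<open>q, q^2, ...\<close>.\<close>

definition strip_fps :: "real \<Rightarrow> shape \<Rightarrow> (shape \<Rightarrow> real fps) \<Rightarrow> real fps" where
  "strip_fps q a X = (\<Sum>s\<in>{s. hstrip s a}.
     fps_const ((1 - q) ^ (size_of a - size_of s)) * (fps_X ^ (size_of a - size_of s) * fps_rescale q (X s)))"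

lemma strip_fps_empty: "strip_fps q empty_shape X = fps_rescale q (X empty_shape)"
proof -
  have "{s. hstrip s empty_shape} = {empty_shape}"
    using hstrip_size[of _ empty_shape] by auto
  then show ?thesis by (simp add: strip_fps_def)
qed

lemma level_fps_rec:
  assumes q: "q > 0" "q \<noteq> 1"
  shows "Abs_fps (\<lambda>k. level_sum q k a) = Abs_fps (pair_coeff q) * strip_fps q a (\<lambda>s. Abs_fps (\<lambda>k. level_sum q k s))"
proof (rule fps_ext)
  fix k
  have "(Abs_fps (pair_coeff q) * strip_fps q a (\<lambda>s. Abs_fps (\<lambda>k. level_sum q k s))) $ k
    = (\<Sum>s\<in>{s. hstrip s a}. (fps_const ((1 - q) ^ (size_of a - size_of s)) * (fps_X ^ (size_of a - size_of s) *
         (Abs_fps (pair_coeff q) * fps_rescale q (Abs_fps (\<lambda>k. level_sum q k s))))) $ k)"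
    unfolding strip_fps_def sum_distrib_left fps_sum_nth by (intro sum.cong refl arg_cong2[where f = fps_nth]) (simp add: mult_ac)
  also have "\<dots> = (\<Sum>s\<in>{s. hstrip s a}. if size_of a - size_of s \<le> k
      then (1 - q) ^ (size_of a - size_of s) * (\<Sum>m\<le>k - (size_of a - size_of s).
             pair_coeff q (k - (size_of a - size_of s) - m) * (q ^ m * level_sum q m s))
      else 0)"
  proof (rule sum.cong[OF refl])
    fix s
    let ?n = "k - (size_of a - size_of s)"
    have "(Abs_fps (pair_coeff q) * fps_rescale q (Abs_fps (\<lambda>k. level_sum q k s))) $ ?n
       = (\<Sum>m\<le>?n. pair_coeff q (?n - m) * (q ^ m * level_sum q m s))"
      by (subst mult.commute, subst fps_mult_nth) (simp add: atLeast0AtMost mult_ac)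
    then show "(fps_const ((1 - q) ^ (size_of a - size_of s)) * (fps_X ^ (size_of a - size_of s) *
         (Abs_fps (pair_coeff q) * fps_rescale q (Abs_fps (\<lambda>k. level_sum q k s))))) $ k = (if size_of a - size_of s \<le> k
      then (1 - q) ^ (size_of a - size_of s) * (\<Sum>m\<le>?n. pair_coeff q (?n - m) * (q ^ m * level_sum q m s))
      else 0)" by (simp add: fps_X_power_mult_nth)
  qed
  also have "\<dots> = level_sum q k a" using level_sum_rec[OF q, of k a] by simp
  finally show "Abs_fps (\<lambda>k. level_sum q k a) $ k = (Abs_fps (pair_coeff q) * strip_fps q a (\<lambda>s. Abs_fps (\<lambda>k. level_sum q k s))) $ k"
    by simp
qed

lemma removed_fps_rec:
  assumes q: "q > 0"
  shows "Abs_fps (\<lambda>k. removed_sum q k a) = strip_fps q a (\<lambda>s. Abs_fps (\<lambda>k. removed_sum q k s))"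
proof (rule fps_ext)
  fix k
  show "Abs_fps (\<lambda>k. removed_sum q k a) $ k = strip_fps q a (\<lambda>s. Abs_fps (\<lambda>k. removed_sum q k s)) $ k"
    unfolding strip_fps_def fps_sum_nth fps_nth_Abs_fps
    by (subst removed_sum_rec[OF q]) (auto intro!: sum.cong simp: fps_X_power_mult_nth)
qed

text \<open>Let \<open>F\<close>, \<open>G\<close> be the generating functions of \<open>level_sum\<close>, \<open>removed_sum\<close>, and \<open>B\<close> the
  series \<open>F\<close> for the empty shape. Then \<open>F = C * strip_fps F\<close>, \<open>G = strip_fps G\<close> and
  \<open>B = C * fps_rescale B\<close>. As rescaling is multiplicative, \<open>B * G\<close> satisfies the same equation
  as \<open>F\<close>. A solution is determined by its constant coefficients: in degree \<open>k > 0\<close> the unknown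
  appears on the right with the coefficient \<open>q ^ k \<noteq> 1\<close>.\<close>

lemma level_sum_factor_generic:
  assumes q: "q > 0" "q \<noteq> 1"
  shows "Abs_fps (\<lambda>k. level_sum q k a) = Abs_fps (\<lambda>k. level_sum q k empty_shape) * Abs_fps (\<lambda>k. removed_sum q k a)"
proof -
  define C where "C = Abs_fps (pair_coeff q)"
  define F where "F a = Abs_fps (\<lambda>k. level_sum q k a)" for a
  define G where "G a = Abs_fps (\<lambda>k. removed_sum q k a)" for a
  define B where "B = F empty_shape"
  define D where "D a = F a - B * G a" for a
  have F: "F a = C * strip_fps q a F" for a
    using level_fps_rec[OF q, of a] unfolding F_def[abs_def] C_def .
  have G: "G a = strip_fps q a G" for a
    using removed_fps_rec[OF q(1), of a] unfolding G_def[abs_def] .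
  have B: "B = C * fps_rescale q B"
    using F[of empty_shape] strip_fps_empty[of q F] by (simp add: B_def)
  have BG: "B * G a = C * strip_fps q a (\<lambda>s. B * G s)" for a
  proof -
    have "B * G a = (C * fps_rescale q B) * strip_fps q a G" using B G by simp
    also have "\<dots> = C * strip_fps q a (\<lambda>s. B * G s)"
      unfolding strip_fps_def fps_rescale_mult sum_distrib_left by (intro sum.cong refl) (simp add: mult_ac)
    finally show ?thesis .
  qed
  have D: "D a = C * strip_fps q a D" for a
  proof -
    have "strip_fps q a F - strip_fps q a (\<lambda>s. B * G s) = strip_fps q a D"
      unfolding strip_fps_def D_def[abs_def] sum_subtractf[symmetric]
      by (intro sum.cong refl) (simp add: fps_rescale_diff right_diff_distrib)
    moreover have "D a = C * (strip_fps q a F - strip_fps q a (\<lambda>s. B * G s))"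
      unfolding D_def right_diff_distrib using F[of a] BG[of a] by metis
    ultimately show ?thesis by simp
  qed
  have "D a $ k = 0" for a k
  proof (induction k arbitrary: a rule: less_induct)
    case (less k)
    show ?case
    proof (cases "k = 0")
      case True
      then show ?thesis by (simp add: D_def F_def G_def B_def)
    next
      case False
      \<comment> \<open>By the induction hypothesis only \<open>s = a\<close>, where no strip is removed, contributes in degrees up to \<open>k\<close>.\<close>
      have strip_nth: "strip_fps q a D $ n = (if n = k then q ^ k * D a $ k else 0)" if "n \<le> k" for n
      proof -
        have "strip_fps q a D $ n = (\<Sum>s\<in>{s. hstrip s a}. if s = a then (if n = k then q ^ k * D a $ k else 0) else 0)"
          unfolding strip_fps_def fps_sum_nth
        proof (rule sum.cong[OF refl])
          fix s assume s: "s \<in> {s. hstrip s a}"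
          show "(fps_const ((1 - q) ^ (size_of a - size_of s)) * (fps_X ^ (size_of a - size_of s) * fps_rescale q (D s))) $ n
             = (if s = a then (if n = k then q ^ k * D a $ k else 0) else 0)"
          proof (cases "s = a")
            case True
            then show ?thesis using less.IH[of n a] that by auto
          next
            case False
            then have "size_of s < size_of a" using s hstrip_size[of s a] hstrip_eq_of_size[of s a] by force
            then show ?thesis using False that less.IH[of "n - (size_of a - size_of s)" s] \<open>k \<noteq> 0\<close>
              by (simp add: fps_X_power_mult_nth)
          qed
        qed
        then show ?thesis by (simp add: sum.delta)
      qed
      have "D a $ k = (\<Sum>i=0..k. C $ i * strip_fps q a D $ (k - i))"
        by (subst D) (simp add: fps_mult_nth)
      also have "\<dots> = (\<Sum>i=0..k. if i = 0 then q ^ k * D a $ k else 0)"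
        using strip_nth False by (intro sum.cong refl) (auto simp: C_def)
      also have "\<dots> = q ^ k * D a $ k" by (simp add: sum.delta)
      finally have "(1 - q ^ k) * D a $ k = 0" by (simp add: algebra_simps)
      moreover have "q ^ k \<noteq> 1" using False q power_eq_1_iff[of q k] by auto
      ultimately show ?thesis by simp
    qed
  qed
  then have "D a = 0" by (intro fps_ext) simp
  then show ?thesis by (simp add: D_def F_def G_def B_def)
qed

lemma isCont_norm_gf: "isCont (\<lambda>q. norm_gf q l a) 1"
proof -
  have "isCont (\<lambda>q. q_fact q n) 1" for n unfolding q_fact_def by (intro continuous_intros)
  then show ?thesis unfolding norm_gf_def skew_gf_def by (intro continuous_intros) simp_all
qed

lemma continuous_extension_at_1:
  fixes f g :: "real \<Rightarrow> real"
  assumes "isCont f 1" "isCont g 1" "\<And>q. q > 0 \<Longrightarrow> q \<noteq> 1 \<Longrightarrow> f q = g q" "q > 0"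
  shows "f q = g q"
proof (cases "q = 1")
  case True
  have "eventually (\<lambda>q. f q = g q) (at 1)"
    unfolding eventually_at by (rule exI[of _ 1]) (auto intro!: assms(3) simp: dist_real_def abs_if split: if_splits)
  then have "(f \<longlongrightarrow> g 1) (at 1)"
    using assms(2) unfolding isCont_def by (simp add: filterlim_cong)
  then have "f 1 = g 1" using assms(1) unfolding isCont_def using LIM_unique by blast
  then show ?thesis using True by simp
qed (use assms in auto)

text \<open>This is the identity \<open>\<Sum>_\<lambda> s_(\<lambda>/\<alpha>) = (\<Sum>_\<lambda> s_\<lambda>) (\<Sum>_\<mu> s_(\<alpha>/\<mu>))\<close> for the variables
  \<open>1, q, q^2, ...\<close>. Both sides are rational functions of \<open>q\<close> without a pole at \<open>q = 1\<close>, so this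
  value is covered by continuity.\<close>

lemma level_sum_factorization:
  assumes q: "q > 0"
  shows "level_sum q k a = (\<Sum>i\<le>k. level_sum q i empty_shape * removed_sum q (k - i) a)"
proof (rule continuous_extension_at_1[OF _ _ _ q])
  show "isCont (\<lambda>q. level_sum q k a) 1"
    unfolding level_sum_def by (intro continuous_intros isCont_norm_gf)
  show "isCont (\<lambda>q. \<Sum>i\<le>k. level_sum q i empty_shape * removed_sum q (k - i) a) 1"
    unfolding level_sum_def removed_sum_def by (intro continuous_intros isCont_norm_gf)
  show "level_sum q k a = (\<Sum>i\<le>k. level_sum q i empty_shape * removed_sum q (k - i) a)" if "q > 0" "q \<noteq> 1" for q
    using arg_cong[OF level_sum_factor_generic[OF that, of a], where f = "\<lambda>f. f $ k"]
    by (simp add: fps_mult_nth atLeast0AtMost)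
qed

section \<open>Counting standard tableaux\<close>

definition num_tableaux :: "shape \<Rightarrow> real" where
  "num_tableaux l = skew_gf 1 l empty_shape"

lemma num_tableaux_eq_card: "num_tableaux l = card (skew_tableaux l empty_shape)"
  by (simp add: num_tableaux_def skew_gf_def)

lemma num_tableaux_empty [simp]: "num_tableaux empty_shape = 1"
  by (simp add: num_tableaux_def)

lemma q_fact_1: "q_fact 1 n = fact n"
  by (induction n) (simp_all add: q_fact_Suc)

text \<open>At \<open>q = 1\<close> the expansion by final runs keeps only the runs of length one.\<close>

lemma skew_count_Suc:
  assumes "size_of a < size_of l"
  shows "skew_gf 1 l a = (\<Sum>k\<in>{k. hstrip k l \<and> Suc (size_of k) = size_of l}. skew_gf 1 k a)"
proof -
  define n where "n = size_of l - size_of a - 1"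
  have "skew_gf 1 l a = q_fact 1 n * (\<Sum>k\<in>run_shapes 0 l. 0 ^ (size_of l - 1 - size_of k) * norm_gf 1 k a)"
    using skew_gf_from_expand[of 1 a l 0] skew_gf_from_0[OF assms, of 1] assms by (simp add: n_def)
  also have "(\<Sum>k\<in>run_shapes 0 l. 0 ^ (size_of l - 1 - size_of k) * norm_gf 1 k a)
      = (\<Sum>k\<in>{k. hstrip k l \<and> Suc (size_of k) = size_of l}. skew_gf 1 k a / q_fact 1 n)"
  proof (rule sum.mono_neutral_cong_right)
    show "{k. hstrip k l \<and> Suc (size_of k) = size_of l} \<subseteq> run_shapes 0 l" by (auto simp: run_shapes_def)
    show "\<forall>k\<in>run_shapes 0 l - {k. hstrip k l \<and> Suc (size_of k) = size_of l}. 0 ^ (size_of l - 1 - size_of k) * norm_gf 1 k a = 0"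
    proof
      fix k assume k: "k \<in> run_shapes 0 l - {k. hstrip k l \<and> Suc (size_of k) = size_of l}"
      then have "size_of l - 1 - size_of k \<noteq> 0" using run_shapes_size[of k 0 l] by (auto simp: run_shapes_def)
      then show "0 ^ (size_of l - 1 - size_of k) * norm_gf 1 k a = 0" by simp
    qed
    fix k assume "k \<in> {k. hstrip k l \<and> Suc (size_of k) = size_of l}"
    then have "size_of l - 1 - size_of k = 0" "size_of k - size_of a = n" using assms by (auto simp: n_def)
    then show "0 ^ (size_of l - 1 - size_of k) * norm_gf 1 k a = skew_gf 1 k a / q_fact 1 n"
      by (simp add: norm_gf_def)
  qed simp
  finally show ?thesis by (simp add: sum_divide_distrib[symmetric])
qed

lemma num_tableaux_Suc:
  "size_of l = Suc n \<Longrightarrow> num_tableaux l = (\<Sum>k\<in>{k. hstrip k l \<and> size_of k = n}. num_tableaux k)"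
  using skew_count_Suc[of empty_shape l] by (simp add: num_tableaux_def)

lemma norm_gf_one_box:
  assumes "size_of l = Suc (size_of k)"
  shows "norm_gf 1 l k = (if hstrip k l then 1 else 0)"
proof -
  have "skew_gf 1 l k = (\<Sum>j\<in>{j. hstrip j l \<and> size_of j = size_of k}. if j = k then 1 else 0)"
  proof -
    have "skew_gf 1 j k = (if j = k then 1 else 0)" if "size_of j = size_of k" for j
      using boxes_eq_of_size[of k j] skew_gf_0[of k j 1] that by auto
    moreover have "skew_gf 1 l k = (\<Sum>j\<in>{j. hstrip j l \<and> size_of j = size_of k}. skew_gf 1 j k)"
      using skew_count_Suc[of k l] assms by simp
    ultimately show ?thesis by simp
  qed
  then show ?thesis using assms by (simp add: norm_gf_def sum.delta q_fact_Suc)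
qed

text \<open>The analogue of \<open>\<Sum> f^\<beta> s_\<beta> = p_1^m\<close> after skewing by \<open>s_u\<close>. Removing the last box from
  the tableaux counted by \<open>num_tableaux b\<close> and commuting this strip of size one past \<open>norm_gf\<close>
  gives the recursion of the binomial coefficients.\<close>

lemma count_weighted_generic:
  assumes q: "q > 0" "q \<noteq> 1"
  shows "(\<Sum>b\<in>{b. size_of b = m}. num_tableaux b * norm_gf q b u) = real (m choose size_of u) * num_tableaux u"
proof (induction m arbitrary: u)
  case 0
  have "norm_gf q empty_shape u = (if u = empty_shape then 1 else 0)"
    using norm_gf_same_size[of empty_shape u q] by auto
  moreover have "0 < size_of u" if "u \<noteq> empty_shape" using that by (metis gr0I size_of_0_iff)
  ultimately show ?case by (auto simp: binomial_eq_0)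
next
  case (Suc m)
  have one: "q_fact q (Suc 0) = 1" by (simp add: q_fact_Suc)
  have "(\<Sum>b\<in>{b. size_of b = Suc m}. num_tableaux b * norm_gf q b u)
     = (\<Sum>b\<in>{b. size_of b = Suc m}. \<Sum>n\<in>{n \<in> {n. size_of n = m}. hstrip n b}. num_tableaux n * norm_gf q b u)"
    by (intro sum.cong refl) (simp add: num_tableaux_Suc sum_distrib_right conj_commute)
  also have "\<dots> = (\<Sum>n\<in>{n. size_of n = m}. \<Sum>b\<in>{b \<in> {b. size_of b = Suc m}. hstrip n b}. num_tableaux n * norm_gf q b u)"
    by (rule sum.swap_restrict) auto
  also have "\<dots> = (\<Sum>n\<in>{n. size_of n = m}. num_tableaux n * strip_sum q (Suc m) n u)"
    by (simp add: strip_sum_def sum_distrib_left)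
  also have "\<dots> = (\<Sum>n\<in>{n. size_of n = m}. \<Sum>s\<in>{s. hstrip s u \<and> size_of u \<le> Suc (size_of s)}. num_tableaux n * norm_gf q n s)"
  proof (rule sum.cong[OF refl])
    fix n assume n: "n \<in> {n. size_of n = m}"
    have "strip_sum q (Suc m) n u = (\<Sum>s\<in>{s. hstrip s u \<and> size_of u \<le> Suc (size_of s)}. norm_gf q n s)"
      unfolding strip_sum_eq_commuted_sum[OF q] commuted_sum_def
    proof (rule sum.cong)
      fix s assume s: "s \<in> {s. hstrip s u \<and> size_of u \<le> Suc (size_of s)}"
      then have "size_of s \<le> size_of u" by (simp add: hstrip_size)
      then have "Suc m + size_of s - (size_of u + size_of n) = 0 \<or> Suc m + size_of s - (size_of u + size_of n) = Suc 0"
        using n s by auto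
      then show "norm_gf q n s / q_fact q (Suc m + size_of s - (size_of u + size_of n)) = norm_gf q n s"
        using one by auto
    qed (use n in auto)
    then show "num_tableaux n * strip_sum q (Suc m) n u
       = (\<Sum>s\<in>{s. hstrip s u \<and> size_of u \<le> Suc (size_of s)}. num_tableaux n * norm_gf q n s)"
      by (simp add: sum_distrib_left)
  qed
  also have "\<dots> = (\<Sum>s\<in>{s. hstrip s u \<and> size_of u \<le> Suc (size_of s)}. real (m choose size_of s) * num_tableaux s)"
    by (subst sum.swap) (simp add: Suc.IH)
  also have "{s. hstrip s u \<and> size_of u \<le> Suc (size_of s)} = insert u {s. hstrip s u \<and> Suc (size_of s) = size_of u}"
    using hstrip_size[of _ u] hstrip_eq_of_size[of _ u] by (auto simp: le_Suc_eq)
  also have "(\<Sum>s\<in>insert u {s. hstrip s u \<and> Suc (size_of s) = size_of u}. real (m choose size_of s) * num_tableaux s)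
     = real (m choose size_of u) * num_tableaux u + (\<Sum>s\<in>{s. hstrip s u \<and> Suc (size_of s) = size_of u}. real (m choose size_of s) * num_tableaux s)"
    by (subst sum.insert) auto
  also have "\<dots> = real (Suc m choose size_of u) * num_tableaux u"
  proof (cases "size_of u")
    case 0
    then have "{s. hstrip s u \<and> Suc (size_of s) = size_of u} = {}" by auto
    then show ?thesis using 0 by (simp only: sum.empty) simp
  next
    case (Suc j)
    have "(\<Sum>s\<in>{s. hstrip s u \<and> Suc (size_of s) = size_of u}. real (m choose size_of s) * num_tableaux s) = real (m choose j) * num_tableaux u"
      using num_tableaux_Suc[OF Suc] Suc by (simp add: sum_distrib_left)
    then show ?thesis using Suc by (simp add: algebra_simps)
  qed
  finally show ?case .
qed

lemma count_weighted:
  assumes q: "q > 0"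
  shows "(\<Sum>b\<in>{b. size_of b = m}. num_tableaux b * norm_gf q b u) = real (m choose size_of u) * num_tableaux u"
proof (rule continuous_extension_at_1[OF _ _ _ q])
  show "isCont (\<lambda>q. \<Sum>b\<in>{b. size_of b = m}. num_tableaux b * norm_gf q b u) 1"
    by (intro continuous_intros isCont_norm_gf)
qed (auto simp: count_weighted_generic)

definition total_tableaux :: "nat \<Rightarrow> real" where
  "total_tableaux n = (\<Sum>l\<in>{l. size_of l = n}. num_tableaux l)"

lemma total_tableaux_0: "total_tableaux 0 = 1"
  by (simp add: total_tableaux_def)

text \<open>Adding a box to \<open>v\<close> is possible in one more way than removing one, by the local rule with
  \<open>mu = nu = v\<close>; and the number of pairs of a tableau with \<open>n\<close> boxes and a box that can be
  removed from its shape is known from the weighted count with \<open>size_of u = n - 1\<close>.\<close>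

lemma total_tableaux_rec: "total_tableaux (Suc n) = total_tableaux n + real n * total_tableaux (n - 1)"
proof -
  have "total_tableaux (Suc n) = (\<Sum>l\<in>{l. size_of l = Suc n}. \<Sum>v\<in>{v \<in> {v. size_of v = n}. hstrip v l}. num_tableaux v)"
    unfolding total_tableaux_def by (intro sum.cong refl) (simp add: num_tableaux_Suc conj_commute)
  also have "\<dots> = (\<Sum>v\<in>{v. size_of v = n}. \<Sum>l\<in>{l \<in> {l. size_of l = Suc n}. hstrip v l}. num_tableaux v)"
    by (rule sum.swap_restrict) auto
  also have "\<dots> = (\<Sum>v\<in>{v. size_of v = n}. num_tableaux v + (\<Sum>k\<in>{k \<in> {k. Suc (size_of k) = n}. hstrip k v}. num_tableaux v))"
  proof (rule sum.cong[OF refl])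
    fix v assume v: "v \<in> {v. size_of v = n}"
    have "card {l \<in> {l. size_of l = Suc n}. hstrip v l} = card {k. hstrip k v \<and> n \<le> Suc (size_of k)}"
      using card_hstrips_above_below[of "Suc n" v v] v by simp
    also have "{k. hstrip k v \<and> n \<le> Suc (size_of k)} = insert v {k \<in> {k. Suc (size_of k) = n}. hstrip k v}"
      using hstrip_size[of _ v] hstrip_eq_of_size[of _ v] v by (auto simp: le_Suc_eq)
    also have "card \<dots> = Suc (card {k \<in> {k. Suc (size_of k) = n}. hstrip k v})"
      by (rule card_insert_disjoint) (use v in \<open>auto simp: conj_commute\<close>)
    finally have "card {l \<in> {l. size_of l = Suc n}. hstrip v l} = Suc (card {k \<in> {k. Suc (size_of k) = n}. hstrip k v})" .
    then show "(\<Sum>l\<in>{l \<in> {l. size_of l = Suc n}. hstrip v l}. num_tableaux v)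
      = num_tableaux v + (\<Sum>k\<in>{k \<in> {k. Suc (size_of k) = n}. hstrip k v}. num_tableaux v)"
      by (simp only: sum_constant) (simp add: algebra_simps)
  qed
  also have "\<dots> = total_tableaux n + (\<Sum>v\<in>{v. size_of v = n}. \<Sum>k\<in>{k \<in> {k. Suc (size_of k) = n}. hstrip k v}. num_tableaux v)"
    by (simp add: sum.distrib total_tableaux_def)
  also have "(\<Sum>v\<in>{v. size_of v = n}. \<Sum>k\<in>{k \<in> {k. Suc (size_of k) = n}. hstrip k v}. num_tableaux v)
     = (\<Sum>k\<in>{k. Suc (size_of k) = n}. \<Sum>v\<in>{v \<in> {v. size_of v = n}. hstrip k v}. num_tableaux v)"
    by (rule sum.swap_restrict) (auto intro: finite_subset[OF _ finite_shapes_le[of n]])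
  also have "\<dots> = (\<Sum>k\<in>{k. Suc (size_of k) = n}. real n * num_tableaux k)"
  proof (rule sum.cong[OF refl])
    fix k assume k: "k \<in> {k. Suc (size_of k) = n}"
    have "(\<Sum>v\<in>{v \<in> {v. size_of v = n}. hstrip k v}. num_tableaux v) = (\<Sum>v\<in>{v. size_of v = n}. num_tableaux v * norm_gf 1 v k)"
      by (subst sum.inter_filter) (use k norm_gf_one_box in \<open>auto intro!: sum.cong\<close>)
    also have "\<dots> = real (n choose size_of k) * num_tableaux k" by (rule count_weighted) simp
    finally show "(\<Sum>v\<in>{v \<in> {v. size_of v = n}. hstrip k v}. num_tableaux v) = real n * num_tableaux k"
      using k by auto
  qed
  also have "\<dots> = real n * total_tableaux (n - 1)"
    by (cases n) (simp_all add: total_tableaux_def sum_distrib_left)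
  finally show ?thesis by simp
qed

section \<open>Involutions\<close>

text \<open>Multiplying by the transposition of \<open>a\<close> and \<open>b\<close> deletes this two-cycle and also puts it
  back.\<close>

lemma involution_remove_pair:
  assumes a: "a \<notin> S" and b: "b \<in> S"
  shows "bij_betw (\<lambda>p. transpose a b \<circ> p)
    {p. p permutes insert a S \<and> p \<circ> p = id \<and> p a = b} {p. p permutes (S - {b}) \<and> p \<circ> p = id}"
proof (rule bij_betw_byWitness[where f' = "\<lambda>p. transpose a b \<circ> p"], goal_cases)
  case 1
  show ?case by (auto simp: fun_eq_iff)
next
  case 2
  show ?case by (auto simp: fun_eq_iff)
next
  case 3
  have t: "transpose a b permutes insert a S" using b by (intro permutes_swap_id) auto
  show ?case
  proof safe
    fix p assume p: "p permutes insert a S" and inv: "p \<circ> p = id" and pa: "b = p a"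
    have pp: "p (p x) = x" for x using inv by (metis comp_apply id_apply)
    have pb: "p b = a" using pp[of a] pa by simp
    have other: "p x \<noteq> a \<and> p x \<noteq> b" if "x \<noteq> a" "x \<noteq> b" for x using pp[of x] pa pb that by auto
    have "transpose a b \<circ> p permutes insert a S" by (rule permutes_compose[OF p t])
    then show "transpose a (p a) \<circ> p permutes S - {p a}"
      unfolding pa[symmetric] by (rule permutes_superset) (use pa pb in auto)
    show "transpose a (p a) \<circ> p \<circ> (transpose a (p a) \<circ> p) = id"
    proof
      fix x
      show "(transpose a (p a) \<circ> p \<circ> (transpose a (p a) \<circ> p)) x = id x"
        using pa pb pp other[of x] unfolding pa[symmetric]
        by (cases "x = a"; cases "x = b") (auto simp: transpose_apply_other)
    qed
  qed
next
  case 4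
  have t: "transpose a b permutes insert a S" using b by (intro permutes_swap_id) auto
  show ?case
  proof safe
    fix p assume p: "p permutes S - {b}" and inv: "p \<circ> p = id"
    have pp: "p (p x) = x" for x using inv by (metis comp_apply id_apply)
    have pa: "p a = a" and pb: "p b = b" using p a by (auto simp: permutes_def)
    have "p permutes insert a S" using p by (rule permutes_subset) auto
    then show "transpose a b \<circ> p permutes insert a S" by (rule permutes_compose[OF _ t])
    have other: "p x \<noteq> a \<and> p x \<noteq> b" if "x \<noteq> a" "x \<noteq> b" for x using pp[of x] pa pb that by auto
    show "transpose a b \<circ> p \<circ> (transpose a b \<circ> p) = id"
    proof
      fix x
      show "(transpose a b \<circ> p \<circ> (transpose a b \<circ> p)) x = id x"
        using pa pb pp other[of x] by (cases "x = a"; cases "x = b") (auto simp: transpose_apply_other)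
    qed
    show "(transpose a b \<circ> p) a = b" using pa by simp
  qed
qed

text \<open>Classify involutions by the image of a fixed element. This gives the recursion
  \<open>t_(n+1) = t_n + n t_(n-1)\<close>, which is the one that the number of standard tableaux satisfies.\<close>

lemma card_involutions:
  "finite S \<Longrightarrow> real (card {p. p permutes S \<and> p \<circ> p = id}) = total_tableaux (card S)"
proof (induction "card S" arbitrary: S rule: less_induct)
  case less
  show ?case
  proof (cases "S = {}")
    case True
    then have "{p. p permutes S \<and> p \<circ> p = id} = {id}" by (auto simp: fun_eq_iff)
    then show ?thesis using True by (simp add: total_tableaux_0)
  next
    case False
    then obtain a R where S: "S = insert a R" and aR: "a \<notin> R" by (meson mk_disjoint_insert ex_in_conv)
    have finR: "finite R" using less.prems S by simp
    have card_S: "card S = Suc (card R)" using S aR finR by simp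
    define I where "I X = {p. p permutes X \<and> p \<circ> p = id}" for X :: "'a set"
    define J where "J b = {p. p permutes insert a R \<and> p \<circ> p = id \<and> p a = b}" for b
    have finI: "finite (I X)" if "finite X" for X
      by (rule finite_subset[OF _ finite_permutations[OF that]]) (auto simp: I_def)
    have finJ: "finite (J b)" for b
      by (rule finite_subset[OF _ finI[OF less.prems]]) (auto simp: J_def I_def S)
    have cardJ: "real (card (J b)) = total_tableaux (card R - 1)" if b: "b \<in> R" for b
    proof -
      have "card (J b) = card (I (R - {b}))"
        using bij_betw_same_card[OF involution_remove_pair[OF aR b]] by (simp add: J_def I_def)
      moreover have "card (R - {b}) = card R - 1" using b by simp
      ultimately show ?thesis using less.hyps[of "R - {b}"] card_S finR by (simp add: I_def)
    qed
    have Ja: "J a = I R"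
    proof -
      have "p permutes R" if "p permutes insert a R" "p a = a" for p
        by (rule permutes_superset[OF that(1)]) (use that in auto)
      moreover have "p permutes insert a R \<and> p a = a" if "p permutes R" for p
        using that aR permutes_subset[OF that, of "insert a R"] by (auto simp: permutes_def)
      ultimately show ?thesis by (auto simp: J_def I_def)
    qed
    have "I S = (\<Union>b\<in>insert a R. J b)"
      using permutes_in_image[of _ "insert a R" a] by (auto simp: I_def J_def S)
    also have "card \<dots> = (\<Sum>b\<in>insert a R. card (J b))"
      by (rule card_UN_disjoint) (use finR finJ in \<open>auto simp: J_def\<close>)
    finally have "card (I S) = card (I R) + (\<Sum>b\<in>R. card (J b))" using aR finR Ja by simp
    then have "real (card (I S)) = total_tableaux (card R) + real (card R) * total_tableaux (card R - 1)"
      using less.hyps[of R] card_S finR cardJ by (simp add: I_def)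
    then show ?thesis using total_tableaux_rec[of "card R"] card_S by (simp add: I_def)
  qed
qed

lemma num_involutions_eq: "real (num_involutions j) = total_tableaux j"
  using card_involutions[of "{1..j}"] by (simp add: num_involutions_def)

section \<open>Partitions as lists and as shapes\<close>

definition shape_of :: "nat list \<Rightarrow> shape" where
  "shape_of la = Shape (\<lambda>i. if i < length la then la ! i else 0)"

lemma row_shape_of:
  assumes "la \<in> partitions_of n"
  shows "row (shape_of la) i = (if i < length la then la ! i else 0)"
proof -
  have "(if Suc i < length la then la ! Suc i else 0) \<le> (if i < length la then la ! i else 0)" for i
    using assms by (auto simp: partitions_of_def sorted_wrt_iff_nth_less)
  then show ?thesis unfolding shape_of_def by (subst row_Shape[where N = "length la"]) auto
qed

lemma boxes_shape_of: "la \<in> partitions_of n \<Longrightarrow> boxes (shape_of la) = diagram la"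
  by (auto simp: boxes_def diagram_def row_shape_of split: if_splits)

lemma size_shape_of:
  assumes la: "la \<in> partitions_of n"
  shows "size_of (shape_of la) = n"
proof -
  have "size_of (shape_of la) = (\<Sum>i<length la. row (shape_of la) i)"
    by (rule size_of_eq_sum) (simp add: row_shape_of[OF la])
  also have "\<dots> = sum_list la" by (simp add: row_shape_of[OF la] sum_list_sum_nth atLeast0LessThan)
  finally show ?thesis using la by (simp add: partitions_of_def)
qed

lemma shape_of_bij: "bij_betw shape_of (partitions_of n) {l. size_of l = n}"
proof (rule bij_betwI')
  fix la lb assume la: "la \<in> partitions_of n" and lb: "lb \<in> partitions_of n"
  show "shape_of la = shape_of lb \<longleftrightarrow> la = lb"
  proof
    assume "shape_of la = shape_of lb"
    then have eq: "(if i < length la then la ! i else 0) = (if i < length lb then lb ! i else 0)" for i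
      using row_shape_of[OF la, of i] row_shape_of[OF lb, of i] by simp
    have "l ! i \<noteq> 0" if "l \<in> partitions_of n" "i < length l" for l i
    proof -
      have "0 \<notin> set l" using that(1) by (simp add: partitions_of_def)
      then show ?thesis using nth_mem[OF that(2)] by metis
    qed
    then have nz: "i < length la \<longrightarrow> la ! i \<noteq> 0" "i < length lb \<longrightarrow> lb ! i \<noteq> 0" for i
      using la lb by blast+
    have "i < length la \<longleftrightarrow> i < length lb" for i
      using eq[of i] nz[of i] by (cases "i < length la"; cases "i < length lb") simp_all
    then have "length la = length lb" by (metis less_irrefl linorder_cases)
    moreover from this have "la ! i = lb ! i" if "i < length la" for i using eq[of i] that by simp
    ultimately show "la = lb" by (rule nth_equalityI)
  qed simp
next
  show "shape_of la \<in> {l. size_of l = n}" if "la \<in> partitions_of n" for la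
    using size_shape_of[OF that] by simp
next
  fix l assume l: "l \<in> {l. size_of l = n}"
  define N where "N = (LEAST N. row l N = 0)"
  have N0: "row l N = 0"
    unfolding N_def using row_eventually_0[of l] by (metis (mono_tags) LeastI order_refl)
  have Npos: "row l i \<noteq> 0" if "i < N" for i using that not_less_Least unfolding N_def by blast
  have Nz: "\<forall>i\<ge>N. row l i = 0" using N0 row_antimono[of N _ l] by (metis le_zero_eq)
  define la where "la = map (row l) [0..<N]"
  have "la \<in> partitions_of n"
  proof -
    have "sorted_wrt (\<ge>) la" by (auto simp: la_def sorted_wrt_iff_nth_less row_antimono)
    moreover have "0 \<notin> set la"
    proof
      assume "0 \<in> set la"
      then obtain i where "i < N" "row l i = 0" unfolding la_def by force
      then show False using Npos by blast
    qed
    moreover have "sum_list la = n"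
      using l size_of_eq_sum[OF Nz] by (simp add: la_def sum_list_sum_nth atLeast0LessThan)
    ultimately show ?thesis by (simp add: partitions_of_def)
  qed
  moreover have "shape_of la = l"
    by (rule shape_eqI) (use row_shape_of[OF \<open>la \<in> partitions_of n\<close>] Nz in \<open>auto simp: la_def\<close>)
  ultimately show "\<exists>la\<in>partitions_of n. l = shape_of la" by blast
qed

lemma skew_SYT_eq:
  assumes la: "la \<in> partitions_of n" and mu: "mu \<in> partitions_of j"
  shows "skew_SYT la mu = skew_tableaux (shape_of la) (shape_of mu)"
proof -
  have sizes: "sum_list la - sum_list mu = size_of (shape_of la) - size_of (shape_of mu)"
    using la mu size_shape_of[OF la] size_shape_of[OF mu] by (simp add: partitions_of_def)
  have D: "diagram la = boxes (shape_of la)" "diagram mu = boxes (shape_of mu)"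
    "skew_diagram la mu = boxes (shape_of la) - boxes (shape_of mu)"
    by (simp_all add: boxes_shape_of[OF la] boxes_shape_of[OF mu] skew_diagram_def)
  show ?thesis
    unfolding skew_SYT_def skew_tableaux_def fillings_def sizes D
    by (cases "boxes (shape_of mu) \<subseteq> boxes (shape_of la)") (simp_all add: card_skew)
qed

lemma nil_partition: "[] \<in> partitions_of 0"
  by (simp add: partitions_of_def)

lemma partitions_of_0: "partitions_of 0 = {[]}"
proof -
  have "la = []" if "la \<in> partitions_of 0" for la
    using that by (cases la) (auto simp: partitions_of_def)
  then show ?thesis using nil_partition by auto
qed

lemma shape_of_Nil: "shape_of [] = empty_shape"
  by (simp add: shape_of_def empty_shape_def)

lemma skew_maj_gf_eq:
  "la \<in> partitions_of n \<Longrightarrow> mu \<in> partitions_of j \<Longrightarrow> skew_maj_gf la mu q = skew_gf q (shape_of la) (shape_of mu)"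
  by (simp add: skew_maj_gf_def skew_gf_def skew_SYT_eq)

lemma SYT_eq: "la \<in> partitions_of n \<Longrightarrow> SYT la = skew_tableaux (shape_of la) empty_shape"
  unfolding SYT_def by (simp add: skew_SYT_eq[OF _ nil_partition] shape_of_Nil)

lemma SYT_size_eq: "SYT_size n = (\<Union>l\<in>{l. size_of l = n}. skew_tableaux l empty_shape)"
proof -
  have "SYT_size n = (\<Union>la\<in>partitions_of n. skew_tableaux (shape_of la) empty_shape)"
    by (simp add: SYT_size_def SYT_eq)
  also have "\<dots> = (\<Union>l\<in>shape_of ` partitions_of n. skew_tableaux l empty_shape)" by simp
  also have "shape_of ` partitions_of n = {l. size_of l = n}"
    using shape_of_bij[of n] by (simp add: bij_betw_def)
  finally show ?thesis .
qed

lemma tableau_shape_unique: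
  "T \<in> skew_tableaux l empty_shape \<Longrightarrow> T \<in> skew_tableaux l' empty_shape \<Longrightarrow> l = l'"
  using fillings_support[of T "boxes l"] fillings_support[of T "boxes l'"] boxes_inj[of l l']
  by (simp add: skew_tableaux_def)

lemma sum_SYT_size:
  "(\<Sum>T\<in>{T \<in> SYT_size n. P T}. f T) = (\<Sum>l\<in>{l. size_of l = n}. \<Sum>T\<in>{T \<in> skew_tableaux l empty_shape. P T}. f T)"
proof -
  have eq: "{T \<in> SYT_size n. P T} = (\<Union>l\<in>{l. size_of l = n}. {T \<in> skew_tableaux l empty_shape. P T})"
    by (auto simp: SYT_size_eq)
  show ?thesis unfolding eq
    by (rule sum.UNION_disjoint) (use tableau_shape_unique in \<open>auto simp: disjoint_iff\<close>)
qed

lemma finite_SYT_size [simp]: "finite (SYT_size n)"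
  by (simp add: SYT_size_eq)

section \<open>Extensions of a fixed tableau\<close>

text \<open>If the shape of \<open>A\<close> is not contained in \<open>l\<close>, both sides are zero; otherwise a tableau
  that extends \<open>A\<close> is determined by its part above \<open>m\<close>, which is an arbitrary skew tableau.\<close>

lemma sum_extensions_shape:
  assumes A: "A \<in> skew_tableaux a empty_shape" and m: "size_of a = m"
  shows "(\<Sum>T\<in>{T \<in> skew_tableaux l empty_shape. tab_le m T = A}. q ^ maj (tab_gt m T)) = skew_gf q l a"
proof (cases "boxes a \<subseteq> boxes l")
  case False
  have "{T \<in> skew_tableaux l empty_shape. tab_le m T = A} = {}"
  proof -
    have False if T: "T \<in> skew_tableaux l empty_shape" and le: "tab_le m T = A" for T
    proof -
      have "{c. A c \<noteq> 0} \<subseteq> {c. T c \<noteq> 0}" using le by (auto simp: tab_le_def split: if_splits)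
      then show False
        using False fillings_support[of A "boxes a"] fillings_support[of T "boxes l"] A T
        by (simp add: skew_tableaux_def)
    qed
    then show ?thesis by blast
  qed
  then show ?thesis using skew_gf_0[OF False, of q] by (simp only: sum.empty)
next
  case True
  define Y where "Y = boxes l - boxes a"
  have un: "boxes a \<union> Y = boxes l" using True by (auto simp: Y_def)
  have FA: "A \<in> fillings (boxes a)" using A by (simp add: skew_tableaux_def)
  have bij: "bij_betw (\<lambda>T. (tab_le m T, tab_gt m T)) {T \<in> fillings (boxes a \<union> Y). \<forall>c\<in>boxes a. T c \<le> m}
      (fillings (boxes a) \<times> fillings Y)"
  proof (rule fillings_split_bij)
    show "\<not> (i' \<le> i \<and> j' \<le> j)" if "(i, j) \<in> boxes a" "(i', j') \<in> Y" for i j i' j'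
      using that boxes_down_closed[of i j a i' j'] by (auto simp: Y_def)
  qed (auto simp: Y_def m[symmetric] size_of_def)
  let ?S = "{T \<in> skew_tableaux l empty_shape. tab_le m T = A}"
  have S: "?S = {T \<in> {T \<in> fillings (boxes a \<union> Y). \<forall>c\<in>boxes a. T c \<le> m}. tab_le m T = A}"
  proof -
    have "T c \<le> m" if "tab_le m T = A" "c \<in> boxes a" for T c
      using fillings_range[OF FA that(2)] that(1) by (auto simp: tab_le_def split: if_splits)
    then show ?thesis by (auto simp: skew_tableaux_def un)
  qed
  have "bij_betw (tab_gt m) ?S (fillings Y)"
  proof (rule bij_betw_imageI)
    show "inj_on (tab_gt m) ?S"
      using bij unfolding S bij_betw_def inj_on_def by auto
    show "tab_gt m ` ?S = fillings Y"
    proof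
      show "tab_gt m ` ?S \<subseteq> fillings Y" using bij_betwE[OF bij] unfolding S by auto
      show "fillings Y \<subseteq> tab_gt m ` ?S"
      proof
        fix U assume "U \<in> fillings Y"
        then have "(A, U) \<in> (\<lambda>T. (tab_le m T, tab_gt m T)) ` {T \<in> fillings (boxes a \<union> Y). \<forall>c\<in>boxes a. T c \<le> m}"
          using bij FA by (simp add: bij_betw_def)
        then show "U \<in> tab_gt m ` ?S" unfolding S by auto
      qed
    qed
  qed
  from sum.reindex_bij_betw[OF this, of "\<lambda>T. q ^ maj T"] show ?thesis
    using True by (simp add: skew_gf_def skew_tableaux_def Y_def)
qed

lemma sum_extensions:
  assumes "A \<in> skew_tableaux a empty_shape" "size_of a = m"
  shows "(\<Sum>T\<in>SYT_extending n m A. q ^ maj (tab_gt m T)) = (\<Sum>l\<in>{l. size_of l = n}. skew_gf q l a)"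
  unfolding SYT_extending_def sum_SYT_size by (simp add: sum_extensions_shape[OF assms])

lemma nat_down_closed_eq:
  assumes "finite J" "\<And>i j. j \<in> J \<Longrightarrow> i \<le> j \<Longrightarrow> i \<in> (J :: nat set)"
  shows "J = {..<card J}"
proof (cases "J = {}")
  case False
  have "J = {..Max J}" using assms(2)[OF Max_in[OF assms(1) False]] Max_ge[OF assms(1)] by auto
  then show ?thesis by (metis card_atMost lessThan_Suc_atMost)
qed simp

lemma shape_exists:
  assumes fin: "finite Y" and down: "\<And>i j i' j'. (i, j) \<in> Y \<Longrightarrow> i' \<le> i \<Longrightarrow> j' \<le> j \<Longrightarrow> (i', j') \<in> Y"
  shows "\<exists>l. boxes l = Y"
proof -
  define J where "J i = {j. (i, j) \<in> Y}" for i
  have finJ: "finite (J i)" for i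
    by (rule finite_subset[OF _ finite_imageI[OF fin, of snd]]) (force simp: J_def)
  have J: "J i = {..<card (J i)}" for i
    by (rule nat_down_closed_eq[OF finJ]) (use down in \<open>auto simp: J_def\<close>)
  obtain N where N: "\<And>i. i \<in> fst ` Y \<Longrightarrow> i < N"
    using fin finite_nat_set_iff_bounded[of "fst ` Y"] by auto
  have "row (Shape (\<lambda>i. card (J i))) = (\<lambda>i. card (J i))"
  proof (rule row_Shape[where N = N])
    show "card (J (Suc i)) \<le> card (J i)" for i
      by (rule card_mono[OF finJ]) (use down in \<open>auto simp: J_def\<close>)
    show "card (J i) = 0" if "i \<ge> N" for i
    proof -
      have "J i = {}" using N[of i] that by (force simp: J_def)
      then show ?thesis by simp
    qed
  qed
  then have "(i, j) \<in> boxes (Shape (\<lambda>i. card (J i))) \<longleftrightarrow> (i, j) \<in> Y" for i j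
    using J[of i] by (auto simp: boxes_def J_def)
  then have "boxes (Shape (\<lambda>i. card (J i))) = Y" by auto
  then show ?thesis by blast
qed

text \<open>The cells with entries up to \<open>m\<close> form a set that is closed towards the top left corner,
  hence the boxes of a shape.\<close>

lemma tab_le_in_SYT_size:
  assumes T: "T \<in> SYT_size n" and m: "m \<le> n"
  shows "tab_le m T \<in> SYT_size m"
proof -
  obtain l where l: "size_of l = n" and Tl: "T \<in> skew_tableaux l empty_shape" using T by (auto simp: SYT_size_eq)
  have F: "T \<in> fillings (boxes l)" using Tl by (simp add: skew_tableaux_def)
  let ?X = "{c \<in> boxes l. T c \<le> m}"
  have "\<exists>a. boxes a = ?X"
  proof (rule shape_exists)
    fix i j i' j' assume ij: "(i, j) \<in> ?X" "i' \<le> i" "j' \<le> j"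
    then have in': "(i', j') \<in> boxes l" using boxes_down_closed[of i j l i' j'] by auto
    have "T (i', j') \<le> T (i, j)"
      using skew_tableaux_less[OF Tl, of i' j' i j] in' ij by (cases "(i', j') = (i, j)") auto
    then show "(i', j') \<in> ?X" using in' ij by auto
  qed simp
  then obtain a where a: "boxes a = ?X" by blast
  have size_a: "size_of a = m"
  proof -
    have bij: "bij_betw T (boxes l) {1..n}" using fillingsD(1)[OF F] l by (simp add: size_of_def)
    then have inj: "inj_on T ?X" by (auto simp: bij_betw_def intro: inj_on_subset)
    have "T ` ?X = {v \<in> T ` boxes l. v \<le> m}" by auto
    also have "\<dots> = {1..m}" using bij m by (auto simp: bij_betw_def)
    finally show ?thesis using card_image[OF inj] a by (simp add: size_of_def)
  qed
  define Y where "Y = boxes l - boxes a"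
  have un: "boxes a \<union> Y = boxes l" using a by (auto simp: Y_def)
  have bij: "bij_betw (\<lambda>T. (tab_le m T, tab_gt m T)) {T \<in> fillings (boxes a \<union> Y). \<forall>c\<in>boxes a. T c \<le> m}
      (fillings (boxes a) \<times> fillings Y)"
  proof (rule fillings_split_bij)
    show "\<not> (i' \<le> i \<and> j' \<le> j)" if "(i, j) \<in> boxes a" "(i', j') \<in> Y" for i j i' j'
      using that boxes_down_closed[of i j a i' j'] by (auto simp: Y_def)
  qed (auto simp: Y_def size_a[symmetric] size_of_def)
  have "tab_le m T \<in> fillings (boxes a)"
    using bij_betwE[OF bij] F a un by auto
  then show ?thesis using size_a by (auto simp: SYT_size_eq skew_tableaux_def)
qed

lemma sum_all_tableaux:
  assumes m: "m \<le> n"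
  shows "(\<Sum>T\<in>SYT_size n. q ^ maj (tab_gt m T))
     = (\<Sum>b\<in>{b. size_of b = m}. num_tableaux b * (\<Sum>l\<in>{l. size_of l = n}. skew_gf q l b))"
proof -
  have "(\<Sum>T\<in>SYT_size n. q ^ maj (tab_gt m T)) = (\<Sum>B\<in>SYT_size m. \<Sum>T\<in>{T \<in> SYT_size n. tab_le m T = B}. q ^ maj (tab_gt m T))"
    by (rule sum.group[symmetric]) (use tab_le_in_SYT_size m in auto)
  also have "\<dots> = (\<Sum>B\<in>{B \<in> SYT_size m. True}. \<Sum>T\<in>SYT_extending n m B. q ^ maj (tab_gt m T))"
    by (simp add: SYT_extending_def)
  also have "\<dots> = (\<Sum>b\<in>{b. size_of b = m}. \<Sum>B\<in>{B \<in> skew_tableaux b empty_shape. True}. \<Sum>T\<in>SYT_extending n m B. q ^ maj (tab_gt m T))"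
    by (rule sum_SYT_size)
  also have "\<dots> = (\<Sum>b\<in>{b. size_of b = m}. num_tableaux b * (\<Sum>l\<in>{l. size_of l = n}. skew_gf q l b))"
    by (intro sum.cong refl) (simp add: sum_extensions num_tableaux_eq_card)
  finally show ?thesis .
qed

section \<open>Transposition\<close>

lemma fillings_swap:
  assumes T: "T \<in> fillings X"
  shows "T \<circ> prod.swap \<in> fillings (prod.swap ` X)"
proof -
  have "bij_betw (prod.swap :: nat \<times> nat \<Rightarrow> _) (prod.swap ` X) X"
    by (rule bij_betw_byWitness[where f' = prod.swap]) auto
  from bij_betw_trans[OF this fillingsD(1)[OF T]]
  have "bij_betw (T \<circ> prod.swap) (prod.swap ` X) {1..card (prod.swap ` X)}"
    by (simp add: card_image)
  moreover have "(i, j) \<in> prod.swap ` X \<longleftrightarrow> (j, i) \<in> X" for i j by force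
  ultimately show ?thesis using fillingsD(2-4)[OF T] by (auto simp: fillings_def)
qed

lemma SYT_size_swap:
  assumes "T \<in> SYT_size n"
  shows "T \<circ> prod.swap \<in> SYT_size n"
proof -
  obtain l where l: "size_of l = n" and T: "T \<in> fillings (boxes l)"
    using assms by (auto simp: SYT_size_eq skew_tableaux_def)
  have "\<exists>l'. boxes l' = prod.swap ` boxes l"
    by (rule shape_exists) (use boxes_down_closed in force)+
  then obtain l' where l': "boxes l' = prod.swap ` boxes l" by blast
  have "size_of l' = n" using l by (simp add: size_of_def l' card_image)
  then show ?thesis using fillings_swap[OF T] l' by (auto simp: SYT_size_eq skew_tableaux_def)
qed

text \<open>In a standard tableau \<open>i + 1\<close> is either in a lower row than \<open>i\<close> or in a column further to
  the right, and never both: a cell below and to the right of \<open>i\<close> exceeds a third entry between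
  the two. Transposition exchanges the two cases.\<close>

lemma descents_swap:
  assumes "T \<in> SYT_size n"
  shows "descents (T \<circ> prod.swap) = {1..<n} - descents T" and "descents T \<subseteq> {1..<n}"
proof -
  obtain l where l: "size_of l = n" and T: "T \<in> skew_tableaux l empty_shape"
    using assms by (auto simp: SYT_size_eq)
  have F: "T \<in> fillings (boxes l)" using T by (simp add: skew_tableaux_def)
  have ts: "tab_size T = n" using tab_size_fillings[OF F] l by (simp add: size_of_def)
  have ts': "tab_size (T \<circ> prod.swap) = n"
    using tab_size_fillings[OF fillings_swap[OF F]] l by (simp add: size_of_def card_image)
  show "descents T \<subseteq> {1..<n}" using ts by (auto simp: descents_def)
  show "descents (T \<circ> prod.swap) = {1..<n} - descents T"
  proof (rule set_eqI)
    fix i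
    show "i \<in> descents (T \<circ> prod.swap) \<longleftrightarrow> i \<in> {1..<n} - descents T"
    proof (cases "i \<in> {1..<n}")
      case False
      then show ?thesis using ts' by (auto simp: descents_def)
    next
      case i: True
      have "card (boxes l) = n" using l by (simp add: size_of_def)
      then obtain r c r' c' where rc: "T (r, c) = i" "T (r', c') = i + 1"
        using fillings_surj[OF F, of i] fillings_surj[OF F, of "i + 1"] i by force
      have uniq: "T x = i \<Longrightarrow> x = (r, c)" "T x = i + 1 \<Longrightarrow> x = (r', c')" for x
        using fillings_inj[OF F, of x "(r, c)"] fillings_inj[OF F, of x "(r', c')"] rc i by auto
      have in_l: "(r, c) \<in> boxes l" "(r', c') \<in> boxes l"
        using fillingsD(2)[OF F, of "(r, c)"] fillingsD(2)[OF F, of "(r', c')"] rc i by force+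
      have not_both: "\<not> (r < r' \<and> c < c')"
      proof
        assume lt: "r < r' \<and> c < c'"
        then have "(r, c') \<in> boxes l" using boxes_down_closed[OF in_l(2), of r c'] by simp
        then have "T (r, c) < T (r, c')" "T (r, c') < T (r', c')"
          using fillingsD(3)[OF F, of r c c'] fillingsD(4)[OF F, of r c' r'] in_l lt by auto
        then show False using rc by simp
      qed
      have one: "r < r' \<or> c < c'"
      proof (rule ccontr)
        assume "\<not> (r < r' \<or> c < c')"
        then show False
          using skew_tableaux_less[OF T, of r' c' r c] in_l rc by (cases "(r', c') = (r, c)") auto
      qed
      have "i \<in> descents T \<longleftrightarrow> r < r'"
        using i ts rc uniq unfolding descents_def mem_Collect_eq by (metis atLeastLessThan_iff prod.inject)
      moreover have "i \<in> descents (T \<circ> prod.swap) \<longleftrightarrow> c < c'"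
      proof -
        have "i \<in> descents (T \<circ> prod.swap) \<longleftrightarrow> (\<exists>r1 c1 r2 c2. T (c1, r1) = i \<and> T (c2, r2) = i + 1 \<and> r1 < r2)"
          using i ts' by (simp add: descents_def)
        also have "\<dots> \<longleftrightarrow> c < c'" using rc uniq by (metis prod.inject)
        finally show ?thesis .
      qed
      ultimately show ?thesis using i one not_both by auto
    qed
  qed
qed

lemma q_fact_inverse:
  assumes "q > 0"
  shows "q_fact q n = q ^ (\<Sum>i<n. i) * q_fact (1 / q) n"
proof (induction n)
  case (Suc n)
  have "(\<Sum>k<Suc n. q ^ k) = (\<Sum>k<Suc n. q ^ n * (1 / q) ^ (n - k))"
    using assms by (intro sum.cong refl) (auto simp: power_one_over power_diff field_simps)
  also have "\<dots> = q ^ n * (\<Sum>k<Suc n. (1 / q) ^ k)"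
    using sum.nat_diff_reindex[of "\<lambda>k. (1 / q) ^ k" "Suc n"] by (simp only: sum_distrib_left[symmetric] diff_Suc_Suc)
  finally have "(\<Sum>k<Suc n. q ^ k) = q ^ n * (\<Sum>k<Suc n. (1 / q) ^ k)" .
  then show ?case unfolding q_fact_Suc Suc.IH by (simp only: sum.lessThan_Suc power_add mult_ac)
qed simp

lemma level_sum_empty_eq: "level_sum q k empty_shape = (\<Sum>T\<in>SYT_size k. q ^ maj T) / q_fact q k"
  using sum_SYT_size[where n = k and P = "\<lambda>_. True" and f = "\<lambda>T. q ^ maj T"]
  by (simp add: level_sum_def norm_gf_def skew_gf_def sum_divide_distrib)

text \<open>By complementing descents, transposition turns \<open>maj\<close> into \<open>k (k - 1) / 2 - maj\<close>, and the
  power of \<open>q\<close> that this costs cancels against the one in \<open>[k]_q!\<close>. This reduces \<open>q > 1\<close> to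
  \<open>q < 1\<close>.\<close>

lemma level_sum_empty_inverse:
  assumes q: "q > 0"
  shows "level_sum q k empty_shape = level_sum (1 / q) k empty_shape"
proof -
  let ?N = "\<Sum>i<k. i"
  have N: "?N = \<Sum>{1..<k}"
    by (rule sum.mono_neutral_cong_right) auto
  have bij: "bij_betw (\<lambda>T. T \<circ> prod.swap) (SYT_size k) (SYT_size k)"
    by (rule bij_betw_byWitness[where f' = "\<lambda>T. T \<circ> prod.swap"]) (auto simp: SYT_size_swap fun_eq_iff)
  have "(\<Sum>T\<in>SYT_size k. q ^ maj T) = (\<Sum>T\<in>SYT_size k. q ^ maj (T \<circ> prod.swap))"
    by (rule sum.reindex_bij_betw[OF bij, symmetric])
  also have "\<dots> = (\<Sum>T\<in>SYT_size k. q ^ ?N * (1 / q) ^ maj T)"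
  proof (rule sum.cong[OF refl])
    fix T assume T: "T \<in> SYT_size k"
    have "maj (T \<circ> prod.swap) + maj T = ?N"
      unfolding maj_def descents_swap(1)[OF T] N
      using sum.subset_diff[OF descents_swap(2)[OF T], of "\<lambda>x. x"] by simp
    then have "q ^ ?N = q ^ maj (T \<circ> prod.swap) * q ^ maj T" by (metis power_add)
    then show "q ^ maj (T \<circ> prod.swap) = q ^ ?N * (1 / q) ^ maj T" using q by (simp add: power_one_over)
  qed
  finally show ?thesis
    using q by (simp add: level_sum_empty_eq q_fact_inverse[OF q] sum_distrib_left[symmetric] del: sum_divide_distrib)
qed

section \<open>Asymptotics of the sum over straight shapes\<close>

text \<open>For large \<open>k\<close> the growth factors are at most \<open>1 / (1 - C r^k)\<close>, and the product of these
  numbers converges.\<close>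

lemma bounded_of_geometric_growth:
  fixes y :: "nat \<Rightarrow> real"
  assumes nn: "\<And>k. 0 \<le> y k" and mono: "\<And>k. y k \<le> y (Suc k)"
    and r: "0 \<le> r" "r < 1" and C: "0 \<le> C"
    and growth: "\<And>k. y (Suc k) - y k \<le> C * r ^ Suc k * y (Suc k)"
  shows "\<exists>M. \<forall>k. y k \<le> M"
proof -
  have "(\<lambda>k. C * r ^ k) \<longlonglongrightarrow> C * 0"
    using r by (intro tendsto_intros LIMSEQ_realpow_zero) auto
  then have "eventually (\<lambda>k. C * r ^ k < 1 / 2) sequentially" by (rule order_tendstoD) simp
  then obtain K where K: "\<And>k. k \<ge> K \<Longrightarrow> C * r ^ k < 1 / 2" unfolding eventually_sequentially by blast
  have step: "y (Suc k) \<le> y k * exp (2 * (C * r ^ Suc k))" if "k \<ge> K" for k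
  proof -
    define x where "x = C * r ^ Suc k"
    \<comment> \<open>For \<open>0 \<le> x \<le> 1 / 2\<close> one has \<open>1 / (1 - x) \<le> 1 + 2 x \<le> exp (2 x)\<close>.\<close>
    have x: "0 \<le> x" "x \<le> 1 / 2" using K[of "Suc k"] that C r by (auto simp: x_def intro: less_imp_le)
    have "0 \<le> x * (1 - 2 * x)" using x by simp
    then have "1 \<le> (1 - x) * (1 + 2 * x)" by (simp add: algebra_simps)
    also have "\<dots> \<le> (1 - x) * exp (2 * x)" using x exp_ge_add_one_self[of "2 * x"] by (intro mult_left_mono) auto
    finally have "y (Suc k) * 1 \<le> y (Suc k) * ((1 - x) * exp (2 * x))" by (intro mult_left_mono nn)
    also have "\<dots> = (y (Suc k) - x * y (Suc k)) * exp (2 * x)" by (simp add: algebra_simps)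
    also have "\<dots> \<le> y k * exp (2 * x)" using growth[of k] by (intro mult_right_mono) (auto simp: x_def)
    finally show ?thesis by (simp add: x_def)
  qed
  have bound: "y (K + j) \<le> y K * exp (2 * C * (\<Sum>i<j. r ^ i))" for j
  proof (induction j)
    case (Suc j)
    have "r ^ Suc (K + j) \<le> r ^ j" using r by (intro power_decreasing) auto
    then have "2 * (C * r ^ Suc (K + j)) \<le> 2 * C * r ^ j" using C by (simp add: mult_left_mono)
    then have "exp (2 * (C * r ^ Suc (K + j))) \<le> exp (2 * C * r ^ j)" by simp
    then have "y (K + Suc j) \<le> y (K + j) * exp (2 * C * r ^ j)"
      using step[of "K + j"] mult_left_mono[OF _ nn[of "K + j"]] unfolding add_Suc_right
      by (meson le_add1 order_trans)
    also have "\<dots> \<le> (y K * exp (2 * C * (\<Sum>i<j. r ^ i))) * exp (2 * C * r ^ j)"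
      by (intro mult_right_mono Suc.IH) simp
    finally show ?case by (simp add: exp_add[symmetric] distrib_left mult.assoc)
  qed simp
  have "y k \<le> y K * exp (2 * C * (1 / (1 - r)))" for k
  proof -
    have incr: "i \<le> j \<Longrightarrow> y i \<le> y j" for i j using mono by (rule lift_Suc_mono_le)
    have "(\<Sum>i<k. r ^ i) \<le> (\<Sum>i. r ^ i)" using r by (intro sum_le_suminf summable_geometric) auto
    also have "\<dots> = 1 / (1 - r)" using r by (intro suminf_geometric) auto
    finally have "2 * C * (\<Sum>i<k. r ^ i) \<le> 2 * C * (1 / (1 - r))" using C by (intro mult_left_mono) auto
    then have "y (K + k) \<le> y K * exp (2 * C * (1 / (1 - r)))"
      using bound[of k] nn[of K] by (auto intro: order_trans mult_left_mono)
    then show ?thesis using incr[of k "K + k"] by simp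
  qed
  then show ?thesis by blast
qed

lemma norm_gf_nonneg: "q > 0 \<Longrightarrow> norm_gf q l a \<ge> 0"
  unfolding norm_gf_def skew_gf_def by (intro divide_nonneg_nonneg sum_nonneg less_imp_le[OF q_fact_pos]) auto

lemma level_sum_empty_rec:
  assumes "q > 0" "q \<noteq> 1"
  shows "level_sum q k empty_shape = (\<Sum>m\<le>k. pair_coeff q (k - m) * (q ^ m * level_sum q m empty_shape))"
proof -
  have "{s. hstrip s empty_shape} = {empty_shape}"
    using hstrip_size[of _ empty_shape] by auto
  then show ?thesis by (subst level_sum_rec[OF assms]) simp
qed

text \<open>After division by \<open>(1 - q) ^ k\<close> the sequence increases to a finite positive limit. Its
  increments are controlled by the recursion for the empty shape: a summand of index \<open>m\<close> carries
  the factor \<open>q ^ m\<close>, and the increment of the other factor is at most a constant times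
  \<open>sqrt q ^ (k + 1 - m)\<close>.\<close>

lemma level_sum_ratio_small_q:
  assumes q: "0 < q" "q < 1"
  shows "(\<lambda>k. level_sum q (Suc k) empty_shape / level_sum q k empty_shape) \<longlonglongrightarrow> 1 - q"
proof -
  define e where "e u = 1 / ((1 - q) ^ u * q_fact q u)" for u
  \<comment> \<open>\<open>P n\<close> is \<open>pair_coeff q n / (1 - q) ^ n\<close>.\<close>
  define P where "P n = (\<Sum>u\<in>{u. 2 * u \<le> n}. q ^ u * e u)" for n
  define y where "y k = level_sum q k empty_shape / (1 - q) ^ k" for k
  \<comment> \<open>The increment of \<open>P\<close> at \<open>2 v\<close> contains \<open>q ^ v = r ^ (2 v)\<close>, and splitting \<open>q ^ m = r ^ m * r ^ m\<close> leaves a convergent series in \<open>m\<close>.\<close>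
  define r where "r = sqrt q"
  have r: "0 < r" "r < 1" "r * r = q" using q by (auto simp: r_def)
  have e_pos: "e u > 0" for u using q by (simp add: e_def)
  have "e (Suc u) - e u = q ^ Suc u * e (Suc u)" for u
  proof -
    have "(1 - q ^ Suc u) * e (Suc u) = e u"
    proof -
      have eq: "(1 - q) ^ Suc u * q_fact q (Suc u) = (1 - q ^ Suc u) * ((1 - q) ^ u * q_fact q u)"
        using q_fact_step[of q u] by (simp add: mult_ac)
      have "1 - q ^ Suc u \<noteq> 0" using power_Suc_less_one[OF q(1), of u] q by (simp add: power_eq_1_iff)
      then show ?thesis unfolding e_def eq by simp
    qed
    then show ?thesis by (simp add: algebra_simps)
  qed
  then have e_growth: "e (Suc u) - e u = 1 * q ^ Suc u * e (Suc u)" for u by simp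
  have "\<exists>E. \<forall>u. e u \<le> E"
  proof (rule bounded_of_geometric_growth[where r = q and C = 1])
    show "e k \<le> e (Suc k)" for k
    proof -
      have "0 \<le> 1 * q ^ Suc k * e (Suc k)" using q e_pos[of "Suc k"] by simp
      then show ?thesis using e_growth[of k] by linarith
    qed
    show "e (Suc k) - e k \<le> 1 * q ^ Suc k * e (Suc k)" for k using e_growth[of k] by simp
  qed (use q e_pos less_imp_le in auto)
  then obtain E where E: "\<And>u. e u \<le> E" by blast
  have E1: "1 \<le> E" using E[of 0] by (simp add: e_def)
  have P0: "P 0 = 1"
  proof -
    have "{u::nat. 2 * u \<le> 0} = {0}" by auto
    then show ?thesis by (simp add: P_def e_def)
  qed
  have P_step: "P n \<le> P (Suc n) \<and> P (Suc n) - P n \<le> E * r ^ Suc n" for n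
  proof (cases "even (Suc n)")
    case True
    then obtain v where v: "Suc n = 2 * v" by (elim evenE)
    have "{u. 2 * u \<le> Suc n} = insert v {u. 2 * u \<le> n}" using v by auto
    moreover have "v \<notin> {u. 2 * u \<le> n}" using v by auto
    ultimately have "P (Suc n) = P n + q ^ v * e v" by (simp add: P_def)
    moreover have "q ^ v = r ^ Suc n" unfolding v power_mult r(3)[symmetric] by (simp add: power2_eq_square)
    moreover have "0 \<le> q ^ v * e v" using q e_pos[of v] by simp
    moreover have "r ^ Suc n * e v \<le> r ^ Suc n * E" using E r by (intro mult_left_mono) auto
    ultimately show ?thesis by (simp add: mult.commute)
  next
    case False
    then have "2 * u \<le> Suc n \<longleftrightarrow> 2 * u \<le> n" for u by presburger
    then have "P (Suc n) = P n" by (simp add: P_def)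
    then show ?thesis using r E1 by simp
  qed
  have y_rec: "y k = (\<Sum>m\<le>k. P (k - m) * (q ^ m * y m))" for k
  proof -
    have "P (k - m) * (q ^ m * y m) = pair_coeff q (k - m) * (q ^ m * level_sum q m empty_shape) / (1 - q) ^ k" if "m \<le> k" for m
    proof -
      have "pair_coeff q (k - m) = (1 - q) ^ (k - m) * P (k - m)"
        unfolding pair_coeff_def P_def sum_distrib_left
      proof (rule sum.cong[OF refl])
        fix u assume "u \<in> {u. 2 * u \<le> k - m}"
        then have "k - m = (k - m - u) + u" by simp
        then have "(1 - q) ^ (k - m) = (1 - q) ^ (k - m - u) * (1 - q) ^ u" by (metis power_add)
        then show "q ^ u * (1 - q) ^ (k - m - u) / q_fact q u = (1 - q) ^ (k - m) * (q ^ u * e u)"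
          using q by (simp add: e_def)
      qed
      moreover have "(1 - q) ^ k = (1 - q) ^ (k - m) * (1 - q) ^ m" using that by (simp add: power_add[symmetric])
      ultimately show ?thesis using q by (simp add: y_def)
    qed
    then have "(\<Sum>m\<le>k. P (k - m) * (q ^ m * y m)) = (\<Sum>m\<le>k. pair_coeff q (k - m) * (q ^ m * level_sum q m empty_shape)) / (1 - q) ^ k"
      unfolding sum_divide_distrib by (intro sum.cong refl) auto
    then show ?thesis using level_sum_empty_rec[of q k] q by (simp add: y_def)
  qed
  have y_nn: "0 \<le> y k" for k
    unfolding y_def level_sum_def using q by (intro divide_nonneg_nonneg sum_nonneg norm_gf_nonneg) auto
  have diff: "y (Suc k) - y k = (\<Sum>m\<le>Suc k. (P (Suc k - m) - (if m = Suc k then 0 else P (k - m))) * (q ^ m * y m))" for k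
    unfolding y_rec[of "Suc k"] left_diff_distrib sum_subtractf by (simp add: y_rec[of k])
  have term_nn: "0 \<le> P (Suc k - m) - (if m = Suc k then 0 else P (k - m))"
    and term_le: "P (Suc k - m) - (if m = Suc k then 0 else P (k - m)) \<le> E * r ^ (Suc k - m)" if "m \<le> Suc k" for k m
    using that P_step[of "k - m"] P0 E1 by (cases "m = Suc k"; simp add: Suc_diff_le)+
  have y_mono: "y k \<le> y (Suc k)" for k
  proof -
    have "0 \<le> y (Suc k) - y k"
      unfolding diff using q by (intro sum_nonneg mult_nonneg_nonneg term_nn y_nn) auto
    then show ?thesis by simp
  qed
  have y_incr: "i \<le> j \<Longrightarrow> y i \<le> y j" for i j using y_mono by (rule lift_Suc_mono_le)
  have "\<exists>M. \<forall>k. y k \<le> M"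
  proof (rule bounded_of_geometric_growth[where y = y, OF y_nn y_mono])
    show "y (Suc k) - y k \<le> E / (1 - r) * r ^ Suc k * y (Suc k)" for k
    proof -
      have "y (Suc k) - y k \<le> (\<Sum>m\<le>Suc k. E * r ^ (Suc k - m) * (q ^ m * y (Suc k)))"
        unfolding diff
      proof (rule sum_mono)
        fix m assume m: "m \<in> {..Suc k}"
        have "q ^ m * y m \<le> q ^ m * y (Suc k)" using m y_incr[of m "Suc k"] q by (intro mult_left_mono) auto
        then show "(P (Suc k - m) - (if m = Suc k then 0 else P (k - m))) * (q ^ m * y m) \<le> E * r ^ (Suc k - m) * (q ^ m * y (Suc k))"
          using m term_le[of m k] E1 r q y_nn[of m] by (intro mult_mono) auto
      qed
      also have "\<dots> = E * r ^ Suc k * y (Suc k) * (\<Sum>m\<le>Suc k. r ^ m)"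
        unfolding sum_distrib_left
      proof (rule sum.cong[OF refl])
        fix m assume "m \<in> {..Suc k}"
        then have "r ^ Suc k = r ^ (Suc k - m) * r ^ m" by (simp only: power_add[symmetric]) simp
        then show "E * r ^ (Suc k - m) * (q ^ m * y (Suc k)) = E * r ^ Suc k * y (Suc k) * r ^ m"
          unfolding r(3)[symmetric] power_mult_distrib by (simp only: mult_ac)
      qed
      also have "\<dots> \<le> E * r ^ Suc k * y (Suc k) * (1 / (1 - r))"
      proof (rule mult_left_mono)
        have "(\<Sum>m\<le>Suc k. r ^ m) \<le> (\<Sum>m. r ^ m)" using r by (intro sum_le_suminf summable_geometric) auto
        also have "\<dots> = 1 / (1 - r)" using r by (intro suminf_geometric) auto
        finally show "(\<Sum>m\<le>Suc k. r ^ m) \<le> 1 / (1 - r)" .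
        show "0 \<le> E * r ^ Suc k * y (Suc k)" using E1 r y_nn[of "Suc k"] by simp
      qed
      finally show ?thesis by (simp add: mult_ac)
    qed
  qed (use r E1 in auto)
  then obtain M where "\<And>k. y k \<le> M" by blast
  then obtain L where L: "y \<longlonglongrightarrow> L" and le: "\<And>k. y k \<le> L"
    using incseq_convergent[of y M] y_mono by (auto simp: incseq_Suc_iff)
  have "y 0 = 1" by (simp add: y_def)
  then have "L \<noteq> 0" using le[of 0] by simp
  then have "(\<lambda>k. y (Suc k) / y k) \<longlonglongrightarrow> L / L" by (intro tendsto_divide LIMSEQ_Suc L)
  then have "(\<lambda>k. (1 - q) * (y (Suc k) / y k)) \<longlonglongrightarrow> (1 - q) * (L / L)" by (rule tendsto_mult_left)
  moreover have "(1 - q) * (y (Suc k) / y k) = level_sum q (Suc k) empty_shape / level_sum q k empty_shape" for k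
    using q by (simp add: y_def)
  ultimately show ?thesis using \<open>L \<noteq> 0\<close> by simp
qed

lemma total_tableaux_pos: "total_tableaux n > 0"
  by (induction n rule: less_induct)
    (metis add_pos_nonneg diff_le_self le_imp_less_Suc less_imp_le mult_nonneg_nonneg not0_implies_Suc of_nat_0_le_iff
      total_tableaux_0 total_tableaux_rec zero_less_one lessI)

text \<open>With \<open>\<rho>_k\<close> the ratio, the recursion reads \<open>\<rho>_(k+1) = 1 + (k + 1) / \<rho>_k\<close>, and each bound
  for \<open>\<rho>_k\<close> gives the opposite bound for \<open>\<rho>_(k+1)\<close>.\<close>

lemma total_tableaux_ratio:
  "sqrt (real (Suc k)) \<le> total_tableaux (Suc k) / total_tableaux k
   \<and> total_tableaux (Suc k) / total_tableaux k \<le> 1 + sqrt (real k)"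
proof (induction k)
  case 0
  show ?case using total_tableaux_rec[of 0] by (simp add: total_tableaux_0)
next
  case (Suc k)
  define \<rho> where "\<rho> = total_tableaux (Suc k) / total_tableaux k"
  have lo: "sqrt (real (Suc k)) \<le> \<rho>" and hi: "\<rho> \<le> 1 + sqrt (real k)" using Suc.IH by (auto simp: \<rho>_def)
  have pos: "\<rho> > 0" using total_tableaux_pos by (simp add: \<rho>_def)
  have eq: "total_tableaux (Suc (Suc k)) / total_tableaux (Suc k) = 1 + real (Suc k) / \<rho>"
    using total_tableaux_rec[of "Suc k"] total_tableaux_pos[of "Suc k"] total_tableaux_pos[of k]
    by (simp add: \<rho>_def field_simps)
  have "real (Suc k) / \<rho> \<le> real (Suc k) / sqrt (real (Suc k))"
    using lo by (intro divide_left_mono) (auto intro: mult_pos_pos pos)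
  also have "\<dots> = sqrt (real (Suc k))" by (rule real_div_sqrt) simp
  finally have upper: "real (Suc k) / \<rho> \<le> sqrt (real (Suc k))" .
  have "sqrt (real (Suc (Suc k))) - 1 = real (Suc k) / (sqrt (real (Suc (Suc k))) + 1)"
  proof -
    have "(sqrt (real (Suc (Suc k))) - 1) * (sqrt (real (Suc (Suc k))) + 1) = real (Suc k)"
      by (simp add: algebra_simps)
    moreover have "sqrt (real (Suc (Suc k))) + 1 > 0" by (simp add: add_nonneg_pos)
    ultimately show ?thesis by (simp add: eq_divide_eq)
  qed
  also have "\<dots> \<le> real (Suc k) / \<rho>"
  proof (rule divide_left_mono)
    have "sqrt (real k) \<le> sqrt (real (Suc (Suc k)))" by simp
    then show "\<rho> \<le> sqrt (real (Suc (Suc k))) + 1" using hi by linarith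
    show "0 < (sqrt (real (Suc (Suc k))) + 1) * \<rho>" using pos by (intro mult_pos_pos add_nonneg_pos) auto
  qed simp
  finally show ?case using upper unfolding eq by simp
qed

lemma level_sum_ratio_one:
  "(\<lambda>k. level_sum 1 (Suc k) empty_shape / level_sum 1 k empty_shape) \<longlonglongrightarrow> 0"
proof (rule tendsto_sandwich[OF always_eventually always_eventually])
  have ls: "level_sum 1 k empty_shape = total_tableaux k / fact k" for k
    by (simp add: level_sum_def norm_gf_def total_tableaux_def num_tableaux_def q_fact_1 sum_divide_distrib)
  have ratio: "level_sum 1 (Suc k) empty_shape / level_sum 1 k empty_shape
      = (total_tableaux (Suc k) / total_tableaux k) / real (Suc k)" for k
  proof -
    have "total_tableaux k \<noteq> 0" using total_tableaux_pos[of k] by simp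
    then show ?thesis unfolding ls by (simp add: divide_simps mult_ac)
  qed
  show "\<forall>k. 0 \<le> level_sum 1 (Suc k) empty_shape / level_sum 1 k empty_shape"
    unfolding ls by (intro allI divide_nonneg_nonneg less_imp_le[OF total_tableaux_pos]) auto
  show "\<forall>k. level_sum 1 (Suc k) empty_shape / level_sum 1 k empty_shape \<le> 2 * sqrt (inverse (real (Suc k)))"
  proof
    fix k
    have "1 + sqrt (real k) \<le> 2 * sqrt (real (Suc k))"
    proof -
      have "1 \<le> sqrt (real (Suc k))" "sqrt (real k) \<le> sqrt (real (Suc k))" by simp_all
      then show ?thesis by linarith
    qed
    then have "total_tableaux (Suc k) / total_tableaux k \<le> 2 * sqrt (real (Suc k))"
      using total_tableaux_ratio[of k] by linarith
    then have "level_sum 1 (Suc k) empty_shape / level_sum 1 k empty_shape \<le> 2 * sqrt (real (Suc k)) / real (Suc k)"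
      unfolding ratio by (intro divide_right_mono) auto
    also have "\<dots> = 2 * sqrt (inverse (real (Suc k)))"
      using sqrt_divide_self_eq[of "real (Suc k)"] by (simp add: real_sqrt_inverse)
    finally show "level_sum 1 (Suc k) empty_shape / level_sum 1 k empty_shape \<le> 2 * sqrt (inverse (real (Suc k)))" .
  qed
  have "(\<lambda>k. 2 * sqrt (inverse (real (Suc k)))) \<longlonglongrightarrow> 2 * sqrt 0"
    by (intro tendsto_intros LIMSEQ_inverse_real_of_nat)
  then show "(\<lambda>k. 2 * sqrt (inverse (real (Suc k)))) \<longlonglongrightarrow> 0" by simp
qed simp

lemma level_sum_ratio:
  assumes q: "q > 0"
  shows "(\<lambda>k. level_sum q (Suc k) empty_shape / level_sum q k empty_shape) \<longlonglongrightarrow> 1 - min q (inverse q)"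
proof -
  consider "q < 1" | "q = 1" | "q > 1" by linarith
  then show ?thesis
  proof cases
    case 1
    then have "min q (inverse q) = q" using q one_less_inverse[of q] by (simp add: min_def)
    then show ?thesis using level_sum_ratio_small_q[OF q 1] by simp
  next
    case 2
    then show ?thesis using level_sum_ratio_one by simp
  next
    case 3
    then have "min q (inverse q) = 1 / q" using less_trans[OF inverse_less_1_iff[THEN iffD2, of q] 3] by (simp add: inverse_eq_divide)
    then show ?thesis using level_sum_ratio_small_q[of "1 / q"] 3 level_sum_empty_inverse[OF q] by simp
  qed
qed

lemma level_sum_empty_pos: "q > 0 \<Longrightarrow> level_sum q k empty_shape > 0"
proof -
  assume q: "q > 0"
  have "SYT_size k \<noteq> {}"
  proof
    assume "SYT_size k = {}"
    then have "(\<Sum>l\<in>{l. size_of l = k}. \<Sum>T\<in>{T \<in> skew_tableaux l empty_shape. True}. 1 :: real) = 0"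
      using sum_SYT_size[where n = k and P = "\<lambda>_. True" and f = "\<lambda>_. 1 :: real"] by simp
    then show False using total_tableaux_pos[of k] by (simp add: total_tableaux_def num_tableaux_eq_card)
  qed
  then show ?thesis unfolding level_sum_empty_eq using q by (intro divide_pos_pos sum_pos) auto
qed

section \<open>The limit\<close>

lemma removed_sum_large: "h > size_of a \<Longrightarrow> removed_sum q h a = 0"
proof -
  assume "h > size_of a"
  then have "{m. size_of m + h = size_of a} = {}" by auto
  then show ?thesis unfolding removed_sum_def by (simp only: sum.empty)
qed

text \<open>Since \<open>removed_sum q h a\<close> vanishes for \<open>h > m\<close>, the factorisation involves only the last
  \<open>m + 1\<close> terms of the sequence \<open>b\<close>, and their ratios to \<open>b p\<close> tend to powers of
  \<open>1 - min q (inverse q)\<close>.\<close>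

lemma level_sum_scaled_limit:
  assumes q: "q > 0" and m: "size_of a = m"
  shows "(\<lambda>p. level_sum q (p + m) a / level_sum q p empty_shape)
     \<longlonglongrightarrow> (\<Sum>j\<le>m. (1 - min q (inverse q)) ^ j * removed_sum q (m - j) a)"
proof -
  define b where "b k = level_sum q k empty_shape" for k
  define x where "x = 1 - min q (inverse q)"
  have b_pos: "b k > 0" for k using level_sum_empty_pos[OF q] by (simp add: b_def)
  \<comment> \<open>Also valid for \<open>x = 0\<close>, with \<open>0 ^ 0 = 1\<close>.\<close>
  have ratio: "(\<lambda>p. b (p + j) / b p) \<longlonglongrightarrow> x ^ j" for j
  proof (induction j)
    case 0
    show ?case using b_pos by (simp add: less_imp_neq[symmetric])
  next
    case (Suc j)
    have "(\<lambda>p. b (Suc p) / b p) \<longlonglongrightarrow> x" using level_sum_ratio[OF q] by (simp add: b_def x_def)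
    from LIMSEQ_ignore_initial_segment[OF this, of j]
    have "(\<lambda>p. b (Suc (p + j)) / b (p + j) * (b (p + j) / b p)) \<longlonglongrightarrow> x * x ^ j"
      by (intro tendsto_mult Suc.IH)
    then show ?case using b_pos by (simp add: less_imp_neq[symmetric])
  qed
  have expand: "level_sum q (p + m) a = (\<Sum>j\<le>m. b (p + j) * removed_sum q (m - j) a)" for p
  proof -
    have "level_sum q (p + m) a = (\<Sum>i\<le>p + m. b i * removed_sum q (p + m - i) a)"
      unfolding b_def by (rule level_sum_factorization[OF q])
    also have "\<dots> = (\<Sum>i\<in>{p..p + m}. b i * removed_sum q (p + m - i) a)"
      by (rule sum.mono_neutral_right) (auto simp: removed_sum_large m)
    also have "\<dots> = (\<Sum>j\<le>m. b (p + j) * removed_sum q (m - j) a)"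
      by (rule sum.reindex_bij_witness[where i = "\<lambda>j. p + j" and j = "\<lambda>i. i - p"]) (auto simp: add.commute)
    finally show ?thesis .
  qed
  have "(\<lambda>p. \<Sum>j\<le>m. b (p + j) / b p * removed_sum q (m - j) a) \<longlonglongrightarrow> (\<Sum>j\<le>m. x ^ j * removed_sum q (m - j) a)"
    by (intro tendsto_intros ratio)
  then show ?thesis by (simp add: expand b_def[symmetric] x_def[symmetric] sum_divide_distrib)
qed

text \<open>Exchange the summations over the outer shape \<open>b\<close> and the inner shape \<open>u\<close>; the sum over
  \<open>b\<close> does not depend on \<open>q\<close>.\<close>

lemma weighted_removed_sums:
  assumes q: "q > 0"
  shows "(\<Sum>b\<in>{b. size_of b = m}. num_tableaux b * (\<Sum>j\<le>m. x ^ j * removed_sum q (m - j) b))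
    = (\<Sum>j\<le>m. x ^ j * (real (m choose j) * total_tableaux j))"
proof -
  have "(\<Sum>b\<in>{b. size_of b = m}. num_tableaux b * (\<Sum>j\<le>m. x ^ j * removed_sum q (m - j) b))
    = (\<Sum>b\<in>{b. size_of b = m}. \<Sum>j\<le>m. \<Sum>u\<in>{u. size_of u = j}. x ^ j * (num_tableaux b * norm_gf q b u))"
    unfolding sum_distrib_left
  proof (intro sum.cong refl)
    fix b j assume "b \<in> {b. size_of b = m}" "j \<in> {..m}"
    then have "{u. size_of u + (m - j) = size_of b} = {u. size_of u = j}" by auto
    then show "num_tableaux b * (x ^ j * removed_sum q (m - j) b) = (\<Sum>u\<in>{u. size_of u = j}. x ^ j * (num_tableaux b * norm_gf q b u))"
      by (simp add: removed_sum_def sum_distrib_left mult_ac)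
  qed
  also have "\<dots> = (\<Sum>j\<le>m. \<Sum>b\<in>{b. size_of b = m}. \<Sum>u\<in>{u. size_of u = j}. x ^ j * (num_tableaux b * norm_gf q b u))"
    by (rule sum.swap)
  also have "\<dots> = (\<Sum>j\<le>m. \<Sum>u\<in>{u. size_of u = j}. \<Sum>b\<in>{b. size_of b = m}. x ^ j * (num_tableaux b * norm_gf q b u))"
    by (intro sum.cong refl sum.swap)
  also have "\<dots> = (\<Sum>j\<le>m. x ^ j * (real (m choose j) * total_tableaux j))"
    by (simp add: sum_distrib_left[symmetric] count_weighted[OF q] total_tableaux_def)
  finally show ?thesis .
qed

lemma sum_skew_gf_level: "size_of a = m \<Longrightarrow> q > 0 \<Longrightarrow>
  (\<Sum>l\<in>{l. size_of l = m + k}. skew_gf q l a) = q_fact q k * level_sum q k a"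
  by (simp add: level_sum_def norm_gf_def sum_distrib_left)

text \<open>Numerator and denominator have the common factor \<open>[n - m]_q!\<close>; after cancelling it, both
  are divided by \<open>b p\<close> with \<open>n = p + 2 m\<close>, so that \<open>n - m = p + m\<close>.\<close>

lemma extension_ratio_limit:
  assumes A: "A \<in> skew_tableaux a empty_shape" and m: "size_of a = m" and q: "q > 0"
  defines "x \<equiv> 1 - min q (inverse q)"
  shows "(\<lambda>n. (\<Sum>T\<in>SYT_extending n m A. q ^ maj (tab_gt m T)) / (\<Sum>T\<in>SYT_size n. q ^ maj (tab_gt m T)))
    \<longlonglongrightarrow> (\<Sum>j\<le>m. x ^ j * removed_sum q (m - j) a) / (\<Sum>j\<le>m. x ^ j * (real (m choose j) * total_tableaux j))"
    and "(\<Sum>j\<le>m. x ^ j * (real (m choose j) * total_tableaux j)) > 0"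
proof -
  let ?f = "\<lambda>n. (\<Sum>T\<in>SYT_extending n m A. q ^ maj (tab_gt m T)) / (\<Sum>T\<in>SYT_size n. q ^ maj (tab_gt m T))"
  let ?Y = "\<Sum>j\<le>m. x ^ j * (real (m choose j) * total_tableaux j)"
  have x: "0 \<le> x"
  proof -
    have "q \<le> 1 \<or> inverse q \<le> 1" using q by (cases "q \<le> 1") (auto simp: inverse_le_1_iff)
    then show ?thesis by (auto simp: x_def min_def)
  qed
  have "0 < (\<Sum>j\<in>{0}. x ^ j * (real (m choose j) * total_tableaux j))" by (simp add: total_tableaux_0)
  also have "\<dots> \<le> ?Y"
    using x less_imp_le[OF total_tableaux_pos] by (intro sum_mono2) auto
  finally show Y: "?Y > 0" .
  define b where "b p = level_sum q p empty_shape" for p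
  have b: "b p > 0" for p using level_sum_empty_pos[OF q] by (simp add: b_def)
  have "(\<lambda>p. (level_sum q (p + m) a / b p) / (\<Sum>c\<in>{c. size_of c = m}. num_tableaux c * (level_sum q (p + m) c / b p)))
     \<longlonglongrightarrow> (\<Sum>j\<le>m. x ^ j * removed_sum q (m - j) a)
          / (\<Sum>c\<in>{c. size_of c = m}. num_tableaux c * (\<Sum>j\<le>m. x ^ j * removed_sum q (m - j) c))"
    unfolding b_def x_def
    by (intro tendsto_divide tendsto_sum tendsto_mult tendsto_const level_sum_scaled_limit[OF q] m)
      (use Y in \<open>auto simp: weighted_removed_sums[OF q] x_def\<close>)
  moreover have "(level_sum q (p + m) a / b p) / (\<Sum>c\<in>{c. size_of c = m}. num_tableaux c * (level_sum q (p + m) c / b p)) = ?f (p + (m + m))" for p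
  proof -
    have n: "p + (m + m) = m + (p + m)" by simp
    have num: "(\<Sum>T\<in>SYT_extending (p + (m + m)) m A. q ^ maj (tab_gt m T)) = q_fact q (p + m) * level_sum q (p + m) a"
      unfolding sum_extensions[OF A m] n by (rule sum_skew_gf_level[OF m q])
    have den: "(\<Sum>T\<in>SYT_size (p + (m + m)). q ^ maj (tab_gt m T))
        = q_fact q (p + m) * (\<Sum>c\<in>{c. size_of c = m}. num_tableaux c * level_sum q (p + m) c)"
    proof -
      have "(\<Sum>T\<in>SYT_size (p + (m + m)). q ^ maj (tab_gt m T))
          = (\<Sum>c\<in>{c. size_of c = m}. num_tableaux c * (\<Sum>l\<in>{l. size_of l = m + (p + m)}. skew_gf q l c))"
        unfolding n by (rule sum_all_tableaux) simp
      also have "\<dots> = (\<Sum>c\<in>{c. size_of c = m}. q_fact q (p + m) * (num_tableaux c * level_sum q (p + m) c))"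
      proof (rule sum.cong[OF refl])
        fix c assume "c \<in> {c. size_of c = m}"
        then have "size_of c = m" by simp
        from sum_skew_gf_level[OF this q] show "num_tableaux c * (\<Sum>l\<in>{l. size_of l = m + (p + m)}. skew_gf q l c)
          = q_fact q (p + m) * (num_tableaux c * level_sum q (p + m) c)" by simp
      qed
      finally show ?thesis by (simp add: sum_distrib_left)
    qed
    have "(\<Sum>c\<in>{c. size_of c = m}. num_tableaux c * (level_sum q (p + m) c / b p))
      = (\<Sum>c\<in>{c. size_of c = m}. num_tableaux c * level_sum q (p + m) c) / b p"
      by (simp add: sum_divide_distrib)
    then show ?thesis unfolding num den using b[of p] q by simp
  qed
  ultimately have "(\<lambda>p. ?f (p + (m + m))) \<longlonglongrightarrow> (\<Sum>j\<le>m. x ^ j * removed_sum q (m - j) a) / ?Y"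
    by (simp add: weighted_removed_sums[OF q])
  then show "?f \<longlonglongrightarrow> (\<Sum>j\<le>m. x ^ j * removed_sum q (m - j) a) / ?Y" by (rule LIMSEQ_offset)
qed

theorem theorem1p3:
  fixes m :: nat and \<alpha> :: "nat list" and A :: tableau and q qb E D :: real
  assumes "\<alpha> \<in> partitions_of m"
    and "A \<in> SYT \<alpha>"
    and "q > 0"
    and "qb = min q (inverse q)"
    and "E = (\<Sum>j=1..m. q_binomial q m j * q_fact q j * (1 - qb) ^ (j - 1)
                * (\<Sum>\<mu>\<in>partitions_of j. skew_maj_gf \<alpha> \<mu> q))"
    and "D = q_fact q m
                * (\<Sum>j=1..m. real (num_involutions j) * real (m choose j) * (1 - qb) ^ (j - 1))"
  shows "(\<lambda>n. (\<Sum>T\<in>SYT_extending n m A. q ^ maj (tab_gt m T))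
            / (\<Sum>T\<in>SYT_size n. q ^ maj (tab_gt m T)))
          \<longlonglongrightarrow> (maj_gf \<alpha> q + (1 - qb) * E) / (q_fact q m + (1 - qb) * D)
       \<and> (\<lambda>n. (\<Sum>T\<in>SYT_extending n m A. q ^ maj (tab_gt m T))
            / (\<Sum>T\<in>SYT_size n. q ^ maj (tab_gt m T)))
          \<longlonglongrightarrow> (\<Sum>j=0..m. q_binomial q m j * q_fact q j * (1 - qb) ^ j
                  * (\<Sum>\<mu>\<in>partitions_of j. skew_maj_gf \<alpha> \<mu> q))
              / (\<Sum>j=0..m. q_fact q m * real (num_involutions j) * real (m choose j) * (1 - qb) ^ j)"
proof -
  note q = \<open>q > 0\<close>
  define a where "a = shape_of \<alpha>"
  define x where "x = 1 - qb"
  have size_a: "size_of a = m" using size_shape_of[OF assms(1)] by (simp add: a_def)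
  have A: "A \<in> skew_tableaux a empty_shape" using assms(2) SYT_eq[OF assms(1)] by (simp add: a_def)
  have qm: "q_fact q m \<noteq> 0" using q by simp
  let ?N = "\<Sum>j\<le>m. x ^ j * removed_sum q (m - j) a"
  let ?Y = "\<Sum>j\<le>m. x ^ j * (real (m choose j) * total_tableaux j)"
  let ?N2 = "\<Sum>j=0..m. q_binomial q m j * q_fact q j * (1 - qb) ^ j * (\<Sum>\<mu>\<in>partitions_of j. skew_maj_gf \<alpha> \<mu> q)"
  let ?D2 = "\<Sum>j=0..m. q_fact q m * real (num_involutions j) * real (m choose j) * (1 - qb) ^ j"
  have inner: "(\<Sum>\<mu>\<in>partitions_of j. skew_maj_gf \<alpha> \<mu> q) = q_fact q (m - j) * removed_sum q (m - j) a" if "j \<le> m" for j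
  proof -
    have "(\<Sum>\<mu>\<in>partitions_of j. skew_maj_gf \<alpha> \<mu> q) = (\<Sum>\<mu>\<in>partitions_of j. skew_gf q a (shape_of \<mu>))"
      by (simp add: skew_maj_gf_eq[OF assms(1)] a_def)
    also have "\<dots> = (\<Sum>u\<in>{u. size_of u = j}. skew_gf q a u)"
      by (rule sum.reindex_bij_betw[OF shape_of_bij])
    also have "\<dots> = (\<Sum>u\<in>{u. size_of u = j}. q_fact q (m - j) * norm_gf q a u)"
      using q by (intro sum.cong refl) (simp add: norm_gf_def size_a)
    also have "{u. size_of u = j} = {u. size_of u + (m - j) = size_of a}" using that by (auto simp: size_a)
    finally show ?thesis by (simp add: removed_sum_def sum_distrib_left)
  qed
  have "?N2 = (\<Sum>j\<le>m. q_fact q m * (x ^ j * removed_sum q (m - j) a))"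
    unfolding atLeast0AtMost
  proof (rule sum.cong[OF refl])
    fix j assume "j \<in> {..m}"
    then have "j \<le> m" by simp
    then show "q_binomial q m j * q_fact q j * (1 - qb) ^ j * (\<Sum>\<mu>\<in>partitions_of j. skew_maj_gf \<alpha> \<mu> q)
        = q_fact q m * (x ^ j * removed_sum q (m - j) a)"
      using q by (simp add: inner q_binomial_def x_def)
  qed
  then have N2: "?N2 = q_fact q m * ?N" by (simp add: sum_distrib_left)
  have D2: "?D2 = q_fact q m * ?Y"
    by (simp add: atLeast0AtMost sum_distrib_left num_involutions_eq x_def mult_ac)
  have lim: "(\<lambda>n. (\<Sum>T\<in>SYT_extending n m A. q ^ maj (tab_gt m T)) / (\<Sum>T\<in>SYT_size n. q ^ maj (tab_gt m T)))
      \<longlonglongrightarrow> ?N2 / ?D2"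
  proof -
    have "?N2 / ?D2 = ?N / ?Y" unfolding N2 D2 using qm by simp
    then show ?thesis
      using extension_ratio_limit(1)[OF A size_a q, folded assms(4), folded x_def] by (simp only:)
  qed
  have split0: "(\<Sum>j=0..m. g j) = g 0 + (\<Sum>j=1..m. g j)" for g :: "nat \<Rightarrow> real"
    by (simp add: sum.atLeast_Suc_atMost)
  have pow: "(1 - qb) ^ j = (1 - qb) * (1 - qb) ^ (j - 1)" if "j \<in> {1..m}" for j
    using that by (cases j) auto
  have N1: "maj_gf \<alpha> q + (1 - qb) * E = ?N2"
    unfolding split0 assms(5) sum_distrib_left[of "1 - qb"]
    using qm by (intro arg_cong2[where f = "(+)"] sum.cong refl)
      (simp_all only: pow mult_ac, simp_all add: maj_gf_def partitions_of_0 q_binomial_def)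
  have D1: "q_fact q m + (1 - qb) * D = ?D2"
    unfolding split0 assms(6) sum_distrib_left
    by (intro arg_cong2[where f = "(+)"] sum.cong refl)
      (simp_all add: num_involutions_eq total_tableaux_0 pow mult_ac)
  show ?thesis using lim unfolding N1 D1 by simp
qed

end
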